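(* Let $\{W(\mathcal G_k)\}_{k\ge 0}$ be a random sequence of gossip matrices in $\mathbb R^{n\times n}$ satisfying Assumptions (A1)–(A4) of the context, with mean matrix $\tilde W$, mixing time $\tau$ and deviation bound $\rho$, and write $\lambda_{\max}=\lambda_{\max}(\tilde W)$ (largest eigenvalue) and $\lambda_{\min}=\lambda_{\min}^+(\tilde W)$ (smallest positive eigenvalue). Let $r(x)=\|\sqrt{\tilde W}\,x\|^2$, and let the problem of minimizing $r(x)$ over $x\in\mathbb R^n$ subject to $\sum_{j=1}^n x_{(j)}=\sum_{j=1}^n x^0_{(j)}$ be solved by the accelerated consensus algorithm of the context, started at $x^0\in\mathbb R^n$. Then for any $b\in\mathbb N$, any $$\gamma\in\left(0;\ \min\left\{\frac{3}{4\lambda_{\max}};\ \frac{\lambda_{\min}^3}{[1800\,\rho^2(\tau b^{-1}+\tau^2b^{-2})]^2}\right\}\right),$$ and $\beta,\theta,\eta,p,M,B$ satisfying $$p=\frac14,\quad \beta=\sqrt{\frac{4p^2\lambda_{\min}\gamma}{3}},\quad \eta=\frac{3\beta}{p\lambda_{\min}\gamma}=\sqrt{\frac{12}{\lambda_{\min}\gamma}},\quad \theta=\frac{p\eta^{-1}-1}{\beta p\eta^{-1}-1},$$ $$M=\max\left\{2;\ \sqrt{\frac14\left(1+\frac{2}{\beta}\right)}\right\},\quad B=\lceil b\log_2 M\rceil,$$ it holds for the iterates after $N$ iterations that $$\mathbb E\left[\|x^N-x^*\|^2+\frac{24}{\lambda_{\min}}\bigl(r(x^N_f)-r(x^* )\bigr)\right]=\mathcal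 O\left(\exp\left(-N\sqrt{\frac{p^2\lambda_{\min}\gamma}{3}}\right)\left[\|x^0-x^*\|^2+\frac{24}{\lambda_{\min}}\bigl(r(x^0)-r(x^* )\bigr)\right]\right),$$ where $x^*\in\mathbb R^n$ is the vector with $x^*_{(i)}=\frac1n\sum_{j=1}^n x^0_{(j)}$ for all $i=1,\dots,n$.
   Context: Graphs are undirected and loop-less on $n$ nodes. $\|\cdot\|$ is the Euclidean norm for vectors and the induced operator norm for matrices; $x_{(j)}$ is the $j$-th coordinate of $x\in\mathbb R^n$; $\sqrt{\tilde W}$ is the matrix square root of $\tilde W$. Gossip matrix: $W(\mathcal G)\in\mathbb R^{n\times n}$ is a gossip matrix of $\mathcal G=(\mathcal V,\mathcal E)$ if (1) $[W(\mathcal G)]_{i,j}=0$ whenever $i\ne j$ and $(i,j)\notin\mathcal E$; (2) $\ker W(\mathcal G)=\{x\in\mathbb R^n: x_1=\dots=x_n\}$. Let $G$ be the set of all graphs that may occur through time and $W_G$ the corresponding set of gossip matrices, with $\sigma$-field $W_\sigma$. Assumptions: (A1) $\{W(\mathcal G_k)\}_{k\ge0}$ is a stationary (time-homogeneous) Markov chain on $(W_G,W_\sigma)$ with Markov kernel $Q$ and unique invariant distribution $\pi$, and $Q$ is uniformly geometrically ergodic with mixing time $\tau\in\mathbb N$: for every $m\in\mathbb N$, $\sup_{W,W'\in W_G}\frac12\|Q^m(W,\cdot)-Q^m(W',\cdot)\|_{TV}\le(1/4)^{\lfloor m/\tau\rfloor}$, where $\|\cdot\|_{TV}$ is the total variation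 norm. (A2) $\mathbb E_\pi[W(\mathcal G_k)]=\tilde W$ for all $k\ge 0$. (A3) There is a connected undirected graph $\tilde{\mathcal G}$ such that $\tilde W$ is a gossip matrix of $\tilde{\mathcal G}$. (A4) $\|W(\mathcal G)-\tilde W\|\le\rho$ for every $\mathcal G\in G$. Accelerated consensus algorithm (parameters: stepsize $\gamma>0$, momentums $\theta,\eta,\beta,p$, number of iterations $N$, batch-size limit $M$, and $B$): set $x^0_f=x^0$, $T^0=0$. For $k=0,1,\dots,N-1$: - $x^k_g=\theta x^k_f+(1-\theta)x^k$; - sample $J_k\sim\mathrm{Geom}(1/2)$ (values in $\{1,2,\dots\}$; the same random seed is used on all devices); - with $g^k_j=2^{-j}B^{-1}\sum_{i=1}^{2^jB}W(\mathcal G_{T^k+i})x^k_g$, set $g^k=g^k_0+2^{J_k}(g^k_{J_k}-g^k_{J_k-1})$ if $2^{J_k}\le M$, and $g^k=g^k_0$ otherwise; - $x^{k+1}_f=x^k_g-p\gamma g^k$; - $x^{k+1}=\eta x^{k+1}_f+(p-\eta)x^k_f+(1-p)(1-\beta)x^k+(1-p)\beta x^k_g$; - $T^{k+1}=T^k+2^{J_k}B$.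
   Formalization: Every gossip matrix W(G) is additionally assumed to have zero column sums (automatic if it is symmetric); the two listed gossip-matrix properties do not imply this, and without it the sum of the coordinates is not preserved and the claim fails. *)

theory Defs
  imports "HOL-Probability.Probability"
begin

section \<open>Graphs and gossip matrices\<close>

text \<open>Graphs on the node set \<open>'n\<close> are given by their edge relation.\<close>

definition simple_graph :: "('n \<times> 'n) set \<Rightarrow> bool" where
  "simple_graph E \<longleftrightarrow> sym E \<and> irrefl E"

definition connected_graph :: "('n \<times> 'n) set \<Rightarrow> bool" where
  "connected_graph E \<longleftrightarrow> (\<forall>i j. (i, j) \<in> E\<^sup>*)"

definition gossip_matrix :: "('n::finite \<times> 'n) set \<Rightarrow> real^'n^'n \<Rightarrow> bool" where
  "gossip_matrix E A \<longleftrightarrow>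
     (\<forall>i j. i \<noteq> j \<and> (i, j) \<notin> E \<longrightarrow> A $ i $ j = 0) \<and>
     {x. A *v x = 0} = {x. \<forall>i j. x $ i = x $ j}"


section \<open>Linear algebra\<close>

definition op_norm :: "real^'n^'n \<Rightarrow> real" where
  "op_norm A = onorm (\<lambda>x. A *v x)"

definition eigenvalues :: "real^'n^'n \<Rightarrow> real set" where
  "eigenvalues A = {l. \<exists>v. v \<noteq> 0 \<and> A *v v = l *\<^sub>R v}"

definition lambda_max :: "real^'n^'n \<Rightarrow> real" where
  "lambda_max A = Max (eigenvalues A)"

definition lambda_min_pos :: "real^'n^'n \<Rightarrow> real" where
  "lambda_min_pos A = Min {l \<in> eigenvalues A. l > 0}"

definition pos_semidef :: "real^'n^'n \<Rightarrow> bool" where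
  "pos_semidef A \<longleftrightarrow> transpose A = A \<and> (\<forall>x. x \<bullet> (A *v x) \<ge> 0)"

text \<open>\<open>R\<close> is the positive semidefinite square root of \<open>A\<close>. It exists if and only if \<open>A\<close> is
  symmetric positive semidefinite, and it is then unique.\<close>

definition matrix_sqrt :: "real^'n^'n \<Rightarrow> real^'n^'n \<Rightarrow> bool" where
  "matrix_sqrt R A \<longleftrightarrow> pos_semidef R \<and> R ** R = A"


section \<open>Markov chains\<close>

text \<open>The total variation norm of the signed measure \<open>\<mu> - \<nu>\<close> (so at most 2 for probability
  measures), for finite measures on the same \<open>\<sigma>\<close>-algebra.\<close>

definition tv_norm_diff :: "'a measure \<Rightarrow> 'a measure \<Rightarrow> real" where
  "tv_norm_diff \<mu> \<nu> =
     (SUP D \<in> {D. finite D \<and> D \<subseteq> sets \<mu> \<and> partition_on (space \<mu>) D}.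
        \<Sum>A\<in>D. \<bar>measure \<mu> A - measure \<nu> A\<bar>)"

primrec kernel_power :: "'a measure \<Rightarrow> ('a \<Rightarrow> 'a measure) \<Rightarrow> nat \<Rightarrow> 'a \<Rightarrow> 'a measure" where
  "kernel_power S Q 0 x = return S x"
| "kernel_power S Q (Suc m) x = bind (kernel_power S Q m x) Q"

definition past :: "'o measure \<Rightarrow> 'a measure \<Rightarrow> (nat \<Rightarrow> 'o \<Rightarrow> 'a) \<Rightarrow> nat \<Rightarrow> 'o measure" where
  "past P S X k = sigma (space P) {X i -` A \<inter> space P | i A. i \<le> k \<and> A \<in> sets S}"

text \<open>A time-homogeneous Markov chain with state space \<open>S\<close> and kernel \<open>Q\<close>; the law of \<open>X 0\<close> is
  arbitrary.\<close>

definition markov_chain ::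
    "'o measure \<Rightarrow> 'a measure \<Rightarrow> ('a \<Rightarrow> 'a measure) \<Rightarrow> (nat \<Rightarrow> 'o \<Rightarrow> 'a) \<Rightarrow> bool" where
  "markov_chain P S Q X \<longleftrightarrow>
     Q \<in> measurable S (prob_algebra S) \<and>
     (\<forall>k. X k \<in> measurable P S) \<and>
     (\<forall>k. \<forall>A\<in>sets S. AE \<omega> in P.
        real_cond_exp P (past P S X k) (\<lambda>\<omega>. indicator A (X (Suc k) \<omega>)) \<omega> = measure (Q (X k \<omega>)) A)"

definition invariant_distribution ::
    "'a measure \<Rightarrow> ('a \<Rightarrow> 'a measure) \<Rightarrow> 'a measure \<Rightarrow> bool" where
  "invariant_distribution S Q \<pi> \<longleftrightarrow> \<pi> \<in> space (prob_algebra S) \<and> bind \<pi> Q = \<pi>"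

definition uniformly_geometrically_ergodic ::
    "'a measure \<Rightarrow> ('a \<Rightarrow> 'a measure) \<Rightarrow> nat \<Rightarrow> bool" where
  "uniformly_geometrically_ergodic S Q \<tau> \<longleftrightarrow>
     \<tau> \<ge> 1 \<and>
     (\<forall>m. \<forall>x\<in>space S. \<forall>y\<in>space S.
        1/2 * tv_norm_diff (kernel_power S Q m x) (kernel_power S Q m y) \<le> (1/4) ^ (m div \<tau>))"

text \<open>Independent variables with law \<open>Geom(1/2)\<close> on \<open>{1, 2, \<dots>}\<close>, independent of the process \<open>X\<close>.
  The library's \<open>geometric_pmf\<close> starts at 0, and its \<open>indep_var\<close>
  needs both variables to have the same type, hence the product law.\<close>

definition geometric_batches ::
    "'o measure \<Rightarrow> 'a measure \<Rightarrow> (nat \<Rightarrow> 'o \<Rightarrow> 'a) \<Rightarrow> (nat \<Rightarrow> 'o \<Rightarrow> nat) \<Rightarrow> bool" where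
  "geometric_batches P S X J \<longleftrightarrow>
     (\<forall>k. J k \<in> measurable P (count_space UNIV)) \<and>
     (\<forall>k. distr P (count_space UNIV) (J k) = measure_pmf (map_pmf Suc (geometric_pmf (1/2)))) \<and>
     prob_space.indep_vars P (\<lambda>_. count_space UNIV) J UNIV \<and>
     distr P ((\<Pi>\<^sub>M k\<in>UNIV. S) \<Otimes>\<^sub>M (\<Pi>\<^sub>M k\<in>UNIV. count_space UNIV))
         (\<lambda>\<omega>. (\<lambda>k. X k \<omega>, \<lambda>k. J k \<omega>)) =
       distr P (\<Pi>\<^sub>M k\<in>UNIV. S) (\<lambda>\<omega> k. X k \<omega>) \<Otimes>\<^sub>M
       distr P (\<Pi>\<^sub>M k\<in>UNIV. count_space UNIV) (\<lambda>\<omega> k. J k \<omega>)"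


section \<open>The accelerated consensus algorithm\<close>

text \<open>Everything here is for one realisation \<open>w\<close> of the matrices and \<open>J\<close> of the batch exponents.\<close>

definition batch_mean :: "(nat \<Rightarrow> real^'n^'n) \<Rightarrow> nat \<Rightarrow> nat \<Rightarrow> real^'n \<Rightarrow> nat \<Rightarrow> real^'n" where
  "batch_mean w B T x j = (1 / (2 ^ j * real B)) *\<^sub>R (\<Sum>i=1..2 ^ j * B. w (T + i) *v x)"

definition mlmc_estimate ::
    "(nat \<Rightarrow> real^'n^'n) \<Rightarrow> real \<Rightarrow> nat \<Rightarrow> nat \<Rightarrow> real^'n \<Rightarrow> nat \<Rightarrow> real^'n" where
  "mlmc_estimate w M B T x j =
     (if 2 ^ j \<le> M
      then batch_mean w B T x 0 + 2 ^ j *\<^sub>R (batch_mean w B T x j - batch_mean w B T x (j - 1))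
      else batch_mean w B T x 0)"

text \<open>The state after \<open>k\<close> iterations is \<open>(x\<^sup>k, x\<^sub>f\<^sup>k, T\<^sup>k)\<close>.\<close>

primrec acc_consensus ::
    "real \<Rightarrow> real \<Rightarrow> real \<Rightarrow> real \<Rightarrow> real \<Rightarrow> real \<Rightarrow> nat \<Rightarrow> real^'n \<Rightarrow>
     (nat \<Rightarrow> real^'n^'n) \<Rightarrow> (nat \<Rightarrow> nat) \<Rightarrow> nat \<Rightarrow> (real^'n) \<times> (real^'n) \<times> nat" where
  "acc_consensus \<gamma> \<theta> \<eta> \<beta> p M B x\<^sub>0 w J 0 = (x\<^sub>0, x\<^sub>0, 0)"
| "acc_consensus \<gamma> \<theta> \<eta> \<beta> p M B x\<^sub>0 w J (Suc k) =
     (let (x, x\<^sub>f, T) = acc_consensus \<gamma> \<theta> \<eta> \<beta> p M B x\<^sub>0 w J k;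
          x\<^sub>g = \<theta> *\<^sub>R x\<^sub>f + (1 - \<theta>) *\<^sub>R x;
          g = mlmc_estimate w M B T x\<^sub>g (J k);
          x\<^sub>f' = x\<^sub>g - (p * \<gamma>) *\<^sub>R g
      in (\<eta> *\<^sub>R x\<^sub>f' + (p - \<eta>) *\<^sub>R x\<^sub>f + ((1 - p) * (1 - \<beta>)) *\<^sub>R x + ((1 - p) * \<beta>) *\<^sub>R x\<^sub>g,
          x\<^sub>f',
          T + 2 ^ J k * B))"

text \<open>\<open>\<parallel>x - x\<^sup>*\<parallel>\<^sup>2 + (24 / \<lambda>) (r(x\<^sub>f) - r(x\<^sup>*))\<close> for \<open>r(x) = \<parallel>R x\<parallel>\<^sup>2\<close>.\<close>

definition consensus_gap ::
    "real^'n^'n \<Rightarrow> real \<Rightarrow> real^'n \<Rightarrow> real^'n \<Rightarrow> real^'n \<Rightarrow> real" where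
  "consensus_gap R l xs x x\<^sub>f =
     (norm (x - xs))\<^sup>2 + 24 / l * ((norm (R *v x\<^sub>f))\<^sup>2 - (norm (R *v xs))\<^sup>2)"

definition average_vec :: "real^'n \<Rightarrow> real^'n" where
  "average_vec x = (\<chi> i. (\<Sum>j\<in>UNIV. x $ j) / real CARD('n))"

end

theory Submission
  imports Defs
begin

text \<open>
  \<^bold>\<open>Reduction.\<close> Every gossip matrix annihilates the constant vectors and has vanishing column
  sums, so the algorithm commutes with translation by \<open>x\<^sup>*\<close> and, started at a mean-zero vector,
  stays in the mean-zero subspace. We may take \<open>x\<^sup>* = 0\<close>. On that subspace the mean matrix
  \<open>Wt\<close> lies between its smallest positive eigenvalue \<open>\<lambda>\<close> and its largest one.

  \<^bold>\<open>One step.\<close> The prescribed parameters amount to \<open>\<eta> = 1 / \<beta>\<close> and \<open>\<lambda> \<gamma> = 12 \<beta>\<^sup>2\<close>. With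
  \<open>z = x\<^sub>g\<close>, \<open>q = (x - x\<^sub>f) / (4 - \<beta>\<^sup>2)\<close> and \<open>s = 3 \<beta> / \<lambda>\<close>, an iteration takes
  \<open>x = z + (4 - \<beta>) q\<close>, \<open>x\<^sub>f = z - \<beta> (1 - \<beta>) q\<close> to
  \<open>z + (4 - \<beta>) (1 - \<beta>) q - s g\<close>, \<open>z - \<beta> s g\<close> (lemma \<open>acc_consensus_step\<close>), so that all
  coefficients are polynomial in \<open>\<beta>\<close>. We measure progress by
  \<open>\<Phi> = \<parallel>x + x\<^sub>f\<parallel>\<^sup>2 + 12 \<langle>x\<^sub>f, Wt x\<^sub>f\<rangle> / \<lambda>\<close>. The cross term \<open>2 \<langle>x, x\<^sub>f\<rangle>\<close> in \<open>\<Phi>\<close> is what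
  makes the claimed rate reachable: to first order in \<open>\<beta>\<close>, \<open>x\<^sub>f\<close> relaxes towards \<open>x\<close> at rate
  \<open>\<beta> / 4\<close>, so a sum of a term in \<open>x\<close> and a term in \<open>x\<^sub>f\<close> cannot decrease by more than the
  factor \<open>1 - \<beta> / 2\<close> and leaves nothing with which to pay for the noise. With the cross term the
  noiseless step decreases \<open>\<Phi>\<close> by more than this factor, and the surplus dominates the noise
  (\<open>lyapunov_contraction\<close>). As \<open>\<Phi>\<close> and the gap of the theorem differ by constant factors
  (\<open>lyapunov_gap_equivalence\<close>), nothing is lost but a constant.

  \<^bold>\<open>Noise.\<close> Since \<open>W - Wt\<close> annihilates constants and is bounded by \<open>\<rho>\<close>, the error of the gradient
  estimate is proportional to the distance to consensus. Geometric mixing decorrelates the deviations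
  at times that are more than \<open>\<tau>\<close> apart (\<open>deviation_decorrelation\<close>), so a batch of length \<open>n\<close>
  has bias of order \<open>\<tau> \<rho> / n\<close> and variance of order \<open>\<tau> \<rho>\<^sup>2 / n\<close> (\<open>batch_bias\<close>,
  \<open>batch_variance\<close>). In expectation over the level the multilevel estimate telescopes to the batch of
  length about \<open>M B\<close>, so its bias is that of the longest batch, whereas its variance
  grows only by the number \<open>log\<^sub>2 M\<close> of levels, which the choice of \<open>B\<close> compensates. The bound on
  \<open>\<gamma>\<close> makes both small enough for the surplus above; this gives \<open>expected_contraction\<close>.

  \<^bold>\<open>Averaging.\<close> The levels are independent of the chain. For fixed levels the times at which the
  batches start are deterministic, so that the Markov property applies; integrating over the
  levels afterwards, one coordinate at a time, iterates the contraction
  (\<open>expected_potential_eq\<close>, \<open>averaged_potential_decay\<close>).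
\<close>

section \<open>The spectrum of a symmetric matrix on the mean-zero subspace\<close>

lemma symmetric_inner:
  fixes A :: "real^'n^'n"
  assumes "transpose A = A"
  shows "x \<bullet> (A *v y) = (A *v x) \<bullet> y"
  by (metis assms dot_lmul_matrix vector_transpose_matrix)

text \<open>Eigenvectors of distinct eigenvalues are orthogonal, hence linearly independent. Finiteness is
  what gives \<open>Max\<close> and \<open>Min\<close> of the set of eigenvalues their meaning.\<close>

lemma finite_eigenvalues_symmetric:
  fixes A :: "real^'n^'n"
  assumes sym: "transpose A = A"
  shows "finite (eigenvalues A)"
proof -
  \<comment> \<open>one eigenvector for each eigenvalue\<close>
  define v where "v l = (SOME x. x \<noteq> 0 \<and> A *v x = l *\<^sub>R x)" for l
  have v: "v l \<noteq> 0 \<and> A *v v l = l *\<^sub>R v l" if "l \<in> eigenvalues A" for l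
    using that someI_ex[of "\<lambda>x. x \<noteq> 0 \<and> A *v x = l *\<^sub>R x"] unfolding v_def eigenvalues_def by auto
  have orth: "v l \<bullet> v m = 0" if "l \<in> eigenvalues A" "m \<in> eigenvalues A" "l \<noteq> m" for l m
  proof -
    have "l * (v l \<bullet> v m) = (A *v v l) \<bullet> v m" using v[OF that(1)] by simp
    also have "\<dots> = v l \<bullet> (A *v v m)" by (rule symmetric_inner[OF sym, symmetric])
    also have "\<dots> = m * (v l \<bullet> v m)" using v[OF that(2)] by simp
    finally show ?thesis using that(3) by auto
  qed
  have inj: "inj_on v (eigenvalues A)"
    by (rule inj_onI) (metis orth v inner_eq_zero_iff)
  have "pairwise orthogonal (v ` eigenvalues A)"
    unfolding pairwise_def orthogonal_def by (auto simp: orth) (metis orth)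
  moreover have "0 \<notin> v ` eigenvalues A" using v by auto
  ultimately have "independent (v ` eigenvalues A)" by (rule pairwise_orthogonal_independent)
  then have "finite (v ` eigenvalues A)" by (rule finiteI_independent)
  then show ?thesis using inj by (rule finite_imageD)
qed

text \<open>A minimiser of the Rayleigh quotient over the unit sphere of an invariant subspace is an
  eigenvector: moving from it in the direction of its residual \<open>A v - l v\<close> would otherwise decrease
  the quotient to first order.\<close>

lemma symmetric_minimal_eigenvalue:
  fixes A :: "real^'n^'n"
  assumes sym: "transpose A = A" and V: "subspace V" "\<And>x. x \<in> V \<Longrightarrow> A *v x \<in> V"
    and ne: "\<exists>x\<in>V. x \<noteq> 0"
  shows "\<exists>l v. v \<in> V \<and> v \<noteq> 0 \<and> A *v v = l *\<^sub>R v \<and> (\<forall>x\<in>V. l * (x \<bullet> x) \<le> x \<bullet> (A *v x))"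
proof -
  let ?S = "sphere 0 1 \<inter> V"
  have cs: "compact ?S" using V(1) by (intro compact_Int_closed closed_subspace) auto
  obtain y where y: "y \<in> V" "y \<noteq> 0" using ne by auto
  then have "(1 / norm y) *\<^sub>R y \<in> ?S" using V(1) by (auto simp: subspace_scale)
  then have nes: "?S \<noteq> {}" by blast
  have "continuous_on ?S (\<lambda>x. x \<bullet> (A *v x))"
    by (intro continuous_intros matrix_vector_mult_linear_continuous_on)
  from continuous_attains_inf[OF cs nes this]
  obtain v where v: "v \<in> ?S" and vmin: "\<And>x. x \<in> ?S \<Longrightarrow> v \<bullet> (A *v v) \<le> x \<bullet> (A *v x)" by auto
  define l where "l = v \<bullet> (A *v v)"
  have vV: "v \<in> V" and vn: "norm v = 1" using v by auto
  have min: "l * (x \<bullet> x) \<le> x \<bullet> (A *v x)" if x: "x \<in> V" for x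
  proof (cases "x = 0")
    case False
    have "(1 / norm x) *\<^sub>R x \<in> ?S" using False x V(1) by (auto simp: subspace_scale)
    from vmin[OF this] have "l \<le> (1 / norm x)^2 * (x \<bullet> (A *v x))"
      by (simp add: l_def matrix_vector_mult_scaleR power2_eq_square)
    then have "l * (norm x)^2 \<le> x \<bullet> (A *v x)" using False by (simp add: field_simps power2_eq_square)
    then show ?thesis by (simp add: power2_norm_eq_inner)
  qed simp
  define w where "w = A *v v - l *\<^sub>R v"
  have wV: "w \<in> V" unfolding w_def using V vV by (auto intro: subspace_diff subspace_scale)
  note symi = symmetric_inner[OF sym]
  \<comment> \<open>first-order optimality of \<open>v\<close> in the direction of its residual \<open>w\<close>\<close>
  define c where "c = w \<bullet> (A *v w) - l * (w \<bullet> w)"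
  have quad: "0 \<le> 2 * t * (w \<bullet> w) + t^2 * c" for t
  proof -
    have "v + t *\<^sub>R w \<in> V" using V(1) vV wV by (auto intro: subspace_add subspace_scale)
    from min[OF this] have "0 \<le> (v + t *\<^sub>R w) \<bullet> (A *v (v + t *\<^sub>R w)) - l * ((v + t *\<^sub>R w) \<bullet> (v + t *\<^sub>R w))"
      by simp
    also have "\<dots> = (v \<bullet> (A *v v) - l * (v \<bullet> v)) + 2 * t * (w \<bullet> (A *v v) - l * (w \<bullet> v)) + t^2 * c"
      unfolding c_def using symi[of v w]
      by (simp add: matrix_vector_right_distrib matrix_vector_mult_scaleR inner_simps algebra_simps
          inner_commute power2_eq_square)
    also have "v \<bullet> (A *v v) - l * (v \<bullet> v) = 0"
      using vn by (simp add: l_def power2_norm_eq_inner[symmetric])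
    also have "w \<bullet> (A *v v) - l * (w \<bullet> v) = w \<bullet> w"
      using inner_diff_right[of w "A *v v" "l *\<^sub>R v"] by (simp add: w_def[symmetric])
    finally show ?thesis by simp
  qed
  have "w \<bullet> w = 0"
  proof (rule ccontr)
    assume "w \<bullet> w \<noteq> 0"
    then have p: "w \<bullet> w > 0" by simp
    \<comment> \<open>small enough for the linear term of \<open>quad\<close> to dominate, whatever the sign of \<open>c\<close>\<close>
    define t where "t = - (w \<bullet> w) / (\<bar>c\<bar> + w \<bullet> w)"
    have d: "\<bar>c\<bar> + w \<bullet> w > 0" using p by linarith
    have tn: "t < 0" unfolding t_def using p d by (simp add: divide_neg_pos)
    have "t^2 * c \<le> t^2 * (\<bar>c\<bar> + w \<bullet> w)" using p abs_ge_self[of c] by (intro mult_left_mono) (linarith | simp)+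
    also have "\<dots> = - t * (w \<bullet> w)" unfolding t_def power2_eq_square using d by simp
    finally have "t^2 * c \<le> - t * (w \<bullet> w)" .
    then have "t^2 * c \<le> - (t * (w \<bullet> w))" by (simp only: mult_minus_left)
    moreover have "2 * t * (w \<bullet> w) = 2 * (t * (w \<bullet> w))" by simp
    ultimately have "0 \<le> t * (w \<bullet> w)" using quad[of t] by linarith
    then show False using tn p using mult_neg_pos[OF tn p] by linarith
  qed
  then have "w = 0" by (simp only: inner_eq_zero_iff)
  then have eig: "A *v v = l *\<^sub>R v" unfolding w_def by (simp only: right_minus_eq)
  have v0: "v \<noteq> 0" using vn by auto
  show ?thesis by (rule exI[of _ l], rule exI[of _ v], intro conjI ballI vV v0 eig min)
qed

lemma matrix_sqrt_inner:
  assumes "matrix_sqrt R A"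
  shows "x \<bullet> (A *v y) = (R *v x) \<bullet> (R *v y)"
proof -
  have R: "transpose R = R" "R ** R = A" using assms unfolding matrix_sqrt_def pos_semidef_def by blast+
  have "A *v y = R *v (R *v y)" unfolding R(2)[symmetric] by (rule matrix_vector_mul_assoc[symmetric])
  then have "x \<bullet> (A *v y) = (x v* R) \<bullet> (R *v y)" by (simp only: dot_lmul_matrix)
  also have "x v* R = R *v x" using vector_transpose_matrix[of x R] unfolding R(1) .
  finally show ?thesis .
qed

lemma matrix_sqrt_transpose:
  assumes "matrix_sqrt R A"
  shows "transpose A = A"
proof -
  have R: "transpose R = R" "R ** R = A" using assms unfolding matrix_sqrt_def pos_semidef_def by blast+
  show ?thesis unfolding R(2)[symmetric] matrix_transpose_mul R(1) ..
qed

lemma mean_zero_subspace: "subspace {x :: real^'n. 1 \<bullet> x = 0}"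
  by (simp add: subspace_def inner_simps)

context
  fixes A R :: "real^'n^'n"
  assumes sqrt: "matrix_sqrt R A"
    and ker: "{x. A *v x = 0} = {x. \<forall>i j. x $ i = x $ j}"
    and pos: "lambda_max A > 0"
begin

lemma zero_is_eigenvalue: "0 \<in> eigenvalues A"
proof -
  have "(1 :: real^'n) \<in> {x. A *v x = 0}" unfolding ker by simp
  then have "A *v 1 = 0 *\<^sub>R 1" by (simp only: mem_Collect_eq scale_zero_left)
  moreover have "(1 :: real^'n) \<noteq> 0" by (simp add: vec_eq_iff)
  ultimately show ?thesis unfolding eigenvalues_def by blast
qed

lemma lambda_min_pos_positive: "lambda_min_pos A > 0"
proof -
  have fin: "finite (eigenvalues A)" by (rule finite_eigenvalues_symmetric[OF matrix_sqrt_transpose[OF sqrt]])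
  have "lambda_max A \<in> eigenvalues A"
    unfolding lambda_max_def using fin zero_is_eigenvalue by (intro Max_in) auto
  then have "{l \<in> eigenvalues A. l > 0} \<noteq> {}" using pos by auto
  then have "lambda_min_pos A \<in> {l \<in> eigenvalues A. l > 0}"
    unfolding lambda_min_pos_def using fin by (intro Min_in) auto
  then show ?thesis by simp
qed

text \<open>The minimal eigenvalue of \<open>- A\<close> on the whole space.\<close>

lemma rayleigh_upper: "x \<bullet> (A *v x) \<le> lambda_max A * (x \<bullet> x)"
proof -
  have A: "transpose A = A" by (rule matrix_sqrt_transpose[OF sqrt])
  have "transpose (- A) = - A" using A by (simp add: transpose_def vec_eq_iff)
  moreover have "\<exists>x\<in>(UNIV :: (real^'n) set). x \<noteq> 0" by (rule bexI[of _ 1]) (auto simp: vec_eq_iff)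
  ultimately have "\<exists>l v. v \<in> UNIV \<and> v \<noteq> 0 \<and> - A *v v = l *\<^sub>R v \<and> (\<forall>x\<in>UNIV. l * (x \<bullet> x) \<le> x \<bullet> (- A *v x))"
    by (rule symmetric_minimal_eigenvalue[OF _ subspace_UNIV UNIV_I])
  then obtain l v where v: "v \<noteq> 0" "- A *v v = l *\<^sub>R v" "\<And>x. l * (x \<bullet> x) \<le> x \<bullet> (- A *v x)"
    by auto
  have m: "- A *v x = - (A *v x)" for x
    by (simp add: matrix_vector_mult_def vec_eq_iff sum_negf)
  have eq: "- (A *v v) = l *\<^sub>R v" using v(2) unfolding m .
  have "A *v v = (- l) *\<^sub>R v" by (simp add: eq[symmetric])
  then have "- l \<in> eigenvalues A" using v(1) unfolding eigenvalues_def by auto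
  then have "- l \<le> lambda_max A"
    unfolding lambda_max_def using finite_eigenvalues_symmetric[OF A] by (intro Max_ge)
  then have "- l * (x \<bullet> x) \<le> lambda_max A * (x \<bullet> x)" by (intro mult_right_mono) auto
  then show ?thesis using v(3)[of x] m[of x] by simp
qed

text \<open>The minimal eigenvalue on the mean-zero subspace is nonnegative by semidefiniteness, and it is not
  \<open>0\<close> because the kernel consists of the constant vectors; so it is one of the positive eigenvalues.\<close>

lemma rayleigh_lower:
  assumes x: "1 \<bullet> x = 0"
  shows "lambda_min_pos A * (x \<bullet> x) \<le> x \<bullet> (A *v x)"
proof (cases "x = 0")
  case False
  have A: "transpose A = A" by (rule matrix_sqrt_transpose[OF sqrt])
  have A1: "A *v 1 = 0" using ker by (auto simp: set_eq_iff)
  note symi = symmetric_inner[OF A]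
  let ?V = "{x :: real^'n. 1 \<bullet> x = 0}"
  have inv: "A *v y \<in> ?V" if "y \<in> ?V" for y using symi[of 1 y] A1 by simp
  have "\<exists>x\<in>?V. x \<noteq> 0" using x False by auto
  from symmetric_minimal_eigenvalue[OF A mean_zero_subspace inv this]
  obtain l v where v: "v \<in> ?V" "v \<noteq> 0" "A *v v = l *\<^sub>R v"
      "\<And>x. x \<in> ?V \<Longrightarrow> l * (x \<bullet> x) \<le> x \<bullet> (A *v x)" by auto
  have "l * (v \<bullet> v) = (R *v v) \<bullet> (R *v v)" using v(3) matrix_sqrt_inner[OF sqrt, of v v] by simp
  then have "l * (v \<bullet> v) \<ge> 0" by simp
  moreover have "v \<bullet> v > 0" using v(2) by simp
  ultimately have l0: "l \<ge> 0" by (simp add: zero_le_mult_iff)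
  have "l \<noteq> 0"
  proof
    assume "l = 0"
    then have "v \<in> {x. A *v x = 0}" using v(3) by simp
    then have c: "v $ i = v $ j" for i j unfolding ker by auto
    define k :: 'n where "k = undefined"
    have vk: "v = v $ k *\<^sub>R 1" unfolding vec_eq_iff using c by simp
    have "1 \<bullet> (v $ k *\<^sub>R (1 :: real^'n)) = 0" using v(1) by (simp only: vk[symmetric] mem_Collect_eq)
    then have "v $ k * (1 \<bullet> (1 :: real^'n)) = 0" by (simp only: inner_scaleR_right)
    moreover have "(1 :: real^'n) \<noteq> 0" by (simp add: vec_eq_iff)
    ultimately have z: "v $ k = 0" by simp
    have "v = 0" using vk unfolding z by simp
    then show False using v(2) by simp
  qed
  then have "l \<in> {l \<in> eigenvalues A. l > 0}" using l0 v unfolding eigenvalues_def by auto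
  then have "lambda_min_pos A \<le> l"
    unfolding lambda_min_pos_def using finite_eigenvalues_symmetric[OF A] by (intro Min_le) auto
  then have "lambda_min_pos A * (x \<bullet> x) \<le> l * (x \<bullet> x)" by (intro mult_right_mono) auto
  then show ?thesis using v(4)[of x] x by simp
qed simp

end

lemma lambda_min_pos_le_max:
  fixes A R :: "real^'n^'n"
  assumes "matrix_sqrt R A" "{x. A *v x = 0} = {x. \<forall>i j. x $ i = x $ j}" and pos: "lambda_max A > 0"
  shows "lambda_min_pos A \<le> lambda_max A"
proof -
  have fin: "finite (eigenvalues A)" by (rule finite_eigenvalues_symmetric[OF matrix_sqrt_transpose[OF assms(1)]])
  have "lambda_max A \<in> eigenvalues A"
    unfolding lambda_max_def using fin zero_is_eigenvalue[OF assms] by (intro Max_in) auto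
  then show ?thesis unfolding lambda_min_pos_def using fin pos by (intro Min_le) auto
qed

text \<open>With \<open>A = R\<^sup>2\<close> one has \<open>\<parallel>A y\<parallel>\<^sup>2 = \<langle>R y, A (R y)\<rangle>\<close>, so two applications of the Rayleigh bound
  suffice.\<close>

lemma norm_matrix_le_lambda_max:
  fixes A R :: "real^'n^'n"
  assumes sqrt: "matrix_sqrt R A" and "{x. A *v x = 0} = {x. \<forall>i j. x $ i = x $ j}" and pos: "lambda_max A > 0"
  shows "norm (A *v y) \<le> lambda_max A * norm y"
proof -
  let ?L = "lambda_max A"
  have RR: "R ** R = A" using sqrt unfolding matrix_sqrt_def by blast
  have A: "A *v x = R *v (R *v x)" for x unfolding RR[symmetric] by (rule matrix_vector_mul_assoc[symmetric])
  note s = symmetric_inner[OF matrix_sqrt_transpose[OF sqrt]]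
  have "(A *v y) \<bullet> (A *v y) = y \<bullet> (A *v (A *v y))" by (rule s[symmetric])
  also have "\<dots> = (R *v y) \<bullet> (R *v (A *v y))" by (rule matrix_sqrt_inner[OF sqrt])
  also have "R *v (A *v y) = A *v (R *v y)" by (simp only: A)
  also have "(R *v y) \<bullet> (A *v (R *v y)) \<le> ?L * ((R *v y) \<bullet> (R *v y))" by (rule rayleigh_upper[OF assms])
  also have "(R *v y) \<bullet> (R *v y) = y \<bullet> (A *v y)" by (rule matrix_sqrt_inner[OF sqrt, symmetric])
  also have "?L * (y \<bullet> (A *v y)) \<le> ?L * (?L * (y \<bullet> y))" using pos by (intro mult_left_mono rayleigh_upper[OF assms]) auto
  finally have "(norm (A *v y))\<^sup>2 \<le> (?L * norm y)\<^sup>2"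
    by (simp add: power2_norm_eq_inner power_mult_distrib power2_eq_square[of ?L] mult.assoc)
  then show ?thesis by (rule power2_le_imp_le) (use pos in simp)
qed

lemma mean_zero_minus_average:
  fixes x :: "real^'n"
  shows "1 \<bullet> (x - average_vec x) = 0"
  by (simp add: inner_vec_def average_vec_def sum_subtractf)

section \<open>Bounded functions and the total variation norm\<close>

text \<open>Rounding \<open>f\<close> down to multiples of \<open>e\<close>. It transfers statements about sets, in which both
  the total variation norm and the Markov property are phrased, to bounded functions.\<close>

lemma uniform_step_approximation:
  fixes f :: "'a \<Rightarrow> real"
  assumes f [measurable]: "f \<in> borel_measurable S" and bd: "\<And>x. x \<in> space S \<Longrightarrow> \<bar>f x\<bar> \<le> c" and e: "e > 0"
  obtains D a where "finite D" "D \<subseteq> sets S" "partition_on (space S) D" "\<And>A. A \<in> D \<Longrightarrow> \<bar>a A\<bar> \<le> c + e"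
    "\<And>x. x \<in> space S \<Longrightarrow> \<bar>f x - (\<Sum>A\<in>D. a A * indicator A x)\<bar> \<le> e"
proof -
  define k where "k x = \<lfloor>f x / e\<rfloor>" for x
  define A where "A i = {x \<in> space S. k x = i}" for i
  define D where "D = A ` k ` space S"
  define a where "a B = e * of_int (k (SOME x. x \<in> B))" for B
  have kb: "\<bar>e * of_int (k x) - f x\<bar> \<le> e" for x
  proof -
    have "of_int (k x) \<le> f x / e" "f x / e < of_int (k x) + 1" unfolding k_def by linarith+
    then show ?thesis using e by (simp add: abs_le_iff field_simps)
  qed
  have kfin: "finite (k ` space S)"
  proof (rule finite_subset)
    show "k ` space S \<subseteq> {\<lfloor>- c / e\<rfloor>..\<lfloor>c / e\<rfloor>}"
    proof
      fix i assume "i \<in> k ` space S"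
      then obtain x where x: "x \<in> space S" "i = k x" by auto
      have "- c \<le> f x" "f x \<le> c" using bd[OF x(1)] by auto
      then have "- c / e \<le> f x / e" "f x / e \<le> c / e" using e divide_right_mono[of "- c" "f x" e] divide_right_mono[of "f x" c e] by auto
      then show "i \<in> {\<lfloor>- c / e\<rfloor>..\<lfloor>c / e\<rfloor>}" unfolding x k_def by (auto intro: floor_mono)
    qed
  qed simp
  have kA: "k x = i" if "x \<in> A i" for x i using that by (simp add: A_def)
  have aA: "a (A i) = e * of_int i" if "i \<in> k ` space S" for i
  proof -
    have "\<exists>x. x \<in> A i" using that by (auto simp: A_def)
    then have "(SOME x. x \<in> A i) \<in> A i" by (rule someI_ex)
    from kA[OF this] show ?thesis by (simp add: a_def)
  qed
  have "finite D" using kfin by (simp add: D_def)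
  moreover have "D \<subseteq> sets S" unfolding D_def A_def k_def by auto
  moreover have "partition_on (space S) D"
    unfolding D_def by (rule partition_onI) (auto simp: A_def disjnt_def)
  moreover have "\<bar>a B\<bar> \<le> c + e" if "B \<in> D" for B
  proof -
    obtain x where x: "x \<in> space S" "B = A (k x)" using \<open>B \<in> D\<close> unfolding D_def by (elim imageE) auto
    then show ?thesis using aA[of "k x"] kb[of x] bd[OF x(1)] by auto
  qed
  moreover have "\<bar>f x - (\<Sum>B\<in>D. a B * indicator B x)\<bar> \<le> e" if x: "x \<in> space S" for x
  proof -
    have "(\<Sum>B\<in>D. a B * indicator B x) = (\<Sum>B\<in>D. if B = A (k x) then a B else 0)"
    proof (rule sum.cong)
      fix B assume "B \<in> D"
      then obtain i where i: "B = A i" "i \<in> k ` space S" by (auto simp: D_def)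
      show "a B * indicator B x = (if B = A (k x) then a B else 0)"
      proof (cases "i = k x")
        case True then show ?thesis using x i by (simp add: A_def)
      next
        case False
        then have "x \<notin> B" using i kA by auto
        moreover have "B \<noteq> A (k x)" using False i x kA[of x "k x"] \<open>x \<notin> B\<close> by (auto simp: A_def)
        ultimately show ?thesis by simp
      qed
    qed simp
    also have "\<dots> = a (A (k x))" using \<open>finite D\<close> x by (subst sum.delta) (auto simp: D_def)
    also have "\<dots> = e * of_int (k x)" using x by (intro aA) auto
    finally show ?thesis using kb[of x] by linarith
  qed
  ultimately show ?thesis by (rule that)
qed

lemma (in prob_space) integrable_bounded_real:
  assumes "f \<in> borel_measurable M" "\<And>x. x \<in> space M \<Longrightarrow> \<bar>f x\<bar> \<le> (c::real)"
  shows "integrable M f"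
  using assms by (intro integrable_const_bound[where B=c]) auto

lemma (in prob_space) abs_expectation_le:
  assumes "f \<in> borel_measurable M" "\<And>x. x \<in> space M \<Longrightarrow> \<bar>f x\<bar> \<le> (c::real)"
  shows "\<bar>expectation f\<bar> \<le> c"
proof -
  have i: "integrable M f" using assms by (rule integrable_bounded_real)
  have "\<bar>expectation f\<bar> \<le> expectation (\<lambda>x. \<bar>f x\<bar>)" by (rule integral_abs_bound)
  also have "\<dots> \<le> expectation (\<lambda>x. c)" using i assms(2) by (intro integral_mono) auto
  finally show ?thesis by (simp add: prob_space)
qed

lemma (in prob_space) expectation_step_function:
  assumes D: "finite D" "D \<subseteq> sets M"
  shows "expectation (\<lambda>x. \<Sum>A\<in>D. a A * indicator A x) = (\<Sum>A\<in>D. a A * prob A)"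
proof -
  have "expectation (\<lambda>x. \<Sum>A\<in>D. a A * indicator A x) = (\<Sum>A\<in>D. expectation (\<lambda>x. a A * indicator A x))"
    using D by (intro Bochner_Integration.integral_sum integrable_mult_right integrable_real_indicator) (auto simp: less_top[symmetric])
  also have "\<dots> = (\<Sum>A\<in>D. a A * prob A)"
    using D by (intro sum.cong) (auto intro!: arg_cong[where f = prob] dest: sets.sets_into_space)
  finally show ?thesis .
qed

lemma (in prob_space)
  fixes g h :: "'a \<Rightarrow> real"
  assumes m: "h \<in> borel_measurable M" "g \<in> borel_measurable M"
    and b: "\<And>x. x \<in> space M \<Longrightarrow> \<bar>h x\<bar> \<le> c" "\<And>x. x \<in> space M \<Longrightarrow> \<bar>g x\<bar> \<le> d"
  shows integrable_mult_bounded: "integrable M (\<lambda>x. h x * g x)"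
    and abs_expectation_mult_le: "\<bar>expectation (\<lambda>x. h x * g x)\<bar> \<le> c * d"
proof -
  have bd: "\<bar>h x * g x\<bar> \<le> c * d" if "x \<in> space M" for x
    unfolding abs_mult using b(1)[OF that] b(2)[OF that] by (intro mult_mono) auto
  have mm: "(\<lambda>x. h x * g x) \<in> borel_measurable M" using m by measurable
  show "integrable M (\<lambda>x. h x * g x)" by (rule integrable_bounded_real[OF mm bd])
  show "\<bar>expectation (\<lambda>x. h x * g x)\<bar> \<le> c * d" by (rule abs_expectation_le[OF mm bd])
qed

text \<open>The content is that the supremum defining the norm is over a bounded set, since each sum is at most
  \<open>2\<close>, the total mass of both measures.\<close>

lemma tv_norm_diff_upper:
  assumes mu: "\<mu> \<in> space (prob_algebra S)" and nu: "\<nu> \<in> space (prob_algebra S)"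
    and D: "finite D" "D \<subseteq> sets S" "partition_on (space S) D"
  shows "(\<Sum>A\<in>D. \<bar>measure \<mu> A - measure \<nu> A\<bar>) \<le> tv_norm_diff \<mu> \<nu>"
proof -
  interpret mu: prob_space \<mu> using mu by (simp add: space_prob_algebra)
  interpret nu: prob_space \<nu> using nu by (simp add: space_prob_algebra)
  have s: "sets \<mu> = sets S" "sets \<nu> = sets S" using mu nu by (simp_all add: space_prob_algebra)
  have sp: "space \<mu> = space S" using s sets_eq_imp_space_eq by blast
  let ?X = "{D. finite D \<and> D \<subseteq> sets \<mu> \<and> partition_on (space \<mu>) D}"
  have "bdd_above ((\<lambda>D. \<Sum>A\<in>D. \<bar>measure \<mu> A - measure \<nu> A\<bar>) ` ?X)"
  proof (rule bdd_aboveI2)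
    fix D assume D: "D \<in> ?X"
    then have dj: "disjoint_family_on (\<lambda>A. A) D" by (auto simp: partition_on_def disjoint_def disjoint_family_on_def)
    have "(\<Sum>A\<in>D. \<bar>measure \<mu> A - measure \<nu> A\<bar>) \<le> (\<Sum>A\<in>D. measure \<mu> A + measure \<nu> A)"
      by (intro sum_mono) (auto simp: abs_le_iff add_increasing add_increasing2)
    also have "\<dots> = measure \<mu> (\<Union>A\<in>D. A) + measure \<nu> (\<Union>A\<in>D. A)"
      using D s mu.finite_measure_finite_Union[OF _ _ dj] nu.finite_measure_finite_Union[OF _ _ dj]
      by (simp add: sum.distrib)
    also have "\<dots> \<le> 2" using add_mono[OF mu.prob_le_1 nu.prob_le_1] by simp
    finally show "(\<Sum>A\<in>D. \<bar>measure \<mu> A - measure \<nu> A\<bar>) \<le> 2" .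
  qed
  then show ?thesis unfolding tv_norm_diff_def using D s sp by (intro cSUP_upper) auto
qed

lemma integral_diff_le_tv_norm_diff:
  fixes f :: "'a \<Rightarrow> real"
  assumes mu: "\<mu> \<in> space (prob_algebra S)" and nu: "\<nu> \<in> space (prob_algebra S)"
    and f [measurable]: "f \<in> borel_measurable S" and bd: "\<And>x. x \<in> space S \<Longrightarrow> \<bar>f x\<bar> \<le> c"
  shows "\<bar>(\<integral>x. f x \<partial>\<mu>) - (\<integral>x. f x \<partial>\<nu>)\<bar> \<le> c * tv_norm_diff \<mu> \<nu>"
proof (rule field_le_epsilon)
  fix e' :: real assume e': "e' > 0"
  interpret mu: prob_space \<mu> using mu by (simp add: space_prob_algebra)
  interpret nu: prob_space \<nu> using nu by (simp add: space_prob_algebra)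
  have s [measurable_cong]: "sets \<mu> = sets S" "sets \<nu> = sets S" using mu nu by (simp_all add: space_prob_algebra)
  have sp: "space \<mu> = space S" "space \<nu> = space S" using s sets_eq_imp_space_eq by blast+
  let ?tv = "tv_norm_diff \<mu> \<nu>"
  have "\<mu> \<in> space (prob_algebra S)" by fact
  define e where "e = e' / (2 + \<bar>?tv\<bar>)"
  have e: "e > 0" using e' by (simp add: e_def add_pos_nonneg)
  obtain D a where D: "finite D" "D \<subseteq> sets S" "partition_on (space S) D"
    and a: "\<And>A. A \<in> D \<Longrightarrow> \<bar>a A\<bar> \<le> c + e"
    and ap: "\<And>x. x \<in> space S \<Longrightarrow> \<bar>f x - (\<Sum>A\<in>D. a A * indicator A x)\<bar> \<le> e"
    using uniform_step_approximation[OF f bd e] by blast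
  define g where "g x = (\<Sum>A\<in>D. a A * indicator A x)" for x
  have gm [measurable]: "g \<in> borel_measurable S" unfolding g_def using D by (intro borel_measurable_sum borel_measurable_times borel_measurable_const borel_measurable_indicator) auto
  have gap: "\<bar>f x - g x\<bar> \<le> e" if "x \<in> space S" for x using ap[OF that] by (simp add: g_def)
  have close: "\<bar>(\<integral>x. f x \<partial>M) - (\<integral>x. g x \<partial>M)\<bar> \<le> e \<and> (\<integral>x. g x \<partial>M) = (\<Sum>A\<in>D. a A * measure M A)"
    if M: "prob_space M" "sets M = sets S" for M
  proof -
    interpret prob_space M by fact
    have sM: "space M = space S" using M(2) by (rule sets_eq_imp_space_eq)
    have m [measurable]: "f \<in> borel_measurable M" "g \<in> borel_measurable M"
      using f gm measurable_cong_sets[OF M(2) refl] by blast+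
    have fi: "integrable M f" using bd sM by (intro integrable_bounded_real[of _ c]) auto
    have "\<bar>g x\<bar> \<le> c + e" if "x \<in> space M" for x using that gap[of x] bd[of x] sM by auto
    then have gi: "integrable M g" by (intro integrable_bounded_real[of _ "c + e"]) auto
    have "\<bar>(\<integral>x. f x \<partial>M) - (\<integral>x. g x \<partial>M)\<bar> = \<bar>\<integral>x. f x - g x \<partial>M\<bar>" using fi gi by simp
    also have "\<dots> \<le> e" using gap sM by (intro abs_expectation_le) auto
    finally have 1: "\<bar>(\<integral>x. f x \<partial>M) - (\<integral>x. g x \<partial>M)\<bar> \<le> e" .
    have "(\<integral>x. g x \<partial>M) = (\<Sum>A\<in>D. a A * measure M A)"
      unfolding g_def using D M(2) by (intro expectation_step_function) auto
    then show ?thesis using 1 by simp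
  qed
  have "\<bar>(\<integral>x. g x \<partial>\<mu>) - (\<integral>x. g x \<partial>\<nu>)\<bar> = \<bar>\<Sum>A\<in>D. a A * (measure \<mu> A - measure \<nu> A)\<bar>"
    using close[OF mu.prob_space_axioms s(1)] close[OF nu.prob_space_axioms s(2)]
    by (simp add: sum_subtractf right_diff_distrib)
  also have "\<dots> \<le> (\<Sum>A\<in>D. \<bar>a A\<bar> * \<bar>measure \<mu> A - measure \<nu> A\<bar>)"
    unfolding abs_mult[symmetric] by (rule sum_abs)
  also have "\<dots> \<le> (\<Sum>A\<in>D. (c + e) * \<bar>measure \<mu> A - measure \<nu> A\<bar>)"
    using a by (intro sum_mono mult_right_mono) auto
  also have "\<dots> = (c + e) * (\<Sum>A\<in>D. \<bar>measure \<mu> A - measure \<nu> A\<bar>)" by (simp add: sum_distrib_left)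
  also have "\<dots> \<le> (c + e) * ?tv"
  proof (rule mult_left_mono)
    show "(\<Sum>A\<in>D. \<bar>measure \<mu> A - measure \<nu> A\<bar>) \<le> ?tv" by (rule tv_norm_diff_upper[OF mu nu D])
    obtain x where "x \<in> space S" using mu.not_empty sp by auto
    then show "0 \<le> c + e" using bd[of x] e by linarith
  qed
  finally have "\<bar>(\<integral>x. f x \<partial>\<mu>) - (\<integral>x. f x \<partial>\<nu>)\<bar> \<le> (c + e) * ?tv + 2 * e"
    using close[OF mu.prob_space_axioms s(1)] close[OF nu.prob_space_axioms s(2)] by linarith
  also have "\<dots> \<le> c * ?tv + e * (2 + \<bar>?tv\<bar>)"
    using mult_left_mono[OF abs_ge_self[of ?tv], of e] e by (simp add: algebra_simps)
  also have "e * (2 + \<bar>?tv\<bar>) = e'" unfolding e_def by (simp add: add_pos_nonneg)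
  finally show "\<bar>(\<integral>x. f x \<partial>\<mu>) - (\<integral>x. f x \<partial>\<nu>)\<bar> \<le> c * ?tv + e'" .
qed

lemma kernel_integral_measurable:
  fixes f :: "'a \<Rightarrow> real"
  assumes f: "f \<in> borel_measurable S" and K: "K \<in> measurable S (prob_algebra S)"
  shows "(\<lambda>x. \<integral>y. f y \<partial>K x) \<in> borel_measurable S"
  using measurable_compose[OF measurable_prob_algebraD[OF K] integral_measurable_subprob_algebra[OF f]] .

lemma kernel_integral_bounded:
  fixes f :: "'a \<Rightarrow> real"
  assumes f: "f \<in> borel_measurable S" "\<And>x. x \<in> space S \<Longrightarrow> \<bar>f x\<bar> \<le> c"
    and K: "\<mu> \<in> space (prob_algebra S)"
  shows "\<bar>\<integral>y. f y \<partial>\<mu>\<bar> \<le> c"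
proof -
  interpret prob_space \<mu> using K by (simp add: space_prob_algebra)
  have s: "sets \<mu> = sets S" using K by (simp add: space_prob_algebra)
  show ?thesis using f sets_eq_imp_space_eq[OF s] measurable_cong_sets[OF s refl]
    by (intro abs_expectation_le) blast+
qed

lemma integral_bind_bounded:
  fixes f :: "'a \<Rightarrow> real"
  assumes f: "f \<in> borel_measurable S" "\<And>x. x \<in> space S \<Longrightarrow> \<bar>f x\<bar> \<le> c"
    and mu: "\<mu> \<in> space (prob_algebra S)" and K: "K \<in> measurable S (prob_algebra S)"
  shows "(\<integral>x. f x \<partial>(bind \<mu> K)) = (\<integral>x. (\<integral>y. f y \<partial>K x) \<partial>\<mu>)"
proof -
  interpret prob_space \<mu> using mu by (simp add: space_prob_algebra)
  have s: "sets \<mu> = sets S" using mu by (simp add: space_prob_algebra)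
  have K': "K \<in> measurable \<mu> (prob_algebra S)" using K measurable_cong_sets[OF s refl] by blast
  show ?thesis
  proof (rule integral_bind[where B = c and B' = 1 and K = S])
    show "AE x in \<mu>. emeasure (K x) (space (K x)) \<le> ennreal 1"
    proof (rule AE_I2)
      fix x assume "x \<in> space \<mu>"
      then have "prob_space (K x)" using measurable_space[OF K'] by (simp add: space_prob_algebra)
      then show "emeasure (K x) (space (K x)) \<le> ennreal 1" by (simp add: prob_space.emeasure_space_1)
    qed
  qed (use f K' measurable_prob_algebraD finite_measure_axioms in auto)
qed

section \<open>Mixing of a uniformly ergodic Markov chain\<close>

locale ergodic_chain = prob_space P for P :: "'o measure" +
  fixes S :: "'a measure" and Q :: "'a \<Rightarrow> 'a measure" and W :: "nat \<Rightarrow> 'o \<Rightarrow> 'a"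
    and \<pi> :: "'a measure" and \<tau> :: nat
  assumes chain: "markov_chain P S Q W"
    and inv: "invariant_distribution S Q \<pi>"
    and erg: "uniformly_geometrically_ergodic S Q \<tau>"
begin

lemma kernel_measurable [measurable]: "Q \<in> measurable S (prob_algebra S)"
  using chain by (simp add: markov_chain_def)

lemma chain_measurable [measurable]: "W k \<in> measurable P S"
  using chain by (simp add: markov_chain_def)

lemma kernel_power_measurable [measurable]: "kernel_power S Q m \<in> measurable S (prob_algebra S)"
proof (induction m)
  case 0
  have "kernel_power S Q 0 = return S" by (rule ext) simp
  then show ?case by simp
next
  case (Suc m)
  have "kernel_power S Q (Suc m) = (\<lambda>x. bind (kernel_power S Q m x) Q)" by (rule ext) simp
  then show ?case using measurable_bind_prob_space[OF Suc kernel_measurable] by simp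
qed

lemma invariant_prob: "\<pi> \<in> space (prob_algebra S)" and invariant_bind: "bind \<pi> Q = \<pi>"
  using inv by (auto simp: invariant_distribution_def)

lemma integral_kernel_power_invariant:
  fixes f :: "'a \<Rightarrow> real"
  assumes f: "f \<in> borel_measurable S" "\<And>x. x \<in> space S \<Longrightarrow> \<bar>f x\<bar> \<le> c"
  shows "(\<integral>x. (\<integral>y. f y \<partial>kernel_power S Q m x) \<partial>\<pi>) = (\<integral>y. f y \<partial>\<pi>)"
  using f
proof (induction m arbitrary: f)
  case 0
  have s: "space \<pi> = space S" using invariant_prob sets_eq_imp_space_eq[of \<pi> S] by (simp add: space_prob_algebra)
  show ?case by (rule Bochner_Integration.integral_cong) (use 0 s in \<open>auto simp: integral_return\<close>)
next
  case (Suc m)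
  let ?g = "\<lambda>x. \<integral>y. f y \<partial>Q x"
  have g: "?g \<in> borel_measurable S" "\<And>x. x \<in> space S \<Longrightarrow> \<bar>?g x\<bar> \<le> c"
    using kernel_integral_measurable[OF Suc.prems(1) kernel_measurable]
      kernel_integral_bounded[OF Suc.prems] measurable_space[OF kernel_measurable] by auto
  have s: "space \<pi> = space S" using invariant_prob sets_eq_imp_space_eq[of \<pi> S] by (simp add: space_prob_algebra)
  have "(\<integral>x. (\<integral>y. f y \<partial>kernel_power S Q (Suc m) x) \<partial>\<pi>) = (\<integral>x. (\<integral>y. ?g y \<partial>kernel_power S Q m x) \<partial>\<pi>)"
  proof (rule Bochner_Integration.integral_cong[OF refl])
    fix x assume "x \<in> space \<pi>"
    then have "kernel_power S Q m x \<in> space (prob_algebra S)"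
      using s measurable_space[OF kernel_power_measurable] by simp
    then show "(\<integral>y. f y \<partial>kernel_power S Q (Suc m) x) = (\<integral>y. ?g y \<partial>kernel_power S Q m x)"
      using integral_bind_bounded[OF Suc.prems _ kernel_measurable] by simp
  qed
  also have "\<dots> = (\<integral>y. ?g y \<partial>\<pi>)" by (rule Suc.IH[OF g])
  also have "\<dots> = (\<integral>y. f y \<partial>bind \<pi> Q)"
    by (rule integral_bind_bounded[OF Suc.prems invariant_prob kernel_measurable, symmetric])
  finally show ?case by (simp add: invariant_bind)
qed

text \<open>Ergodicity compares two starting points; averaging one of them over \<open>\<pi>\<close> compares the chain with
  its invariant distribution.\<close>

lemma geometric_mixing:
  fixes f :: "'a \<Rightarrow> real"
  assumes f: "f \<in> borel_measurable S" "\<And>x. x \<in> space S \<Longrightarrow> \<bar>f x\<bar> \<le> c" and x: "x \<in> space S"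
  shows "\<bar>(\<integral>y. f y \<partial>kernel_power S Q m x) - (\<integral>y. f y \<partial>\<pi>)\<bar> \<le> 2 * c * (1/4) ^ (m div \<tau>)"
proof -
  let ?K = "\<lambda>x. \<integral>y. f y \<partial>kernel_power S Q m x"
  interpret pi: prob_space \<pi> using invariant_prob by (simp add: space_prob_algebra)
  have s: "sets \<pi> = sets S" using invariant_prob by (auto simp: space_prob_algebra)
  have sp: "space \<pi> = space S" using s by (rule sets_eq_imp_space_eq)
  have kp: "kernel_power S Q m y \<in> space (prob_algebra S)" if "y \<in> space S" for y
    using measurable_space[OF kernel_power_measurable that] .
  have Km: "?K \<in> borel_measurable \<pi>"
    using kernel_integral_measurable[OF f(1) kernel_power_measurable] measurable_cong_sets[OF s refl] by blast
  have c0: "c \<ge> 0" using f(2)[OF x] by linarith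
  have d: "\<bar>?K x - ?K y\<bar> \<le> 2 * c * (1/4) ^ (m div \<tau>)" if y: "y \<in> space S" for y
  proof -
    have "\<bar>?K x - ?K y\<bar> \<le> c * tv_norm_diff (kernel_power S Q m x) (kernel_power S Q m y)"
      by (rule integral_diff_le_tv_norm_diff[OF kp[OF x] kp[OF y] f])
    also have "\<dots> \<le> c * (2 * (1/4) ^ (m div \<tau>))"
    proof (rule mult_left_mono[OF _ c0])
      have "1/2 * tv_norm_diff (kernel_power S Q m x) (kernel_power S Q m y) \<le> (1/4) ^ (m div \<tau>)"
        using erg x y unfolding uniformly_geometrically_ergodic_def by blast
      then show "tv_norm_diff (kernel_power S Q m x) (kernel_power S Q m y) \<le> 2 * (1/4) ^ (m div \<tau>)" by simp
    qed
    finally show ?thesis by simp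
  qed
  have Ki: "integrable \<pi> ?K"
    using kernel_integral_bounded[OF f kp] sp by (intro pi.integrable_bounded_real[OF Km, of c]) auto
  have "\<bar>?K x - (\<integral>y. f y \<partial>\<pi>)\<bar> = \<bar>\<integral>y. ?K x - ?K y \<partial>\<pi>\<bar>"
    using Ki integral_kernel_power_invariant[OF f, of m] by (simp add: pi.prob_space)
  also have "\<dots> \<le> 2 * c * (1/4) ^ (m div \<tau>)"
    using Km d sp by (intro pi.abs_expectation_le) auto
  finally show ?thesis .
qed

lemma past_subalgebra: "subalgebra P (past P S W k)"
  unfolding subalgebra_def past_def
proof (intro conjI)
  let ?G = "{W i -` A \<inter> space P | i A. i \<le> k \<and> A \<in> sets S}"
  have G: "?G \<subseteq> sets P" by (auto intro: measurable_sets[OF chain_measurable])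
  then have G': "?G \<subseteq> Pow (space P)" using sets.sets_into_space by blast
  show "space (sigma (space P) ?G) = space P" using G' by (rule space_measure_of)
  show "sets (sigma (space P) ?G) \<subseteq> sets P"
    using G G' by (simp add: sets.sigma_sets_subset)
qed

lemma space_past [simp]: "space (past P S W k) = space P"
  using past_subalgebra by (simp add: subalgebra_def)

lemma past_mono: "k \<le> l \<Longrightarrow> sets (past P S W k) \<subseteq> sets (past P S W l)"
proof -
  assume kl: "k \<le> l"
  have G': "{W i -` A \<inter> space P | i A. i \<le> k \<and> A \<in> sets S} \<subseteq> Pow (space P)" for k by auto
  show ?thesis unfolding past_def sets_measure_of[OF G'] using kl by (intro sigma_sets_mono') (force)
qed

lemma measurable_past_mono: "f \<in> measurable (past P S W k) N \<Longrightarrow> k \<le> l \<Longrightarrow> f \<in> measurable (past P S W l) N"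
  using past_mono[of k l] by (auto simp: measurable_def)

lemma measurable_past: "f \<in> measurable (past P S W k) N \<Longrightarrow> f \<in> measurable P N"
  using measurable_from_subalg[OF past_subalgebra] .

lemma chain_measurable_past: "i \<le> k \<Longrightarrow> W i \<in> measurable (past P S W k) S"
proof (rule measurableI)
  fix A assume i: "i \<le> k" and A: "A \<in> sets S"
  have G': "{W i -` A \<inter> space P | i A. i \<le> k \<and> A \<in> sets S} \<subseteq> Pow (space P)" by auto
  have "W i -` A \<inter> space P \<in> sets (past P S W k)"
    unfolding past_def sets_measure_of[OF G'] using i A by (intro sigma_sets.Basic) auto
  then show "W i -` A \<inter> space (past P S W k) \<in> sets (past P S W k)" by simp
qed (use measurable_space[OF chain_measurable] in auto)

text \<open>The conditional expectation in the definition of a Markov chain, tested against a function of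
  the past.\<close>

lemma markov_property_indicator:
  fixes h :: "'o \<Rightarrow> real"
  assumes h: "h \<in> borel_measurable (past P S W k)" "\<And>\<omega>. \<omega> \<in> space P \<Longrightarrow> \<bar>h \<omega>\<bar> \<le> c" and A: "A \<in> sets S"
  shows "(\<integral>\<omega>. h \<omega> * indicator A (W (Suc k) \<omega>) \<partial>P) = (\<integral>\<omega>. h \<omega> * measure (Q (W k \<omega>)) A \<partial>P)"
proof -
  interpret sub: finite_measure_subalgebra P "past P S W k"
    by unfold_locales (rule past_subalgebra)
  have hP [measurable]: "h \<in> borel_measurable P" using h(1) by (rule measurable_past)
  note A [measurable]
  have ii: "integrable P (\<lambda>\<omega>. h \<omega> * indicator A (W (Suc k) \<omega>))"
  proof (rule integrable_bounded_real)
    show "\<bar>h \<omega> * indicator A (W (Suc k) \<omega>)\<bar> \<le> c" if "\<omega> \<in> space P" for \<omega>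
      using h(2)[OF that] by (auto simp: indicator_def)
  qed measurable
  have "(\<integral>\<omega>. h \<omega> * indicator A (W (Suc k) \<omega>) \<partial>P)
      = (\<integral>\<omega>. h \<omega> * real_cond_exp P (past P S W k) (\<lambda>\<omega>. indicator A (W (Suc k) \<omega>)) \<omega> \<partial>P)"
    using sub.real_cond_exp_intg(2)[OF ii h(1)] by simp
  also have "\<dots> = (\<integral>\<omega>. h \<omega> * measure (Q (W k \<omega>)) A \<partial>P)"
  proof (rule integral_cong_AE)
    show "AE \<omega> in P. h \<omega> * real_cond_exp P (past P S W k) (\<lambda>\<omega>. indicator A (W (Suc k) \<omega>)) \<omega> = h \<omega> * measure (Q (W k \<omega>)) A"
      using chain A unfolding markov_chain_def by fastforce
  qed (use A in measurable)
  finally show ?thesis .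
qed

text \<open>Both sides are linear in \<open>f\<close>, and they agree on indicators; a uniform approximation by step
  functions carries the equation to all bounded \<open>f\<close>.\<close>

lemma markov_property:
  fixes h :: "'o \<Rightarrow> real" and f :: "'a \<Rightarrow> real"
  assumes h: "h \<in> borel_measurable (past P S W k)" "\<And>\<omega>. \<omega> \<in> space P \<Longrightarrow> \<bar>h \<omega>\<bar> \<le> c"
    and f: "f \<in> borel_measurable S" "\<And>x. x \<in> space S \<Longrightarrow> \<bar>f x\<bar> \<le> b"
  shows "(\<integral>\<omega>. h \<omega> * f (W (Suc k) \<omega>) \<partial>P) = (\<integral>\<omega>. h \<omega> * (\<integral>y. f y \<partial>Q (W k \<omega>)) \<partial>P)"
proof -
  have hP [measurable]: "h \<in> borel_measurable P" using h(1) by (rule measurable_past)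
  note [measurable] = f(1)
  have Wsp: "W k \<omega> \<in> space S" if "\<omega> \<in> space P" for k \<omega> using measurable_space[OF chain_measurable that] .
  have Qp: "Q x \<in> space (prob_algebra S)" if "x \<in> space S" for x using measurable_space[OF kernel_measurable that] .
  have c0: "c \<ge> 0" using not_empty h(2) by (meson abs_ge_zero all_not_in_conv order_trans)
  let ?L = "\<lambda>f. (\<integral>\<omega>. h \<omega> * f (W (Suc k) \<omega>) \<partial>P)" and ?R = "\<lambda>f. (\<integral>\<omega>. h \<omega> * (\<integral>y. f y \<partial>Q (W k \<omega>)) \<partial>P)"
  have "\<bar>?L f - ?R f\<bar> \<le> 0 + e'" if e': "e' > 0" for e'
  proof -
    define e where "e = e' / (2 * c + 1)"
    have e: "e > 0" using e' c0 by (simp add: e_def)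
    obtain D a where D: "finite D" "D \<subseteq> sets S" "partition_on (space S) D"
      and a: "\<And>A. A \<in> D \<Longrightarrow> \<bar>a A\<bar> \<le> b + e"
      and ap: "\<And>x. x \<in> space S \<Longrightarrow> \<bar>f x - (\<Sum>A\<in>D. a A * indicator A x)\<bar> \<le> e"
      using uniform_step_approximation[OF f e] by blast
    define g where "g x = (\<Sum>A\<in>D. a A * indicator A x)" for x
    have gm [measurable]: "g \<in> borel_measurable S" unfolding g_def using D by (intro borel_measurable_sum borel_measurable_times borel_measurable_const borel_measurable_indicator) auto
    have gap: "\<bar>f x - g x\<bar> \<le> e" if "x \<in> space S" for x using ap[OF that] by (simp add: g_def)
    have gb: "\<bar>g x\<bar> \<le> b + e" if "x \<in> space S" for x using gap[OF that] f(2)[OF that] by linarith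
    have Am: "A \<in> sets S" if "A \<in> D" for A using D that by auto
    have Qg: "(\<integral>y. g y \<partial>Q (W k \<omega>)) = (\<Sum>A\<in>D. a A * measure (Q (W k \<omega>)) A)" if w: "\<omega> \<in> space P" for \<omega>
    proof -
      interpret q: prob_space "Q (W k \<omega>)" using Qp[OF Wsp[OF w]] by (simp add: space_prob_algebra)
      have s: "sets (Q (W k \<omega>)) = sets S" using Qp[OF Wsp[OF w]] by (simp add: space_prob_algebra)
      show ?thesis unfolding g_def using D s by (intro q.expectation_step_function) auto
    qed
    have lin: "?L g = ?R g"
    proof -
      have "?L g = (\<integral>\<omega>. (\<Sum>A\<in>D. a A * (h \<omega> * indicator A (W (Suc k) \<omega>))) \<partial>P)"
        unfolding g_def by (simp only: sum_distrib_left mult.left_commute)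
      also have "\<dots> = (\<Sum>A\<in>D. \<integral>\<omega>. a A * (h \<omega> * indicator A (W (Suc k) \<omega>)) \<partial>P)"
      proof (rule Bochner_Integration.integral_sum)
        fix A assume "A \<in> D"
        note Am[OF this, measurable]
        have "integrable P (\<lambda>\<omega>. h \<omega> * indicator A (W (Suc k) \<omega>))"
        proof (rule integrable_mult_bounded[OF hP _ h(2)])
          show "(\<lambda>\<omega>. indicator A (W (Suc k) \<omega>) :: real) \<in> borel_measurable P" by measurable
          show "\<bar>indicator A (W (Suc k) \<omega>)\<bar> \<le> (1 :: real)" for \<omega> by (simp add: indicator_def)
        qed
        then show "integrable P (\<lambda>\<omega>. a A * (h \<omega> * indicator A (W (Suc k) \<omega>)))" by (rule integrable_mult_right)
      qed
      also have "\<dots> = (\<Sum>A\<in>D. \<integral>\<omega>. a A * (h \<omega> * measure (Q (W k \<omega>)) A) \<partial>P)"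
        using markov_property_indicator[OF h Am] by (intro sum.cong) simp_all
      also have "\<dots> = (\<integral>\<omega>. (\<Sum>A\<in>D. a A * (h \<omega> * measure (Q (W k \<omega>)) A)) \<partial>P)"
      proof (rule Bochner_Integration.integral_sum[symmetric])
        fix A assume "A \<in> D"
        note Am[OF this, measurable]
        have "integrable P (\<lambda>\<omega>. h \<omega> * measure (Q (W k \<omega>)) A)"
        proof (rule integrable_mult_bounded[OF hP _ h(2)])
          show "(\<lambda>\<omega>. measure (Q (W k \<omega>)) A) \<in> borel_measurable P" by measurable
          show "\<bar>measure (Q (W k \<omega>)) A\<bar> \<le> 1" if "\<omega> \<in> space P" for \<omega>
            using Qp[OF Wsp[OF that]] by (auto simp: space_prob_algebra prob_space.prob_le_1)
        qed
        then show "integrable P (\<lambda>\<omega>. a A * (h \<omega> * measure (Q (W k \<omega>)) A))" by (rule integrable_mult_right)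
      qed
      also have "\<dots> = ?R g"
      proof (rule Bochner_Integration.integral_cong[OF refl])
        fix \<omega> assume "\<omega> \<in> space P"
        then show "(\<Sum>A\<in>D. a A * (h \<omega> * measure (Q (W k \<omega>)) A)) = h \<omega> * (\<integral>y. g y \<partial>Q (W k \<omega>))"
          by (simp only: Qg sum_distrib_left mult.left_commute)
      qed
      finally show ?thesis .
    qed
    have Qm: "(\<lambda>\<omega>. \<integral>y. f' y \<partial>Q (W k \<omega>)) \<in> borel_measurable P" if f': "f' \<in> borel_measurable S" for f' :: "'a \<Rightarrow> real"
      using measurable_compose[OF chain_measurable kernel_integral_measurable[OF f' kernel_measurable]] .
    have Wm: "(\<lambda>\<omega>. f' (W (Suc k) \<omega>)) \<in> borel_measurable P" if f': "f' \<in> borel_measurable S" for f' :: "'a \<Rightarrow> real"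
      using measurable_compose[OF chain_measurable f'] .
    have Qf: "\<bar>\<integral>y. f y \<partial>Q (W k \<omega>)\<bar> \<le> b" "\<bar>\<integral>y. g y \<partial>Q (W k \<omega>)\<bar> \<le> b + e" if "\<omega> \<in> space P" for \<omega>
      using kernel_integral_bounded[OF f Qp[OF Wsp[OF that]]] kernel_integral_bounded[OF gm gb Qp[OF Wsp[OF that]]] by auto
    have Lfg: "\<bar>?L f - ?L g\<bar> \<le> c * e"
    proof -
      have "integrable P (\<lambda>\<omega>. h \<omega> * f (W (Suc k) \<omega>))" "integrable P (\<lambda>\<omega>. h \<omega> * g (W (Suc k) \<omega>))"
        by (rule integrable_mult_bounded[OF hP Wm[OF f(1)] h(2) f(2)[OF Wsp]] integrable_mult_bounded[OF hP Wm[OF gm] h(2) gb[OF Wsp]], assumption+)+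
      then have "?L f - ?L g = (\<integral>\<omega>. h \<omega> * (f (W (Suc k) \<omega>) - g (W (Suc k) \<omega>)) \<partial>P)"
        by (simp add: right_diff_distrib)
      also have "\<bar>\<dots>\<bar> \<le> c * e"
        using gap Wsp Wm[OF f(1)] Wm[OF gm] by (intro abs_expectation_mult_le[OF hP _ h(2)] borel_measurable_diff) auto
      finally show ?thesis .
    qed
    have Rfg: "\<bar>?R f - ?R g\<bar> \<le> c * e"
    proof -
      have "integrable P (\<lambda>\<omega>. h \<omega> * (\<integral>y. f y \<partial>Q (W k \<omega>)))" "integrable P (\<lambda>\<omega>. h \<omega> * (\<integral>y. g y \<partial>Q (W k \<omega>)))"
        by (rule integrable_mult_bounded[OF hP Qm[OF f(1)] h(2) Qf(1)] integrable_mult_bounded[OF hP Qm[OF gm] h(2) Qf(2)], assumption+)+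
      then have "?R f - ?R g = (\<integral>\<omega>. h \<omega> * ((\<integral>y. f y \<partial>Q (W k \<omega>)) - (\<integral>y. g y \<partial>Q (W k \<omega>))) \<partial>P)"
        by (simp add: right_diff_distrib)
      also have "\<bar>\<dots>\<bar> \<le> c * e"
      proof (rule abs_expectation_mult_le[OF hP _ h(2)])
        show "(\<lambda>\<omega>. (\<integral>y. f y \<partial>Q (W k \<omega>)) - (\<integral>y. g y \<partial>Q (W k \<omega>))) \<in> borel_measurable P"
          by (intro borel_measurable_diff Qm f(1) gm)
        fix \<omega> assume w: "\<omega> \<in> space P"
        interpret q: prob_space "Q (W k \<omega>)" using Qp[OF Wsp[OF w]] by (simp add: space_prob_algebra)
        have s: "sets (Q (W k \<omega>)) = sets S" using Qp[OF Wsp[OF w]] by (simp add: space_prob_algebra)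
        have ss: "space (Q (W k \<omega>)) = space S" using s by (rule sets_eq_imp_space_eq)
        have m: "f \<in> borel_measurable (Q (W k \<omega>))" "g \<in> borel_measurable (Q (W k \<omega>))"
          using f(1) gm measurable_cong_sets[OF s refl] by blast+
        have "integrable (Q (W k \<omega>)) f" "integrable (Q (W k \<omega>)) g"
          using q.integrable_bounded_real[OF m(1), of b] q.integrable_bounded_real[OF m(2), of "b+e"] f(2) gb ss by simp_all
        then have "(\<integral>y. f y \<partial>Q (W k \<omega>)) - (\<integral>y. g y \<partial>Q (W k \<omega>)) = (\<integral>y. f y - g y \<partial>Q (W k \<omega>))" by simp
        also have "\<bar>\<dots>\<bar> \<le> e"
          using m gap ss by (intro q.abs_expectation_le borel_measurable_diff) auto
        finally show "\<bar>(\<integral>y. f y \<partial>Q (W k \<omega>)) - (\<integral>y. g y \<partial>Q (W k \<omega>))\<bar> \<le> e" .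
      qed
      finally show ?thesis .
    qed
    have "\<bar>?L f - ?R f\<bar> \<le> 2 * c * e" using Lfg Rfg lin by linarith
    also have "\<dots> \<le> (2 * c + 1) * e" using e by (simp add: algebra_simps)
    also have "\<dots> = e'" using c0 by (simp add: e_def)
    finally show ?thesis by simp
  qed
  then have "\<bar>?L f - ?R f\<bar> \<le> 0" by (rule field_le_epsilon)
  then show ?thesis by simp
qed

lemma markov_property_power:
  fixes h :: "'o \<Rightarrow> real" and f :: "'a \<Rightarrow> real"
  assumes h: "h \<in> borel_measurable (past P S W k)" "\<And>\<omega>. \<omega> \<in> space P \<Longrightarrow> \<bar>h \<omega>\<bar> \<le> c"
    and f: "f \<in> borel_measurable S" "\<And>x. x \<in> space S \<Longrightarrow> \<bar>f x\<bar> \<le> b"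
  shows "(\<integral>\<omega>. h \<omega> * f (W (k + d) \<omega>) \<partial>P) = (\<integral>\<omega>. h \<omega> * (\<integral>y. f y \<partial>kernel_power S Q d (W k \<omega>)) \<partial>P)"
  using f
proof (induction d arbitrary: f)
  case 0
  have "W k \<omega> \<in> space S" if "\<omega> \<in> space P" for \<omega> using measurable_space[OF chain_measurable that] .
  then show ?case using 0 by (intro Bochner_Integration.integral_cong) (auto simp: integral_return)
next
  case (Suc d)
  let ?g = "\<lambda>x. \<integral>y. f y \<partial>Q x"
  have g: "?g \<in> borel_measurable S" "\<And>x. x \<in> space S \<Longrightarrow> \<bar>?g x\<bar> \<le> b"
    using kernel_integral_measurable[OF Suc.prems(1) kernel_measurable]
      kernel_integral_bounded[OF Suc.prems] measurable_space[OF kernel_measurable] by auto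
  have "(\<integral>\<omega>. h \<omega> * f (W (k + Suc d) \<omega>) \<partial>P) = (\<integral>\<omega>. h \<omega> * ?g (W (k + d) \<omega>) \<partial>P)"
    using markov_property[OF measurable_past_mono[OF h(1), of "k + d"] h(2) Suc.prems] by simp
  also have "\<dots> = (\<integral>\<omega>. h \<omega> * (\<integral>y. ?g y \<partial>kernel_power S Q d (W k \<omega>)) \<partial>P)" by (rule Suc.IH[OF g])
  also have "\<dots> = (\<integral>\<omega>. h \<omega> * (\<integral>y. f y \<partial>kernel_power S Q (Suc d) (W k \<omega>)) \<partial>P)"
  proof (rule Bochner_Integration.integral_cong[OF refl])
    fix \<omega> assume "\<omega> \<in> space P"
    then have "kernel_power S Q d (W k \<omega>) \<in> space (prob_algebra S)"
      using measurable_space[OF kernel_power_measurable] measurable_space[OF chain_measurable] by blast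
    then show "h \<omega> * (\<integral>y. ?g y \<partial>kernel_power S Q d (W k \<omega>)) = h \<omega> * (\<integral>y. f y \<partial>kernel_power S Q (Suc d) (W k \<omega>))"
      using integral_bind_bounded[OF Suc.prems _ kernel_measurable] by simp
  qed
  finally show ?case .
qed

end

section \<open>Averages of gossip matrices over a batch\<close>

lemma borel_measurable_matrix_vector_mult:
  fixes A :: "'a \<Rightarrow> real^'n^'m"
  assumes A: "A \<in> borel_measurable M" and x: "x \<in> borel_measurable M"
  shows "(\<lambda>\<omega>. A \<omega> *v x \<omega>) \<in> borel_measurable M"
  using A x by (rule borel_measurable_continuous_Pair)
    (simp add: matrix_vector_mult_def, intro continuous_intros)

lemma borel_measurable_vec_nth:
  fixes u :: "'a \<Rightarrow> real^'n"
  assumes "u \<in> borel_measurable M"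
  shows "(\<lambda>\<omega>. u \<omega> $ a) \<in> borel_measurable M"
proof -
  have "(\<lambda>x :: real^'n. x $ a) \<in> borel_measurable borel"
    by (intro borel_measurable_continuous_onI continuous_intros)
  from measurable_compose[OF assms this] show ?thesis .
qed

lemma norm_matrix_vector_le_op_norm:
  fixes A :: "real^'n^'n"
  shows "norm (A *v x) \<le> op_norm A * norm x"
  unfolding op_norm_def by (rule onorm) simp

lemma matrix_entry_expansion:
  fixes A :: "real^'n^'n"
  shows "u \<bullet> (A *v z) = (\<Sum>a\<in>UNIV. \<Sum>b\<in>UNIV. (u $ a * z $ b) * A $ a $ b)"
  by (simp add: inner_vec_def matrix_vector_mult_def sum_distrib_left algebra_simps)

text \<open>Each power of \<open>1/4\<close> occurs \<open>\<tau>\<close> times, which gives \<open>\<tau>\<close> copies of the geometric series.\<close>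

lemma sum_mixing_le:
  assumes "\<tau> \<ge> 1"
  shows "(\<Sum>i = 1..n. (1/4 :: real) ^ (i div \<tau>)) \<le> 4 / 3 * real \<tau>"
proof -
  have "(\<Sum>i = 1..n. (1/4 :: real) ^ (i div \<tau>)) \<le> (\<Sum>i < Suc n * \<tau>. (1/4 :: real) ^ (i div \<tau>))"
  proof (rule sum_mono2)
    have "n < Suc n * \<tau>" using assms by (cases \<tau>) auto
    then show "{1..n} \<subseteq> {..<Suc n * \<tau>}" by auto
  qed auto
  also have "\<dots> = (\<Sum>m < Suc n. \<Sum>i = m * \<tau>..<m * \<tau> + \<tau>. (1/4 :: real) ^ (i div \<tau>))"
    by (rule sum.nat_group[symmetric])
  also have "\<dots> = (\<Sum>m < Suc n. \<Sum>i = m * \<tau>..<m * \<tau> + \<tau>. (1/4 :: real) ^ m)"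
  proof (intro sum.cong refl arg_cong[where f="\<lambda>k. (1/4 :: real) ^ k"])
    fix m i assume i: "i \<in> {m * \<tau>..<m * \<tau> + \<tau>}"
    then show "i div \<tau> = m" using assms by (intro div_nat_eqI) (auto simp: algebra_simps)
  qed
  also have "\<dots> = real \<tau> * (\<Sum>m < Suc n. (1/4 :: real) ^ m)"
    by (simp only: sum_constant card_atLeastLessThan add_diff_cancel_left' sum_distrib_left)
  also have "\<dots> \<le> real \<tau> * (4 / 3)"
  proof (rule mult_left_mono)
    have "(\<Sum>m < k. (1/4 :: real) ^ m) = (1 - (1/4) ^ k) * (4/3)" for k
      by (induction k) (auto simp: algebra_simps)
    then show "(\<Sum>m < Suc n. (1/4 :: real) ^ m) \<le> 4 / 3" by simp
  qed simp
  finally show ?thesis by simp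
qed

locale gossip_chain = ergodic_chain P S Q W \<pi> \<tau>
  for P :: "'o measure" and S :: "(real^'n::finite^'n) measure" and Q W \<pi> \<tau> +
  fixes Wt :: "real^'n^'n" and \<rho> :: real
  assumes stationary_integrable: "integrable \<pi> (\<lambda>A. A)"
    and stationary_mean: "(\<integral>A. A \<partial>\<pi>) = Wt"
    and deviation: "\<And>A. A \<in> space S \<Longrightarrow> op_norm (A - Wt) \<le> \<rho>"
begin

text \<open>The \<open>\<sigma>\<close>-algebra on the matrices is arbitrary; that it contains the traces of the Borel sets comes
  from the integrability of the identity under \<open>\<pi>\<close>.\<close>

lemma identity_measurable [measurable]: "(\<lambda>A. A) \<in> borel_measurable S"
proof -
  have s: "sets \<pi> = sets S" using invariant_prob by (simp add: space_prob_algebra)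
  show ?thesis using borel_measurable_integrable[OF stationary_integrable] measurable_cong_sets[OF s refl] by blast
qed

lemma W_space: "\<omega> \<in> space P \<Longrightarrow> W k \<omega> \<in> space S"
  by (rule measurable_space[OF chain_measurable])

lemma deviation_nonneg: "\<rho> \<ge> 0"
proof -
  obtain \<omega> where "\<omega> \<in> space P" using not_empty by auto
  from deviation[OF W_space[OF this, of 0]] show ?thesis
    unfolding op_norm_def by (rule order_trans[rotated]) (rule onorm_pos_le, simp)
qed

lemma norm_deviation_le: "A \<in> space S \<Longrightarrow> norm ((A - Wt) *v x) \<le> \<rho> * norm x"
  by (rule order_trans[OF norm_matrix_vector_le_op_norm]) (intro mult_right_mono deviation norm_ge_zero)

lemma W_measurable_past: "i \<le> k \<Longrightarrow> W i \<in> borel_measurable (past P S W k)"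
  using measurable_compose[OF chain_measurable_past identity_measurable] by simp

lemma deviation_measurable_past:
  assumes "z \<in> borel_measurable (past P S W k)"
  shows "(\<lambda>\<omega>. (W (k + i) \<omega> - Wt) *v z \<omega>) \<in> borel_measurable (past P S W (k + i))"
  using assms
  by (intro borel_measurable_matrix_vector_mult borel_measurable_diff W_measurable_past borel_measurable_const)
    (auto intro: measurable_past_mono)

lemma bilinear_matrix_measurable: "(\<lambda>A. u \<bullet> ((A - Wt) *v z)) \<in> borel_measurable S"
  by (intro borel_measurable_inner borel_measurable_const borel_measurable_matrix_vector_mult borel_measurable_diff identity_measurable)

lemma bilinear_matrix_bound: "A \<in> space S \<Longrightarrow> \<bar>u \<bullet> ((A - Wt) *v z)\<bar> \<le> \<rho> * (norm u * norm z)"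
proof -
  assume A: "A \<in> space S"
  have "\<bar>u \<bullet> ((A - Wt) *v z)\<bar> \<le> norm u * norm ((A - Wt) *v z)" by (rule Cauchy_Schwarz_ineq2)
  also have "\<dots> \<le> norm u * (\<rho> * norm z)" by (intro mult_left_mono norm_deviation_le A norm_ge_zero)
  finally show ?thesis by (simp add: algebra_simps)
qed

lemma stationary_deviation_zero: "(\<integral>A. u \<bullet> ((A - Wt) *v z) \<partial>\<pi>) = 0"
proof -
  interpret pi: prob_space \<pi> using invariant_prob by (simp add: space_prob_algebra)
  have "linear (\<lambda>A :: real^'n^'n. u \<bullet> (A *v z))"
    by (rule linearI) (simp_all add: matrix_vector_mult_add_rdistrib inner_add_right scaleR_matrix_vector_assoc[symmetric])
  then have bl: "bounded_linear (\<lambda>A :: real^'n^'n. u \<bullet> (A *v z))" by (simp add: linear_conv_bounded_linear)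
  have "(\<integral>A. u \<bullet> (A *v z) \<partial>\<pi>) = u \<bullet> (Wt *v z)"
    using integral_bounded_linear[OF bl stationary_integrable] stationary_mean by simp
  moreover have "integrable \<pi> (\<lambda>A. u \<bullet> (A *v z))"
    by (rule integrable_bounded_linear[OF bl stationary_integrable])
  ultimately show ?thesis
    by (simp add: matrix_vector_mult_diff_rdistrib inner_diff_right pi.prob_space)
qed

lemma conditional_deviation_le:
  assumes "x \<in> space S"
  shows "\<bar>\<integral>A. u \<bullet> ((A - Wt) *v z) \<partial>kernel_power S Q d x\<bar> \<le> 2 * \<rho> * (1/4) ^ (d div \<tau>) * (norm u * norm z)"
  using geometric_mixing[OF bilinear_matrix_measurable[of u z] bilinear_matrix_bound[of _ u z] assms, of d]
  by (simp only: stationary_deviation_zero diff_zero) (simp only: ac_simps)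

text \<open>The heart of the noise estimates. The bilinear form is a sum of products of an entry of the
  deviation with a function of the past, so the Markov property applies to each entry. After
  summing again, the conditional expectation of the deviation, at a fixed value of \<open>u\<close> and \<open>z\<close>, is
  small because its mean under \<open>\<pi>\<close> vanishes. Applying mixing before the summation would cost a
  dimension-dependent factor.\<close>

lemma deviation_decorrelation:
  fixes u z :: "'o \<Rightarrow> real^'n"
  assumes u: "u \<in> borel_measurable (past P S W k)" "\<And>\<omega>. \<omega> \<in> space P \<Longrightarrow> norm (u \<omega>) \<le> cu"
    and z: "z \<in> borel_measurable (past P S W k)" "\<And>\<omega>. \<omega> \<in> space P \<Longrightarrow> norm (z \<omega>) \<le> cz"
  shows "\<bar>\<integral>\<omega>. u \<omega> \<bullet> ((W (k + d) \<omega> - Wt) *v z \<omega>) \<partial>P\<bar>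
    \<le> 2 * \<rho> * (1/4) ^ (d div \<tau>) * (\<integral>\<omega>. norm (u \<omega>) * norm (z \<omega>) \<partial>P)"
proof -
  define h where "h a b \<omega> = u \<omega> $ a * z \<omega> $ b" for a b \<omega>
  define f where "f a b A = (A - Wt) $ a $ b" for a b and A :: "real^'n^'n"
  note um = measurable_past[OF u(1)] and zm = measurable_past[OF z(1)]
  obtain \<omega>0 where w0: "\<omega>0 \<in> space P" using not_empty by auto
  have cu0: "cu \<ge> 0" using order_trans[OF norm_ge_zero u(2)[OF w0]] .
  have hm: "h a b \<in> borel_measurable (past P S W k)" for a b
    unfolding h_def using u(1) z(1) by (intro borel_measurable_times borel_measurable_vec_nth)
  have hmP: "h a b \<in> borel_measurable P" for a b using hm by (rule measurable_past)
  have hb: "\<bar>h a b \<omega>\<bar> \<le> cu * cz" if "\<omega> \<in> space P" for a b \<omega>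
    unfolding h_def abs_mult using u(2)[OF that] z(2)[OF that] cu0
    by (intro mult_mono order_trans[OF component_le_norm_cart]) auto
  have f_eq: "f a b A = axis a 1 \<bullet> ((A - Wt) *v axis b 1)" for a b A
    by (simp add: f_def inner_axis' matrix_vector_mult_basis column_def)
  have fm: "f a b \<in> borel_measurable S" for a b
    using bilinear_matrix_measurable[of "axis a 1" "axis b 1"] by (simp add: f_eq[symmetric])
  have fb: "\<bar>f a b A\<bar> \<le> \<rho>" if "A \<in> space S" for a b A
    using bilinear_matrix_bound[OF that, of "axis a 1" "axis b 1"] by (simp add: f_eq[symmetric])
  have kp: "kernel_power S Q d x \<in> space (prob_algebra S)" if "x \<in> space S" for x
    using measurable_space[OF kernel_power_measurable that] .
  define F where "F a b \<omega> = (\<integral>A. f a b A \<partial>kernel_power S Q d (W k \<omega>))" for a b \<omega>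
  have Fm: "F a b \<in> borel_measurable P" for a b
    unfolding F_def using measurable_compose[OF chain_measurable kernel_integral_measurable[OF fm kernel_power_measurable]] .
  have Fb: "\<bar>F a b \<omega>\<bar> \<le> \<rho>" if "\<omega> \<in> space P" for a b \<omega>
    unfolding F_def by (rule kernel_integral_bounded[OF fm fb kp[OF W_space[OF that]]])
  have fWm: "(\<lambda>\<omega>. f a b (W (k + d) \<omega>)) \<in> borel_measurable P" for a b
    using measurable_compose[OF chain_measurable fm] .
  have i1: "integrable P (\<lambda>\<omega>. h a b \<omega> * f a b (W (k + d) \<omega>))" for a b
    by (rule integrable_mult_bounded[OF hmP fWm hb fb[OF W_space]])
  have i2: "integrable P (\<lambda>\<omega>. h a b \<omega> * F a b \<omega>)" for a b
    by (rule integrable_mult_bounded[OF hmP Fm hb Fb])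
  have "(\<integral>\<omega>. u \<omega> \<bullet> ((W (k + d) \<omega> - Wt) *v z \<omega>) \<partial>P)
     = (\<integral>\<omega>. (\<Sum>a\<in>UNIV. \<Sum>b\<in>UNIV. h a b \<omega> * f a b (W (k + d) \<omega>)) \<partial>P)"
    by (simp only: matrix_entry_expansion h_def f_def)
  also have "\<dots> = (\<Sum>a\<in>UNIV. \<Sum>b\<in>UNIV. \<integral>\<omega>. h a b \<omega> * f a b (W (k + d) \<omega>) \<partial>P)"
    by (simp add: Bochner_Integration.integral_sum Bochner_Integration.integrable_sum i1)
  also have "\<dots> = (\<Sum>a\<in>UNIV. \<Sum>b\<in>UNIV. \<integral>\<omega>. h a b \<omega> * F a b \<omega> \<partial>P)"
    unfolding F_def by (intro sum.cong refl markov_property_power[OF hm hb fm fb])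
  also have "\<dots> = (\<integral>\<omega>. (\<Sum>a\<in>UNIV. \<Sum>b\<in>UNIV. h a b \<omega> * F a b \<omega>) \<partial>P)"
    by (simp add: Bochner_Integration.integral_sum Bochner_Integration.integrable_sum i2)
  finally have eq: "(\<integral>\<omega>. u \<omega> \<bullet> ((W (k + d) \<omega> - Wt) *v z \<omega>) \<partial>P)
     = (\<integral>\<omega>. (\<Sum>a\<in>UNIV. \<Sum>b\<in>UNIV. h a b \<omega> * F a b \<omega>) \<partial>P)" .
  have pt: "\<bar>\<Sum>a\<in>UNIV. \<Sum>b\<in>UNIV. h a b \<omega> * F a b \<omega>\<bar> \<le> 2 * \<rho> * (1/4) ^ (d div \<tau>) * (norm (u \<omega>) * norm (z \<omega>))"
    if w: "\<omega> \<in> space P" for \<omega>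
  proof -
    interpret q: prob_space "kernel_power S Q d (W k \<omega>)" using kp[OF W_space[OF w]] by (simp add: space_prob_algebra)
    have s: "sets (kernel_power S Q d (W k \<omega>)) = sets S" using kp[OF W_space[OF w]] by (simp add: space_prob_algebra)
    have ss: "space (kernel_power S Q d (W k \<omega>)) = space S" using s by (rule sets_eq_imp_space_eq)
    have "f a b \<in> borel_measurable (kernel_power S Q d (W k \<omega>))" for a b
      using fm measurable_cong_sets[OF s refl] by blast
    then have fi: "integrable (kernel_power S Q d (W k \<omega>)) (f a b)" for a b
      by (rule q.integrable_bounded_real) (use fb ss in auto)
    have "(\<Sum>a\<in>UNIV. \<Sum>b\<in>UNIV. h a b \<omega> * F a b \<omega>)
       = (\<integral>A. (\<Sum>a\<in>UNIV. \<Sum>b\<in>UNIV. h a b \<omega> * f a b A) \<partial>kernel_power S Q d (W k \<omega>))"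
      unfolding F_def using fi by (simp add: Bochner_Integration.integral_sum Bochner_Integration.integrable_sum)
    also have "\<dots> = (\<integral>A. u \<omega> \<bullet> ((A - Wt) *v z \<omega>) \<partial>kernel_power S Q d (W k \<omega>))"
      by (simp only: matrix_entry_expansion h_def f_def)
    finally show ?thesis using conditional_deviation_le[OF W_space[OF w]] by simp
  qed
  have m: "(\<lambda>\<omega>. norm (u \<omega>) * norm (z \<omega>)) \<in> borel_measurable P" using um zm by measurable
  have i3: "integrable P (\<lambda>\<omega>. norm (u \<omega>) * norm (z \<omega>))"
    by (rule integrable_mult_bounded[of _ _ cu cz]) (use um zm u(2) z(2) in auto)
  have i4: "integrable P (\<lambda>\<omega>. \<Sum>a\<in>UNIV. \<Sum>b\<in>UNIV. h a b \<omega> * F a b \<omega>)"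
    by (intro Bochner_Integration.integrable_sum i2)
  have "\<bar>\<integral>\<omega>. (\<Sum>a\<in>UNIV. \<Sum>b\<in>UNIV. h a b \<omega> * F a b \<omega>) \<partial>P\<bar>
     \<le> (\<integral>\<omega>. \<bar>\<Sum>a\<in>UNIV. \<Sum>b\<in>UNIV. h a b \<omega> * F a b \<omega>\<bar> \<partial>P)" by (rule integral_abs_bound)
  also have "\<dots> \<le> (\<integral>\<omega>. 2 * \<rho> * (1/4) ^ (d div \<tau>) * (norm (u \<omega>) * norm (z \<omega>)) \<partial>P)"
    using i3 i4 pt by (intro integral_mono integrable_abs integrable_mult_right) auto
  finally show ?thesis using eq by simp
qed

lemma batch_bias:
  fixes u z :: "'o \<Rightarrow> real^'n"
  assumes u: "u \<in> borel_measurable (past P S W k)" "\<And>\<omega>. \<omega> \<in> space P \<Longrightarrow> norm (u \<omega>) \<le> cu"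
    and z: "z \<in> borel_measurable (past P S W k)" "\<And>\<omega>. \<omega> \<in> space P \<Longrightarrow> norm (z \<omega>) \<le> cz"
  shows "\<bar>\<integral>\<omega>. u \<omega> \<bullet> (\<Sum>i = 1..n. (W (k + i) \<omega> - Wt) *v z \<omega>) \<partial>P\<bar>
    \<le> 8 / 3 * (real \<tau> * \<rho>) * (\<integral>\<omega>. norm (u \<omega>) * norm (z \<omega>) \<partial>P)"
proof -
  have dm: "(\<lambda>\<omega>. (W (k + i) \<omega> - Wt) *v z \<omega>) \<in> borel_measurable P" for i
    by (rule measurable_past[OF deviation_measurable_past[OF z(1)]])
  have um: "u \<in> borel_measurable P" by (rule measurable_past[OF u(1)])
  let ?E = "\<integral>\<omega>. norm (u \<omega>) * norm (z \<omega>) \<partial>P"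
  have E0: "?E \<ge> 0" by simp
  have ii: "integrable P (\<lambda>\<omega>. u \<omega> \<bullet> ((W (k + i) \<omega> - Wt) *v z \<omega>))" for i
  proof (rule integrable_bounded_real)
    show "(\<lambda>\<omega>. u \<omega> \<bullet> ((W (k + i) \<omega> - Wt) *v z \<omega>)) \<in> borel_measurable P" using um dm by measurable
    fix \<omega> assume w: "\<omega> \<in> space P"
    have "\<bar>u \<omega> \<bullet> ((W (k + i) \<omega> - Wt) *v z \<omega>)\<bar> \<le> \<rho> * (norm (u \<omega>) * norm (z \<omega>))"
      by (rule bilinear_matrix_bound[OF W_space[OF w]])
    also have "\<dots> \<le> \<rho> * (cu * cz)"
      using u(2)[OF w] z(2)[OF w] deviation_nonneg order_trans[OF norm_ge_zero u(2)[OF w]]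
      by (intro mult_left_mono mult_mono) auto
    finally show "\<bar>u \<omega> \<bullet> ((W (k + i) \<omega> - Wt) *v z \<omega>)\<bar> \<le> \<rho> * (cu * cz)" .
  qed
  have "\<bar>\<integral>\<omega>. u \<omega> \<bullet> (\<Sum>i = 1..n. (W (k + i) \<omega> - Wt) *v z \<omega>) \<partial>P\<bar>
    = \<bar>\<Sum>i = 1..n. \<integral>\<omega>. u \<omega> \<bullet> ((W (k + i) \<omega> - Wt) *v z \<omega>) \<partial>P\<bar>"
    using ii by (simp add: inner_sum_right Bochner_Integration.integral_sum)
  also have "\<dots> \<le> (\<Sum>i = 1..n. \<bar>\<integral>\<omega>. u \<omega> \<bullet> ((W (k + i) \<omega> - Wt) *v z \<omega>) \<partial>P\<bar>)" by (rule sum_abs)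
  also have "\<dots> \<le> (\<Sum>i = 1..n. 2 * \<rho> * (1/4) ^ (i div \<tau>) * ?E)"
    by (intro sum_mono deviation_decorrelation[OF u z])
  also have "\<dots> = (\<Sum>i = 1..n. (1/4) ^ (i div \<tau>)) * (2 * \<rho> * ?E)"
    by (simp add: sum_distrib_left sum_distrib_right algebra_simps)
  also have "\<dots> \<le> (4 / 3 * real \<tau>) * (2 * \<rho> * ?E)"
    using erg deviation_nonneg E0 unfolding uniformly_geometrically_ergodic_def
    by (intro mult_right_mono sum_mixing_le mult_nonneg_nonneg) auto
  finally show ?thesis by (simp add: algebra_simps)
qed

text \<open>Adding the summands one at a time: the new summand is decorrelated from each earlier one, and the
  resulting covariances are summable with sum of order \<open>\<tau>\<close>.\<close>

lemma batch_variance: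
  fixes z :: "'o \<Rightarrow> real^'n"
  assumes z: "z \<in> borel_measurable (past P S W k)" "\<And>\<omega>. \<omega> \<in> space P \<Longrightarrow> norm (z \<omega>) \<le> cz"
  shows "(\<integral>\<omega>. (norm (\<Sum>i = 1..n. (W (k + i) \<omega> - Wt) *v z \<omega>))\<^sup>2 \<partial>P)
    \<le> real n * (19 / 3 * real \<tau> * \<rho>\<^sup>2 * (\<integral>\<omega>. (norm (z \<omega>))\<^sup>2 \<partial>P))"
proof (induction n)
  case (Suc n)
  define D where "D i \<omega> = (W (k + i) \<omega> - Wt) *v z \<omega>" for i \<omega>
  let ?E = "\<integral>\<omega>. (norm (z \<omega>))\<^sup>2 \<partial>P"
  have E0: "?E \<ge> 0" by simp
  have tau: "\<tau> \<ge> 1" using erg by (simp add: uniformly_geometrically_ergodic_def)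
  have zm: "z \<in> borel_measurable P" by (rule measurable_past[OF z(1)])
  have Dp: "D i \<in> borel_measurable (past P S W (k + i))" for i
    unfolding D_def by (rule deviation_measurable_past[OF z(1)])
  have Dm: "D i \<in> borel_measurable P" for i by (rule measurable_past[OF Dp])
  have Db': "norm (D i \<omega>) \<le> \<rho> * norm (z \<omega>)" if "\<omega> \<in> space P" for i \<omega>
    unfolding D_def by (rule norm_deviation_le[OF W_space[OF that]])
  have Db: "norm (D i \<omega>) \<le> \<rho> * cz" if "\<omega> \<in> space P" for i \<omega>
    using Db'[OF that, of i] mult_left_mono[OF z(2)[OF that] deviation_nonneg] by linarith
  have zi: "integrable P (\<lambda>\<omega>. (norm (z \<omega>))\<^sup>2)"
    unfolding power2_eq_square by (rule integrable_mult_bounded[of _ _ cz cz]) (use zm z(2) in auto)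
  have Dij: "integrable P (\<lambda>\<omega>. D i \<omega> \<bullet> D j \<omega>)" for i j
  proof (rule integrable_bounded_real)
    show "(\<lambda>\<omega>. D i \<omega> \<bullet> D j \<omega>) \<in> borel_measurable P" using Dm by measurable
    fix \<omega> assume w: "\<omega> \<in> space P"
    show "\<bar>D i \<omega> \<bullet> D j \<omega>\<bar> \<le> (\<rho> * cz) * (\<rho> * cz)"
      using Db[OF w] order_trans[OF norm_ge_zero Db[OF w, of i]]
      by (intro order_trans[OF Cauchy_Schwarz_ineq2] mult_mono) auto
  qed
  have cross: "(\<integral>\<omega>. D i \<omega> \<bullet> D (Suc n) \<omega> \<partial>P) \<le> 2 * \<rho>\<^sup>2 * ?E * (1/4) ^ ((Suc n - i) div \<tau>)" if i: "i \<in> {1..n}" for i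
  proof -
    have "(\<integral>\<omega>. D i \<omega> \<bullet> D (Suc n) \<omega> \<partial>P) \<le> \<bar>\<integral>\<omega>. D i \<omega> \<bullet> ((W ((k + i) + (Suc n - i)) \<omega> - Wt) *v z \<omega>) \<partial>P\<bar>"
      using i by (simp add: D_def[of "Suc n"])
    also have "\<dots> \<le> 2 * \<rho> * (1/4) ^ ((Suc n - i) div \<tau>) * (\<integral>\<omega>. norm (D i \<omega>) * norm (z \<omega>) \<partial>P)"
      by (rule deviation_decorrelation[OF Dp Db measurable_past_mono[OF z(1)] z(2)]) auto
    also have "\<dots> \<le> 2 * \<rho> * (1/4) ^ ((Suc n - i) div \<tau>) * (\<integral>\<omega>. \<rho> * (norm (z \<omega>))\<^sup>2 \<partial>P)"
    proof (rule mult_left_mono)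
      show "(\<integral>\<omega>. norm (D i \<omega>) * norm (z \<omega>) \<partial>P) \<le> (\<integral>\<omega>. \<rho> * (norm (z \<omega>))\<^sup>2 \<partial>P)"
      proof (rule integral_mono)
        show "integrable P (\<lambda>\<omega>. norm (D i \<omega>) * norm (z \<omega>))"
          by (rule integrable_mult_bounded[of _ _ "\<rho> * cz" cz]) (use Dm zm Db z(2) in auto)
        show "integrable P (\<lambda>\<omega>. \<rho> * (norm (z \<omega>))\<^sup>2)" using zi by simp
        fix \<omega> assume "\<omega> \<in> space P"
        from mult_right_mono[OF Db'[OF this, of i], of "norm (z \<omega>)"]
        show "norm (D i \<omega>) * norm (z \<omega>) \<le> \<rho> * (norm (z \<omega>))\<^sup>2" by (simp add: power2_eq_square)
      qed
    qed (use deviation_nonneg in auto)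
    finally show ?thesis by (simp add: power2_eq_square algebra_simps)
  qed
  have "(\<integral>\<omega>. (norm (\<Sum>i = 1..Suc n. D i \<omega>))\<^sup>2 \<partial>P)
    = (\<integral>\<omega>. (norm (\<Sum>i = 1..n. D i \<omega>))\<^sup>2 + 2 * (\<Sum>i = 1..n. D i \<omega> \<bullet> D (Suc n) \<omega>) + D (Suc n) \<omega> \<bullet> D (Suc n) \<omega> \<partial>P)"
  proof (rule Bochner_Integration.integral_cong[OF refl])
    fix \<omega>
    have e: "(norm (x + y))\<^sup>2 = (norm x)\<^sup>2 + 2 * (x \<bullet> y) + y \<bullet> y" for x y :: "real^'n"
      unfolding power2_norm_eq_inner by (simp add: inner_add_left inner_add_right inner_commute)
    have s: "(\<Sum>i = 1..Suc n. D i \<omega>) = (\<Sum>i = 1..n. D i \<omega>) + D (Suc n) \<omega>" by simp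
    show "(norm (\<Sum>i = 1..Suc n. D i \<omega>))\<^sup>2 = (norm (\<Sum>i = 1..n. D i \<omega>))\<^sup>2
        + 2 * (\<Sum>i = 1..n. D i \<omega> \<bullet> D (Suc n) \<omega>) + D (Suc n) \<omega> \<bullet> D (Suc n) \<omega>"
      unfolding s e inner_sum_left ..
  qed
  also have "\<dots> = (\<integral>\<omega>. (norm (\<Sum>i = 1..n. D i \<omega>))\<^sup>2 \<partial>P) + 2 * (\<Sum>i = 1..n. \<integral>\<omega>. D i \<omega> \<bullet> D (Suc n) \<omega> \<partial>P)
      + (\<integral>\<omega>. D (Suc n) \<omega> \<bullet> D (Suc n) \<omega> \<partial>P)"
  proof -
    have "integrable P (\<lambda>\<omega>. (norm (\<Sum>i = 1..n. D i \<omega>))\<^sup>2)"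
      unfolding power2_norm_eq_inner inner_sum_left inner_sum_right by (intro Bochner_Integration.integrable_sum Dij)
    then show ?thesis using Dij
      by (simp add: Bochner_Integration.integral_sum Bochner_Integration.integrable_sum)
  qed
  also have "(\<integral>\<omega>. D (Suc n) \<omega> \<bullet> D (Suc n) \<omega> \<partial>P) \<le> (\<integral>\<omega>. \<rho>\<^sup>2 * (norm (z \<omega>))\<^sup>2 \<partial>P)"
  proof (rule integral_mono[OF Dij])
    fix \<omega> assume "\<omega> \<in> space P"
    from power_mono[OF Db'[OF this, of "Suc n"], of 2]
    show "D (Suc n) \<omega> \<bullet> D (Suc n) \<omega> \<le> \<rho>\<^sup>2 * (norm (z \<omega>))\<^sup>2" by (simp add: power2_norm_eq_inner power_mult_distrib)
  qed (use zi in simp)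
  also have "(\<integral>\<omega>. \<rho>\<^sup>2 * (norm (z \<omega>))\<^sup>2 \<partial>P) = \<rho>\<^sup>2 * ?E" by simp
  also have "\<dots> \<le> real \<tau> * (\<rho>\<^sup>2 * ?E)" using tau E0 mult_right_mono[of 1 "real \<tau>" "\<rho>\<^sup>2 * ?E"] by simp
  also have "(\<Sum>i = 1..n. \<integral>\<omega>. D i \<omega> \<bullet> D (Suc n) \<omega> \<partial>P) \<le> (\<Sum>i = 1..n. 2 * \<rho>\<^sup>2 * ?E * (1/4) ^ ((Suc n - i) div \<tau>))"
    by (intro sum_mono cross)
  also have "\<dots> = 2 * \<rho>\<^sup>2 * ?E * (\<Sum>i = 1..n. (1/4) ^ (i div \<tau>))"
    unfolding sum_distrib_left[symmetric]
    by (subst sum.atLeastAtMost_rev) simp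
  also have "\<dots> \<le> 2 * \<rho>\<^sup>2 * ?E * (4 / 3 * real \<tau>)"
    by (intro mult_left_mono sum_mixing_le tau) (use E0 in auto)
  also have "(\<integral>\<omega>. (norm (\<Sum>i = 1..n. D i \<omega>))\<^sup>2 \<partial>P) \<le> real n * (19 / 3 * real \<tau> * \<rho>\<^sup>2 * ?E)"
    using Suc.IH by (simp add: D_def)
  finally show ?case unfolding D_def[symmetric] by (simp add: algebra_simps)
qed simp

end

section \<open>A Lyapunov function for the accelerated iteration\<close>

text \<open>\<open>U\<close> stands for \<open>Wt / \<lambda>\<close>.\<close>

definition lyapunov :: "('a::real_inner \<Rightarrow> 'a) \<Rightarrow> 'a \<Rightarrow> 'a \<Rightarrow> real" where
  "lyapunov U x x\<^sub>f = (norm (x + x\<^sub>f))\<^sup>2 + 12 * (x\<^sub>f \<bullet> U x\<^sub>f)"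

text \<open>The coefficient of the noise in the part of the next Lyapunov value that is linear in it.\<close>

definition noise_gradient :: "('a::real_inner \<Rightarrow> 'a) \<Rightarrow> real \<Rightarrow> 'a \<Rightarrow> 'a \<Rightarrow> 'a" where
  "noise_gradient U \<beta> z q =
     - (2 * (1 + \<beta>)) *\<^sub>R (2 *\<^sub>R z + (4 - 5 * \<beta> + \<beta>\<^sup>2) *\<^sub>R q - (3 * \<beta> * (1 + \<beta>)) *\<^sub>R U z)
     - (24 * \<beta>) *\<^sub>R U (z - (3 * \<beta>\<^sup>2) *\<^sub>R U z)"

lemma lyapunov_perturbation:
  fixes U :: "'a::real_inner \<Rightarrow> 'a"
  assumes lin: "linear U" and sym: "\<And>x y. x \<bullet> U y = U x \<bullet> y"
  shows "lyapunov U (z + ((4 - \<beta>) * (1 - \<beta>)) *\<^sub>R q - (3 * \<beta>) *\<^sub>R U z - e) (z - (3 * \<beta>\<^sup>2) *\<^sub>R U z - \<beta> *\<^sub>R e)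
    = lyapunov U (z + ((4 - \<beta>) * (1 - \<beta>)) *\<^sub>R q - (3 * \<beta>) *\<^sub>R U z) (z - (3 * \<beta>\<^sup>2) *\<^sub>R U z)
      + noise_gradient U \<beta> z q \<bullet> e + ((1 + \<beta>)\<^sup>2 * (e \<bullet> e) + 12 * \<beta>\<^sup>2 * (e \<bullet> U e))"
proof -
  define y where "y = z - (3 * \<beta>\<^sup>2) *\<^sub>R U z"
  define v where "v = 2 *\<^sub>R z + (4 - 5 * \<beta> + \<beta>\<^sup>2) *\<^sub>R q - (3 * \<beta> * (1 + \<beta>)) *\<^sub>R U z"
  have s0: "z + ((4 - \<beta>) * (1 - \<beta>)) *\<^sub>R q - (3 * \<beta>) *\<^sub>R U z + y = v"
  proof -
    have e: "4 - 5 * \<beta> + \<beta>\<^sup>2 = (4 - \<beta>) * (1 - \<beta>)" "3 * \<beta> * (1 + \<beta>) = 3 * \<beta> + 3 * \<beta>\<^sup>2"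
      by (simp_all add: algebra_simps power2_eq_square)
    show ?thesis unfolding y_def v_def e scaleR_left_distrib scaleR_2 by (simp only: algebra_simps)
  qed
  have s1: "z + ((4 - \<beta>) * (1 - \<beta>)) *\<^sub>R q - (3 * \<beta>) *\<^sub>R U z - e + (y - \<beta> *\<^sub>R e) = v - (1 + \<beta>) *\<^sub>R e"
    unfolding s0[symmetric] by (simp add: algebra_simps)
  have U1: "U (y - \<beta> *\<^sub>R e) = U y - \<beta> *\<^sub>R U e" by (simp add: linear_diff[OF lin] linear_scale[OF lin])
  have ey: "e \<bullet> U y = y \<bullet> U e" using sym[of e y] by (simp add: inner_commute)
  have n: "noise_gradient U \<beta> z q = - (2 * (1 + \<beta>)) *\<^sub>R v - (24 * \<beta>) *\<^sub>R U y"
    unfolding noise_gradient_def y_def v_def ..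
  have sq: "(norm (v - (1 + \<beta>) *\<^sub>R e))\<^sup>2 = (norm v)\<^sup>2 - 2 * (1 + \<beta>) * (v \<bullet> e) + (1 + \<beta>)\<^sup>2 * (e \<bullet> e)"
    unfolding power2_norm_eq_inner
    by (simp add: inner_diff_left inner_diff_right inner_commute[of e v] power2_eq_square algebra_simps)
  have ye: "y \<bullet> U e = U y \<bullet> e" "e \<bullet> U y = U y \<bullet> e" using sym[of y e] by (simp_all add: inner_commute)
  have qu: "(y - \<beta> *\<^sub>R e) \<bullet> (U y - \<beta> *\<^sub>R U e) = y \<bullet> U y - 2 * \<beta> * (U y \<bullet> e) + \<beta>\<^sup>2 * (e \<bullet> U e)"
    by (simp add: inner_diff_left inner_diff_right ye power2_eq_square algebra_simps)
  have li: "noise_gradient U \<beta> z q \<bullet> e = - (2 * (1 + \<beta>) * (v \<bullet> e)) - 24 * \<beta> * (U y \<bullet> e)"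
    unfolding n by (simp only: inner_diff_left inner_scaleR_left)
  show ?thesis
    unfolding y_def[symmetric] lyapunov_def s0 s1 U1 sq qu li by simp
qed

text \<open>The amount by which a noiseless step misses the factor \<open>1 - \<beta> / 2\<close> (negative when it does better), as a
  quadratic form in \<open>z\<close>, \<open>q\<close> and \<open>U z\<close>.\<close>

lemma lyapunov_drift_identity:
  fixes U :: "'a::real_inner \<Rightarrow> 'a"
  assumes lin: "linear U" and sym: "\<And>x y. x \<bullet> U y = U x \<bullet> y"
  shows "lyapunov U (z + ((4 - \<beta>) * (1 - \<beta>)) *\<^sub>R q - (3 * \<beta>) *\<^sub>R U z) (z - (3 * \<beta>\<^sup>2) *\<^sub>R U z)
      - (1 - \<beta> / 2) * lyapunov U (z + (4 - \<beta>) *\<^sub>R q) (z - (\<beta> * (1 - \<beta>)) *\<^sub>R q)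
    = 2 * \<beta> * (z \<bullet> z) + 4 * (- \<beta> - \<beta>\<^sup>2 + \<beta>^3 / 2) * (z \<bullet> q)
      + ((4 - 5 * \<beta> + \<beta>\<^sup>2)\<^sup>2 - (1 - \<beta> / 2) * (4 - 2 * \<beta> + \<beta>\<^sup>2)\<^sup>2) * (q \<bullet> q)
      - (6 * \<beta> + 12 * \<beta>\<^sup>2) * (z \<bullet> U z) + \<beta>\<^sup>2 * (- 30 + 36 * \<beta> - 6 * \<beta>\<^sup>2) * (q \<bullet> U z)
      + (9 * \<beta>\<^sup>2 * (1 + \<beta>)\<^sup>2 - 72 * \<beta>\<^sup>2) * (U z \<bullet> U z) + 108 * \<beta>^4 * (U z \<bullet> U (U z))
      - 12 * (1 - \<beta> / 2) * (\<beta> * (1 - \<beta>))\<^sup>2 * (q \<bullet> U q)"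
proof -
  have s0: "z + ((4 - \<beta>) * (1 - \<beta>)) *\<^sub>R q - (3 * \<beta>) *\<^sub>R U z + (z - (3 * \<beta>\<^sup>2) *\<^sub>R U z)
     = 2 *\<^sub>R z + (4 - 5 * \<beta> + \<beta>\<^sup>2) *\<^sub>R q - (3 * \<beta> * (1 + \<beta>)) *\<^sub>R U z"
  proof -
    have e: "4 - 5 * \<beta> + \<beta>\<^sup>2 = (4 - \<beta>) * (1 - \<beta>)" "3 * \<beta> * (1 + \<beta>) = 3 * \<beta> + 3 * \<beta>\<^sup>2"
      by (simp_all add: algebra_simps power2_eq_square)
    show ?thesis unfolding  e scaleR_left_distrib scaleR_2 by (simp only: algebra_simps)
  qed
  have s1: "z + (4 - \<beta>) *\<^sub>R q + (z - (\<beta> * (1 - \<beta>)) *\<^sub>R q) = 2 *\<^sub>R z + (4 - 2 * \<beta> + \<beta>\<^sup>2) *\<^sub>R q"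
  proof -
    have e: "4 - 2 * \<beta> + \<beta>\<^sup>2 = (4 - \<beta>) - \<beta> * (1 - \<beta>)" by (simp add: algebra_simps power2_eq_square)
    show ?thesis unfolding e scaleR_left_diff_distrib scaleR_2 by (simp only: algebra_simps)
  qed
  have U: "U (z - (3 * \<beta>\<^sup>2) *\<^sub>R U z) = U z - (3 * \<beta>\<^sup>2) *\<^sub>R U (U z)"
    "U (z - (\<beta> * (1 - \<beta>)) *\<^sub>R q) = U z - (\<beta> * (1 - \<beta>)) *\<^sub>R U q"
    by (simp_all add: linear_diff[OF lin] linear_scale[OF lin])
  have c: "z \<bullet> U (U z) = U z \<bullet> U z" "z \<bullet> U q = q \<bullet> U z" "U z \<bullet> q = q \<bullet> U z" "q \<bullet> z = z \<bullet> q"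
     "U z \<bullet> z = z \<bullet> U z"
    using sym[of z "U z"] sym[of z q] by (simp_all add: inner_commute)
  have n1: "(norm (2 *\<^sub>R z + (4 - 5 * \<beta> + \<beta>\<^sup>2) *\<^sub>R q - (3 * \<beta> * (1 + \<beta>)) *\<^sub>R U z))\<^sup>2
     = 4 * (z \<bullet> z) + (4 - 5 * \<beta> + \<beta>\<^sup>2)\<^sup>2 * (q \<bullet> q) + (3 * \<beta> * (1 + \<beta>))\<^sup>2 * (U z \<bullet> U z)
       + 4 * (4 - 5 * \<beta> + \<beta>\<^sup>2) * (z \<bullet> q) - 4 * (3 * \<beta> * (1 + \<beta>)) * (z \<bullet> U z)
       - 2 * (4 - 5 * \<beta> + \<beta>\<^sup>2) * (3 * \<beta> * (1 + \<beta>)) * (q \<bullet> U z)" for \<beta>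
    unfolding power2_norm_eq_inner
    by (simp only: inner_add_left inner_add_right inner_diff_left inner_diff_right inner_scaleR_left inner_scaleR_right c)
      (simp add: algebra_simps power2_eq_square)
  have n2: "(norm (2 *\<^sub>R z + (4 - 2 * \<beta> + \<beta>\<^sup>2) *\<^sub>R q))\<^sup>2
     = 4 * (z \<bullet> z) + (4 - 2 * \<beta> + \<beta>\<^sup>2)\<^sup>2 * (q \<bullet> q) + 4 * (4 - 2 * \<beta> + \<beta>\<^sup>2) * (z \<bullet> q)"
    unfolding power2_norm_eq_inner
    by (simp only: inner_add_left inner_add_right inner_diff_left inner_diff_right inner_scaleR_left inner_scaleR_right c)
      (simp add: algebra_simps power2_eq_square)
  have n3: "(z - (3 * \<beta>\<^sup>2) *\<^sub>R U z) \<bullet> (U z - (3 * \<beta>\<^sup>2) *\<^sub>R U (U z))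
     = z \<bullet> U z - 6 * \<beta>\<^sup>2 * (U z \<bullet> U z) + 9 * \<beta>^4 * (U z \<bullet> U (U z))"
    by (simp add: inner_diff_left inner_diff_right c algebra_simps power2_eq_square power4_eq_xxxx)
  have n4: "(z - (\<beta> * (1 - \<beta>)) *\<^sub>R q) \<bullet> (U z - (\<beta> * (1 - \<beta>)) *\<^sub>R U q)
     = z \<bullet> U z - 2 * (\<beta> * (1 - \<beta>)) * (q \<bullet> U z) + (\<beta> * (1 - \<beta>))\<^sup>2 * (q \<bullet> U q)"
    by (simp add: inner_diff_left inner_diff_right c algebra_simps power2_eq_square)
  have poly: "4 * t1 + (4 - 5 * \<beta> + \<beta>\<^sup>2)\<^sup>2 * t2 + (3 * \<beta> * (1 + \<beta>))\<^sup>2 * t3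
       + 4 * (4 - 5 * \<beta> + \<beta>\<^sup>2) * t4 - 4 * (3 * \<beta> * (1 + \<beta>)) * t5
       - 2 * (4 - 5 * \<beta> + \<beta>\<^sup>2) * (3 * \<beta> * (1 + \<beta>)) * t6
       + 12 * (t5 - 6 * \<beta>\<^sup>2 * t3 + 9 * \<beta>^4 * t7)
       - (1 - \<beta> / 2) * (4 * t1 + (4 - 2 * \<beta> + \<beta>\<^sup>2)\<^sup>2 * t2 + 4 * (4 - 2 * \<beta> + \<beta>\<^sup>2) * t4
           + 12 * (t5 - 2 * (\<beta> * (1 - \<beta>)) * t6 + (\<beta> * (1 - \<beta>))\<^sup>2 * t8))
    = 2 * \<beta> * t1 + 4 * (- \<beta> - \<beta>\<^sup>2 + \<beta>^3 / 2) * t4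
      + ((4 - 5 * \<beta> + \<beta>\<^sup>2)\<^sup>2 - (1 - \<beta> / 2) * (4 - 2 * \<beta> + \<beta>\<^sup>2)\<^sup>2) * t2
      - (6 * \<beta> + 12 * \<beta>\<^sup>2) * t5 + \<beta>\<^sup>2 * (- 30 + 36 * \<beta> - 6 * \<beta>\<^sup>2) * t6
      + (9 * \<beta>\<^sup>2 * (1 + \<beta>)\<^sup>2 - 72 * \<beta>\<^sup>2) * t3 + 108 * \<beta>^4 * t7
      - 12 * (1 - \<beta> / 2) * (\<beta> * (1 - \<beta>))\<^sup>2 * t8" for t1 t2 t3 t4 t5 t6 t7 t8 :: real
    by (simp add: algebra_simps power2_eq_square power3_eq_cube power4_eq_xxxx)
  show ?thesis
    unfolding lyapunov_def s0 s1 U n1 n2 n3 n4 by (rule poly)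
qed

text \<open>Completing the square, first in \<open>V\<close> and then in \<open>X\<close>.\<close>

lemma quadratic_form_nonpos:
  fixes X Y V :: real
  assumes "X \<ge> 0" "Y \<ge> 0"
  shows "- (2187 / 1000) * X\<^sup>2 + 8 * (X * Y) + 57 / 5 * (X * V) + 30 * (Y * V) - 127 / 10 * Y\<^sup>2 - 204 * V\<^sup>2 \<le> 0"
proof -
  have "0 \<le> (408 * V - 57 / 5 * X - 30 * Y)\<^sup>2" by simp
  then have a: "0 \<le> 166464 * V\<^sup>2 + 3249 / 25 * X\<^sup>2 + 900 * Y\<^sup>2 - 46512 / 5 * (X * V) - 24480 * (Y * V) + 684 * (X * Y)"
    by (simp add: power2_eq_square algebra_simps)
  have "0 \<le> (X - 221 / 100 * Y)\<^sup>2" by simp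
  then have b: "0 \<le> X\<^sup>2 + 48841 / 10000 * Y\<^sup>2 - 442 / 100 * (X * Y)"
    by (simp add: power2_eq_square algebra_simps)
  have "0 \<le> X\<^sup>2" "0 \<le> Y\<^sup>2" "0 \<le> X * Y" using assms by auto
  with a b show ?thesis by linarith
qed

text \<open>The two extra terms on the left are the allowances for the bias and for the variance of the noise. With
  \<open>X = \<parallel>z\<parallel>\<close>, \<open>Y = \<parallel>q\<parallel>\<close> and \<open>V = \<beta> \<parallel>U z\<parallel>\<close>, every term is at most \<open>\<beta>\<close> times a monomial of
  degree two, and the sum of these is the form of \<open>quadratic_form_nonpos\<close>. The term \<open>-204 V\<^sup>2\<close>
  comes from the descent of \<open>x\<^sub>f\<close> and uses the upper bound on the stepsize.\<close>

lemma lyapunov_contraction: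
  fixes U :: "'a::real_inner \<Rightarrow> 'a"
  assumes lin: "linear U" and sym: "\<And>x y. x \<bullet> U y = U x \<bullet> y"
    and psd: "\<And>y. 0 \<le> y \<bullet> U y" and ub: "\<And>y. \<beta>\<^sup>2 * (y \<bullet> U y) \<le> (y \<bullet> y) / 16"
    and ubn: "\<And>y. \<beta>\<^sup>2 * norm (U y) \<le> norm y / 16"
    and lb: "z \<bullet> z \<le> z \<bullet> U z" and \<beta>: "0 < \<beta>" "\<beta> \<le> 1 / 4"
  shows "lyapunov U (z + ((4 - \<beta>) * (1 - \<beta>)) *\<^sub>R q - (3 * \<beta>) *\<^sub>R U z) (z - (3 * \<beta>\<^sup>2) *\<^sub>R U z)
      + 3 / 10 * \<beta> * (norm (noise_gradient U \<beta> z q) * norm z) + 312 / 1000 * \<beta> * (norm z)\<^sup>2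
    \<le> (1 - \<beta> / 2) * lyapunov U (z + (4 - \<beta>) *\<^sub>R q) (z - (\<beta> * (1 - \<beta>)) *\<^sub>R q)"
proof -
  define X where "X = norm z" define Y where "Y = norm q" define V where "V = \<beta> * norm (U z)"
  have nn: "X \<ge> 0" "Y \<ge> 0" "V \<ge> 0" using \<beta> by (auto simp: X_def Y_def V_def)
  have b2: "\<beta>\<^sup>2 \<le> \<beta> / 4" using \<beta> mult_left_mono[of \<beta> "1/4" \<beta>] by (simp add: power2_eq_square)
  have b20: "0 \<le> \<beta>\<^sup>2" by simp
  have b3: "0 \<le> \<beta>^3" "\<beta>^3 \<le> \<beta>\<^sup>2 / 4"
    using \<beta> mult_left_mono[of \<beta> "1/4" "\<beta>\<^sup>2"] by (simp_all add: power3_eq_cube power2_eq_square)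
  have XX: "z \<bullet> z = X\<^sup>2" and YY: "q \<bullet> q = Y\<^sup>2" by (simp_all add: X_def Y_def power2_norm_eq_inner)
  have VV: "\<beta>\<^sup>2 * (U z \<bullet> U z) = V\<^sup>2" by (simp add: V_def power_mult_distrib power2_norm_eq_inner)
  have t2: "4 * (- \<beta> - \<beta>\<^sup>2 + \<beta>^3 / 2) * (z \<bullet> q) \<le> \<beta> * (5 * (X * Y))"
  proof -
    have "4 * (- \<beta> - \<beta>\<^sup>2 + \<beta>^3 / 2) * (z \<bullet> q) \<le> \<bar>4 * (- \<beta> - \<beta>\<^sup>2 + \<beta>^3 / 2)\<bar> * \<bar>z \<bullet> q\<bar>"
      by (metis abs_ge_self abs_mult)
    also have "\<dots> \<le> (5 * \<beta>) * (X * Y)"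
    proof (rule mult_mono)
      show "\<bar>4 * (- \<beta> - \<beta>\<^sup>2 + \<beta>^3 / 2)\<bar> \<le> 5 * \<beta>" proof -
        have "\<bar>4 * (- a - b + c / 2)\<bar> \<le> 5 * a" if "0 < a" "0 \<le> b" "b \<le> a / 4" "0 \<le> c" "c \<le> b / 4" for a b c :: real
        proof -
          have e: "4 * (- a - b + c / 2) = 2 * c - 4 * a - 4 * b" by (simp add: algebra_simps)
          show ?thesis unfolding e by (rule abs_leI) (use that in linarith)+
        qed
        then show ?thesis using \<beta> b2 b20 b3 by blast
      qed
      show "\<bar>z \<bullet> q\<bar> \<le> X * Y" using Cauchy_Schwarz_ineq2[of z q] by (simp add: X_def Y_def)
    qed (use \<beta> in auto)
    finally show ?thesis by simp
  qed
  have t3: "((4 - 5 * \<beta> + \<beta>\<^sup>2)\<^sup>2 - (1 - \<beta> / 2) * (4 - 2 * \<beta> + \<beta>\<^sup>2)\<^sup>2) * (q \<bullet> q) \<le> \<beta> * (- (127 / 10) * Y\<^sup>2)"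
  proof -
    have "(4 - 5 * \<beta> + \<beta>\<^sup>2)\<^sup>2 - (1 - \<beta> / 2) * (4 - 2 * \<beta> + \<beta>\<^sup>2)\<^sup>2
       = - 16 * \<beta> + 13 * \<beta>\<^sup>2 + \<beta>^3 * (\<beta>\<^sup>2 / 2 - 2 * \<beta>)"
      by (simp add: power2_eq_square power3_eq_cube algebra_simps)
    also have "\<beta>^3 * (\<beta>\<^sup>2 / 2 - 2 * \<beta>) \<le> 0" using b3 b2 \<beta> by (intro mult_nonneg_nonpos) auto
    also have "- 16 * \<beta> + 13 * \<beta>\<^sup>2 + 0 \<le> - (127 / 10) * \<beta>" using b2 \<beta> by simp
    finally have "(4 - 5 * \<beta> + \<beta>\<^sup>2)\<^sup>2 - (1 - \<beta> / 2) * (4 - 2 * \<beta> + \<beta>\<^sup>2)\<^sup>2 \<le> - (127 / 10) * \<beta>" by simp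
    from mult_right_mono[OF this, of "Y\<^sup>2"] show ?thesis by (simp add: YY algebra_simps)
  qed
  have t4: "\<beta> * (6 * X\<^sup>2) \<le> (6 * \<beta> + 12 * \<beta>\<^sup>2) * (z \<bullet> U z)"
  proof -
    have "(6 * \<beta>) * X\<^sup>2 \<le> (6 * \<beta> + 12 * \<beta>\<^sup>2) * (z \<bullet> U z)"
      using \<beta> lb by (intro mult_mono) (auto simp: XX)
    then show ?thesis by (simp add: algebra_simps)
  qed
  have t5: "\<beta>\<^sup>2 * (- 30 + 36 * \<beta> - 6 * \<beta>\<^sup>2) * (q \<bullet> U z) \<le> \<beta> * (30 * (Y * V))"
  proof -
    have "\<beta>\<^sup>2 * (- 30 + 36 * \<beta> - 6 * \<beta>\<^sup>2) * (q \<bullet> U z) \<le> \<bar>\<beta>\<^sup>2 * (- 30 + 36 * \<beta> - 6 * \<beta>\<^sup>2)\<bar> * \<bar>q \<bullet> U z\<bar>"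
      by (metis abs_ge_self abs_mult)
    also have "\<dots> \<le> (30 * \<beta>\<^sup>2) * (Y * norm (U z))"
    proof (rule mult_mono)
      have "\<bar>- 30 + 36 * \<beta> - 6 * \<beta>\<^sup>2\<bar> \<le> 30" using \<beta> b2 b20 unfolding abs_le_iff by linarith
      from mult_left_mono[OF this b20] show "\<bar>\<beta>\<^sup>2 * (- 30 + 36 * \<beta> - 6 * \<beta>\<^sup>2)\<bar> \<le> 30 * \<beta>\<^sup>2"
        by (simp add: abs_mult)
      show "\<bar>q \<bullet> U z\<bar> \<le> Y * norm (U z)" using Cauchy_Schwarz_ineq2[of q "U z"] by (simp add: Y_def)
    qed auto
    also have "\<dots> = \<beta> * (30 * (Y * V))" by (simp add: V_def power2_eq_square)
    finally show ?thesis .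
  qed
  have t6: "(9 * \<beta>\<^sup>2 * (1 + \<beta>)\<^sup>2 - 72 * \<beta>\<^sup>2) * (U z \<bullet> U z) + 108 * \<beta>^4 * (U z \<bullet> U (U z)) \<le> \<beta> * (- 204 * V\<^sup>2)"
  proof -
    have "(1 + \<beta>)\<^sup>2 \<le> (5 / 4)\<^sup>2" using \<beta> by (intro power_mono) auto
    then have c: "9 * (1 + \<beta>)\<^sup>2 - 72 \<le> - (579 / 10)" by (simp add: power2_eq_square)
    have "(9 * \<beta>\<^sup>2 * (1 + \<beta>)\<^sup>2 - 72 * \<beta>\<^sup>2) * (U z \<bullet> U z) = (9 * (1 + \<beta>)\<^sup>2 - 72) * V\<^sup>2"
      by (simp add: VV[symmetric] algebra_simps)
    also have "\<dots> \<le> - (579 / 10) * V\<^sup>2" using c by (rule mult_right_mono) simp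
    finally have A: "(9 * \<beta>\<^sup>2 * (1 + \<beta>)\<^sup>2 - 72 * \<beta>\<^sup>2) * (U z \<bullet> U z) \<le> - (579 / 10) * V\<^sup>2" .
    have "108 * \<beta>^4 * (U z \<bullet> U (U z)) = 108 * (\<beta>\<^sup>2 * (\<beta>\<^sup>2 * (U z \<bullet> U (U z))))"
      by (simp add: power2_eq_square power4_eq_xxxx)
    also have "\<dots> \<le> 108 * (\<beta>\<^sup>2 * ((U z \<bullet> U z) / 16))"
      using ub[of "U z"] by (intro mult_left_mono) auto
    also have "\<dots> = 27 / 4 * V\<^sup>2" by (simp add: VV[symmetric])
    finally have B: "108 * \<beta>^4 * (U z \<bullet> U (U z)) \<le> 27 / 4 * V\<^sup>2" .
    have "(4 * \<beta>) * (51 * V\<^sup>2) \<le> 1 * (51 * V\<^sup>2)" using \<beta> by (intro mult_right_mono) auto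
    then have C: "\<beta> * (- 204 * V\<^sup>2) \<ge> - 51 * V\<^sup>2" by simp
    have "0 \<le> V\<^sup>2" by simp
    then show ?thesis using A B C by linarith
  qed
  have t8: "0 \<le> 12 * (1 - \<beta> / 2) * (\<beta> * (1 - \<beta>))\<^sup>2 * (q \<bullet> U q)" using \<beta> psd[of q] by simp
  have ng: "norm (noise_gradient U \<beta> z q) \<le> 5 * X + 10 * Y + 38 * V"
  proof -
    have "norm (noise_gradient U \<beta> z q) \<le>
       norm ((2 * (1 + \<beta>)) *\<^sub>R (2 *\<^sub>R z + (4 - 5 * \<beta> + \<beta>\<^sup>2) *\<^sub>R q - (3 * \<beta> * (1 + \<beta>)) *\<^sub>R U z))
       + norm ((24 * \<beta>) *\<^sub>R U (z - (3 * \<beta>\<^sup>2) *\<^sub>R U z))"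
      unfolding noise_gradient_def scaleR_minus_left
      by (rule order_trans[OF norm_triangle_ineq4]) (simp only: norm_minus_cancel order_refl)
    moreover have "norm ((2 * (1 + \<beta>)) *\<^sub>R (2 *\<^sub>R z + (4 - 5 * \<beta> + \<beta>\<^sup>2) *\<^sub>R q - (3 * \<beta> * (1 + \<beta>)) *\<^sub>R U z))
        \<le> (5 / 2) * (2 * X + 4 * Y + 15 / 4 * V)"
    proof -
      have "norm (2 *\<^sub>R z + (4 - 5 * \<beta> + \<beta>\<^sup>2) *\<^sub>R q - (3 * \<beta> * (1 + \<beta>)) *\<^sub>R U z)
        \<le> norm (2 *\<^sub>R z) + norm ((4 - 5 * \<beta> + \<beta>\<^sup>2) *\<^sub>R q) + norm ((3 * \<beta> * (1 + \<beta>)) *\<^sub>R U z)"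
        by (intro order_trans[OF norm_triangle_ineq4] add_mono norm_triangle_ineq order_refl)
      moreover have "norm ((4 - 5 * \<beta> + \<beta>\<^sup>2) *\<^sub>R q) \<le> 4 * Y"
        unfolding norm_scaleR Y_def using \<beta> b2 b20 by (intro mult_right_mono) (auto simp: abs_le_iff)
      moreover have "norm ((3 * \<beta> * (1 + \<beta>)) *\<^sub>R U z) \<le> 15 / 4 * V"
      proof -
        have "norm ((3 * \<beta> * (1 + \<beta>)) *\<^sub>R U z) = (3 * (1 + \<beta>)) * V" using \<beta> by (simp add: V_def)
        also have "\<dots> \<le> 15 / 4 * V" using \<beta> nn by (intro mult_right_mono) auto
        finally show ?thesis .
      qed
      ultimately have n: "norm (2 *\<^sub>R z + (4 - 5 * \<beta> + \<beta>\<^sup>2) *\<^sub>R q - (3 * \<beta> * (1 + \<beta>)) *\<^sub>R U z) \<le> 2 * X + 4 * Y + 15 / 4 * V"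
        by (simp add: X_def)
      show ?thesis unfolding norm_scaleR using \<beta> n by (intro mult_mono) auto
    qed
    moreover have "norm ((24 * \<beta>) *\<^sub>R U (z - (3 * \<beta>\<^sup>2) *\<^sub>R U z)) \<le> 57 / 2 * V"
    proof -
      have "norm (U (z - (3 * \<beta>\<^sup>2) *\<^sub>R U z)) = norm (U z - (3 * \<beta>\<^sup>2) *\<^sub>R U (U z))"
        by (simp add: linear_diff[OF lin] linear_scale[OF lin])
      also have "\<dots> \<le> norm (U z) + 3 * (\<beta>\<^sup>2 * norm (U (U z)))"
        by (rule order_trans[OF norm_triangle_ineq4]) simp
      also have "\<dots> \<le> 19 / 16 * norm (U z)" using ubn[of "U z"] by linarith
      finally have "24 * \<beta> * norm (U (z - (3 * \<beta>\<^sup>2) *\<^sub>R U z)) \<le> 24 * \<beta> * (19 / 16 * norm (U z))"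
        using \<beta> by (intro mult_left_mono) auto
      then show ?thesis using \<beta> by (simp add: V_def)
    qed
    moreover have "5 / 2 * (2 * X + 4 * Y + 15 / 4 * V) = 5 * X + 10 * Y + 75 / 8 * V" by (simp add: algebra_simps)
    ultimately show ?thesis using nn by linarith
  qed
  have bias: "3 / 10 * \<beta> * (norm (noise_gradient U \<beta> z q) * norm z)
      \<le> \<beta> * (3 / 2 * X\<^sup>2 + 3 * (X * Y) + 57 / 5 * (X * V))"
  proof -
    have "norm (noise_gradient U \<beta> z q) * norm z \<le> (5 * X + 10 * Y + 38 * V) * X"
      using ng nn by (simp add: X_def[symmetric] mult_right_mono)
    from mult_left_mono[OF this, of "3 / 10 * \<beta>"] \<beta> show ?thesis by (simp add: power2_eq_square algebra_simps)
  qed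
  have q: "\<beta> * (- (2187 / 1000) * X\<^sup>2 + 8 * (X * Y) + 57 / 5 * (X * V) + 30 * (Y * V) - 127 / 10 * Y\<^sup>2 - 204 * V\<^sup>2) \<le> 0"
    using quadratic_form_nonpos[OF nn(1,2), of V] \<beta> by (intro mult_nonneg_nonpos) auto
  have x2: "0 \<le> \<beta> * X\<^sup>2" using \<beta> by simp
  have collect: "c + T2 + T3 - T4 + T5 + T6 + T7 - T8 + T9 + T10 \<le> c + b2 + b3 - b4 + b5 + b6 + b9 + T10"
    if "T2 \<le> b2" "T3 \<le> b3" "b4 \<le> T4" "T5 \<le> b5" "T6 + T7 \<le> b6" "0 \<le> T8" "T9 \<le> b9"
    for c T2 T3 T4 T5 T6 T7 T8 T9 T10 b2 b3 b4 b5 b6 b9 :: real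
    using that by linarith
  have "lyapunov U (z + ((4 - \<beta>) * (1 - \<beta>)) *\<^sub>R q - (3 * \<beta>) *\<^sub>R U z) (z - (3 * \<beta>\<^sup>2) *\<^sub>R U z)
      - (1 - \<beta> / 2) * lyapunov U (z + (4 - \<beta>) *\<^sub>R q) (z - (\<beta> * (1 - \<beta>)) *\<^sub>R q)
      + 3 / 10 * \<beta> * (norm (noise_gradient U \<beta> z q) * norm z) + 312 / 1000 * \<beta> * (norm z)\<^sup>2
    \<le> 2 * \<beta> * (z \<bullet> z) + \<beta> * (5 * (X * Y)) + \<beta> * (- (127 / 10) * Y\<^sup>2) - \<beta> * (6 * X\<^sup>2) + \<beta> * (30 * (Y * V))
     + \<beta> * (- 204 * V\<^sup>2) + \<beta> * (3 / 2 * X\<^sup>2 + 3 * (X * Y) + 57 / 5 * (X * V)) + 312 / 1000 * \<beta> * (norm z)\<^sup>2"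
    unfolding lyapunov_drift_identity[OF lin sym] by (rule collect[OF t2 t3 t4 t5 t6 t8 bias])
  also have "\<dots> \<le> 0" using q x2 by (simp add: XX X_def[symmetric] algebra_simps)
  finally show ?thesis by linarith
qed

section \<open>Bounded random vectors adapted to the past\<close>

context gossip_chain
begin

text \<open>Boundedness is included so that integrability is automatic; at every fixed iteration the
  states are bounded, because the chain moves in a bounded set of matrices.\<close>

definition adapted :: "nat \<Rightarrow> ('o \<Rightarrow> 'b::euclidean_space) \<Rightarrow> bool" where
  "adapted k f \<longleftrightarrow> f \<in> borel_measurable (past P S W k) \<and> (\<exists>c. \<forall>\<omega>\<in>space P. norm (f \<omega>) \<le> c)"

lemma adapted_mono: "adapted k f \<Longrightarrow> k \<le> l \<Longrightarrow> adapted l f"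
  unfolding adapted_def using measurable_past_mono by blast

lemma adapted_const: "adapted k (\<lambda>\<omega>. c)"
  unfolding adapted_def by auto

lemma adapted_add: "adapted k f \<Longrightarrow> adapted k g \<Longrightarrow> adapted k (\<lambda>\<omega>. f \<omega> + g \<omega>)"
proof -
  assume "adapted k f" "adapted k g"
  then obtain c d where b: "\<And>\<omega>. \<omega> \<in> space P \<Longrightarrow> norm (f \<omega>) \<le> c" "\<And>\<omega>. \<omega> \<in> space P \<Longrightarrow> norm (g \<omega>) \<le> d"
    and m: "f \<in> borel_measurable (past P S W k)" "g \<in> borel_measurable (past P S W k)"
    unfolding adapted_def by blast
  have "\<forall>\<omega>\<in>space P. norm (f \<omega> + g \<omega>) \<le> c + d" using b by (intro ballI norm_triangle_le add_mono)
  with m show ?thesis unfolding adapted_def by (blast intro: borel_measurable_add)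
qed

lemma adapted_scaleR:
  fixes f :: "'o \<Rightarrow> 'b::euclidean_space"
  shows "adapted k f \<Longrightarrow> adapted k (\<lambda>\<omega>. a *\<^sub>R f \<omega>)"
proof -
  assume "adapted k f"
  then obtain c where b: "\<And>\<omega>. \<omega> \<in> space P \<Longrightarrow> norm (f \<omega>) \<le> c" and m: "f \<in> borel_measurable (past P S W k)"
    unfolding adapted_def by blast
  have "\<forall>\<omega>\<in>space P. norm (a *\<^sub>R f \<omega>) \<le> \<bar>a\<bar> * c" using b by (auto intro: mult_left_mono)
  with borel_measurable_scaleR[OF borel_measurable_const m] show ?thesis unfolding adapted_def by blast
qed

lemma adapted_diff: "adapted k f \<Longrightarrow> adapted k g \<Longrightarrow> adapted k (\<lambda>\<omega>. f \<omega> - g \<omega>)"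
  using adapted_add[of k f "\<lambda>\<omega>. (- 1) *\<^sub>R g \<omega>"] adapted_scaleR[of k g "- 1"] by simp

lemma adapted_sum: "(\<And>i. i \<in> I \<Longrightarrow> adapted k (f i)) \<Longrightarrow> adapted k (\<lambda>\<omega>. \<Sum>i\<in>I. f i \<omega>)"
  by (induction I rule: infinite_finite_induct) (auto intro: adapted_add adapted_const)

lemma adapted_inner: "adapted k f \<Longrightarrow> adapted k g \<Longrightarrow> adapted k (\<lambda>\<omega>. f \<omega> \<bullet> g \<omega>)"
proof -
  assume "adapted k f" "adapted k g"
  then obtain c d where b: "\<And>\<omega>. \<omega> \<in> space P \<Longrightarrow> norm (f \<omega>) \<le> c" "\<And>\<omega>. \<omega> \<in> space P \<Longrightarrow> norm (g \<omega>) \<le> d"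
    and m: "f \<in> borel_measurable (past P S W k)" "g \<in> borel_measurable (past P S W k)"
    unfolding adapted_def by blast
  have "\<forall>\<omega>\<in>space P. norm (f \<omega> \<bullet> g \<omega>) \<le> c * d"
  proof
    fix \<omega> assume w: "\<omega> \<in> space P"
    show "norm (f \<omega> \<bullet> g \<omega>) \<le> c * d"
      using b[OF w] order_trans[OF norm_ge_zero b(1)[OF w]] unfolding real_norm_def
      by (intro order_trans[OF Cauchy_Schwarz_ineq2] mult_mono) auto
  qed
  with borel_measurable_inner[OF m] show ?thesis unfolding adapted_def by blast
qed

lemma adapted_norm: "adapted k f \<Longrightarrow> adapted k (\<lambda>\<omega>. norm (f \<omega>))"
  unfolding adapted_def by (auto intro: borel_measurable_norm)

lemma adapted_mult: "adapted k f \<Longrightarrow> adapted k g \<Longrightarrow> adapted k (\<lambda>\<omega>. f \<omega> * g \<omega> :: real)"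
  using adapted_inner[of k f g] by simp

lemma adapted_power2: "adapted k f \<Longrightarrow> adapted k (\<lambda>\<omega>. (f \<omega>)\<^sup>2 :: real)"
  unfolding power2_eq_square by (rule adapted_mult)

lemma adapted_matrix:
  fixes z :: "'o \<Rightarrow> real^'n" and A :: "real^'n^'n"
  shows "adapted k z \<Longrightarrow> adapted k (\<lambda>\<omega>. A *v z \<omega>)"
proof -
  assume "adapted k z"
  then obtain c where b: "\<And>\<omega>. \<omega> \<in> space P \<Longrightarrow> norm (z \<omega>) \<le> c" and m: "z \<in> borel_measurable (past P S W k)"
    unfolding adapted_def by blast
  have "\<forall>\<omega>\<in>space P. norm (A *v z \<omega>) \<le> op_norm A * c"
  proof
    fix \<omega> assume w: "\<omega> \<in> space P"
    show "norm (A *v z \<omega>) \<le> op_norm A * c"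
      by (rule order_trans[OF norm_matrix_vector_le_op_norm mult_left_mono[OF b[OF w]]])
        (simp add: op_norm_def onorm_pos_le)
  qed
  with borel_measurable_matrix_vector_mult[OF borel_measurable_const m] show ?thesis unfolding adapted_def by blast
qed

lemma adapted_deviation:
  fixes z :: "'o \<Rightarrow> real^'n"
  assumes z: "adapted k z" and i: "i \<le> l" "k \<le> l"
  shows "adapted l (\<lambda>\<omega>. (W i \<omega> - Wt) *v z \<omega>)"
proof -
  obtain c where b: "\<And>\<omega>. \<omega> \<in> space P \<Longrightarrow> norm (z \<omega>) \<le> c" and m: "z \<in> borel_measurable (past P S W l)"
    using adapted_mono[OF z i(2)] unfolding adapted_def by blast
  have "\<forall>\<omega>\<in>space P. norm ((W i \<omega> - Wt) *v z \<omega>) \<le> \<rho> * c"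
    using order_trans[OF norm_deviation_le[OF W_space] mult_left_mono[OF b deviation_nonneg]] by blast
  moreover have "(\<lambda>\<omega>. (W i \<omega> - Wt) *v z \<omega>) \<in> borel_measurable (past P S W l)"
    by (intro borel_measurable_matrix_vector_mult borel_measurable_diff W_measurable_past borel_measurable_const i m)
  ultimately show ?thesis unfolding adapted_def by blast
qed

lemma adapted_measurable: "adapted k f \<Longrightarrow> f \<in> borel_measurable P"
  unfolding adapted_def using measurable_past by blast

lemma adapted_integrable: "adapted k (f :: 'o \<Rightarrow> real) \<Longrightarrow> integrable P f"
proof -
  assume f: "adapted k f"
  then obtain c where "\<And>\<omega>. \<omega> \<in> space P \<Longrightarrow> \<bar>f \<omega>\<bar> \<le> c" unfolding adapted_def real_norm_def by blast
  then show ?thesis by (rule integrable_bounded_real[OF adapted_measurable[OF f]])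
qed

lemmas adapted_rules = adapted_add adapted_diff adapted_scaleR adapted_inner adapted_norm adapted_mult
  adapted_power2 adapted_matrix adapted_const

definition mean_deviation :: "nat \<Rightarrow> nat \<Rightarrow> ('o \<Rightarrow> real^'n) \<Rightarrow> nat \<Rightarrow> 'o \<Rightarrow> real^'n" where
  "mean_deviation B T z j \<omega> = (1 / (2 ^ j * real B)) *\<^sub>R (\<Sum>i = 1..2 ^ j * B. (W (T + i) \<omega> - Wt) *v z \<omega>)"

lemma adapted_mean_deviation:
  assumes "adapted T z"
  shows "adapted (T + 2 ^ j * B) (mean_deviation B T z j)"
  unfolding mean_deviation_def by (intro adapted_scaleR adapted_sum adapted_deviation[OF assms]) auto

lemma mean_deviation_bias:
  fixes u z :: "'o \<Rightarrow> real^'n"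
  assumes u: "adapted T u" and z: "adapted T z"
  shows "(2 ^ j * real B) * \<bar>\<integral>\<omega>. u \<omega> \<bullet> mean_deviation B T z j \<omega> \<partial>P\<bar> \<le> 8 / 3 * (real \<tau> * \<rho>) * (\<integral>\<omega>. norm (u \<omega>) * norm (z \<omega>) \<partial>P)"
proof (cases "B = 0")
  case False
  obtain cu where u': "u \<in> borel_measurable (past P S W T)" "\<And>\<omega>. \<omega> \<in> space P \<Longrightarrow> norm (u \<omega>) \<le> cu"
    using u unfolding adapted_def by blast
  obtain cz where z': "z \<in> borel_measurable (past P S W T)" "\<And>\<omega>. \<omega> \<in> space P \<Longrightarrow> norm (z \<omega>) \<le> cz"
    using z unfolding adapted_def by blast
  have "(\<integral>\<omega>. u \<omega> \<bullet> mean_deviation B T z j \<omega> \<partial>P)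
     = (1 / (2 ^ j * real B)) * (\<integral>\<omega>. u \<omega> \<bullet> (\<Sum>i = 1..2 ^ j * B. (W (T + i) \<omega> - Wt) *v z \<omega>) \<partial>P)"
    unfolding mean_deviation_def inner_scaleR_right by (rule integral_mult_right_zero)
  then have "(2 ^ j * real B) * \<bar>\<integral>\<omega>. u \<omega> \<bullet> mean_deviation B T z j \<omega> \<partial>P\<bar>
     = \<bar>\<integral>\<omega>. u \<omega> \<bullet> (\<Sum>i = 1..2 ^ j * B. (W (T + i) \<omega> - Wt) *v z \<omega>) \<partial>P\<bar>"
    using False by (simp only: abs_mult) simp
  also have "\<dots> \<le> 8 / 3 * (real \<tau> * \<rho>) * (\<integral>\<omega>. norm (u \<omega>) * norm (z \<omega>) \<partial>P)"
    by (rule batch_bias[OF u' z'])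
  finally show ?thesis .
qed (use deviation_nonneg in simp)

lemma mean_deviation_variance:
  fixes z :: "'o \<Rightarrow> real^'n"
  assumes z: "adapted T z" and B: "B \<ge> 1"
  shows "(\<integral>\<omega>. (norm (mean_deviation B T z j \<omega>))\<^sup>2 \<partial>P) \<le> (19 / 3 * real \<tau> * \<rho>\<^sup>2 * (\<integral>\<omega>. (norm (z \<omega>))\<^sup>2 \<partial>P)) / (2 ^ j * real B)"
proof -
  obtain cz where z': "z \<in> borel_measurable (past P S W T)" "\<And>\<omega>. \<omega> \<in> space P \<Longrightarrow> norm (z \<omega>) \<le> cz"
    using z unfolding adapted_def by blast
  let ?N = "2 ^ j * real B" and ?V = "19 / 3 * real \<tau> * \<rho>\<^sup>2 * (\<integral>\<omega>. (norm (z \<omega>))\<^sup>2 \<partial>P)"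
  have N: "?N > 0" using B by simp
  have "(\<integral>\<omega>. (norm (mean_deviation B T z j \<omega>))\<^sup>2 \<partial>P)
     = (1 / ?N)\<^sup>2 * (\<integral>\<omega>. (norm (\<Sum>i = 1..2 ^ j * B. (W (T + i) \<omega> - Wt) *v z \<omega>))\<^sup>2 \<partial>P)"
    unfolding mean_deviation_def norm_scaleR power_mult_distrib power2_abs by (rule integral_mult_right_zero)
  also have "\<dots> \<le> (1 / ?N)\<^sup>2 * (real (2 ^ j * B) * ?V)"
    by (intro mult_left_mono batch_variance[OF z'] zero_le_power2)
  also have "\<dots> = ?V / ?N"
  proof -
    have "(1 / n)\<^sup>2 * (n * v) = v / n" if "n > 0" for n v :: real using that by (simp add: power2_eq_square)
    moreover have "real (2 ^ j * B) = ?N" by simp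
    ultimately show ?thesis using N by (simp only:)
  qed
  finally show ?thesis .
qed

end

section \<open>One iteration in expectation\<close>

text \<open>Level \<open>i\<close> has probability \<open>2\<^sup>-\<^sup>i\<close>; this cancels the weight \<open>2\<^sup>i\<close> of the multilevel correction.\<close>

lemma geometric_level_expectation:
  fixes f :: "nat \<Rightarrow> real"
  shows "integrable (measure_pmf (map_pmf Suc (geometric_pmf (1/2)))) (\<lambda>i. c + (if 1 \<le> i \<and> i \<le> m then f i else 0))"
    and "(\<integral>i. c + (if 1 \<le> i \<and> i \<le> m then f i else 0) \<partial>measure_pmf (map_pmf Suc (geometric_pmf (1/2)))) = c + (\<Sum>i = 1..m. f i / 2 ^ i)"
proof -
  let ?G = "map_pmf Suc (geometric_pmf (1/2))"
  let ?g = "\<lambda>i. if 1 \<le> i \<and> i \<le> m then f i else 0"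
  have gi: "integrable (measure_pmf ?G) ?g"
  proof (rule measure_pmf.integrable_bounded_real)
    fix i
    have "\<bar>f i\<bar> \<le> (\<Sum>i = 1..m. \<bar>f i\<bar>)" if "1 \<le> i" "i \<le> m"
      using that by (intro member_le_sum) auto
    then show "\<bar>?g i\<bar> \<le> (\<Sum>i = 1..m. \<bar>f i\<bar>)" by (auto intro: sum_nonneg)
  qed simp
  then show "integrable (measure_pmf ?G) (\<lambda>i. c + ?g i)" by simp
  have p: "pmf ?G i = 1 / 2 ^ i" if i: "i \<in> {1..m}" for i
  proof -
    obtain n where n: "i = Suc n" using i by (cases i) auto
    have "pmf ?G (Suc n) = pmf (geometric_pmf (1/2)) n" by (intro pmf_map_inj') simp
    also have "\<dots> = (1/2) ^ n * (1/2)" by (subst pmf_geometric) auto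
    finally show ?thesis by (simp add: n power_one_over)
  qed
  have "(\<integral>i. ?g i \<partial>measure_pmf ?G) = (\<Sum>i = 1..m. ?g i * pmf ?G i)"
    by (intro integral_measure_pmf_real) (auto split: if_splits)
  also have "\<dots> = (\<Sum>i = 1..m. f i / 2 ^ i)" by (intro sum.cong) (auto simp: p)
  finally show "(\<integral>i. c + ?g i \<partial>measure_pmf ?G) = c + (\<Sum>i = 1..m. f i / 2 ^ i)"
    using gi by simp
qed

lemma norm_add_square_le: "(norm (x + y))\<^sup>2 \<le> 2 * (norm x)\<^sup>2 + 2 * (norm y)\<^sup>2" for x y :: "'a::real_inner"
proof -
  have "(norm (x - y))\<^sup>2 + (norm (x + y))\<^sup>2 = 2 * (norm x)\<^sup>2 + 2 * (norm y)\<^sup>2"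
    by (simp add: power2_norm_eq_inner inner_add_left inner_add_right inner_diff_left inner_diff_right inner_commute[of y x])
  then show ?thesis using zero_le_power2[of "norm (x - y)"] by linarith
qed

text \<open>The number \<open>lam\<close> plays the role of \<open>\<lambda>\<^sub>m\<^sub>i\<^sub>n\<close> and \<open>m\<close> is the highest level used by the estimate. The bounds
  involving \<open>\<beta>\<^sup>2\<close> express \<open>\<gamma> \<lambda>\<^sub>m\<^sub>a\<^sub>x \<le> 3/4\<close> through \<open>\<lambda> \<gamma> = 12 \<beta>\<^sup>2\<close>; \<open>bias_small\<close> and
  \<open>variance_small\<close> are what the remaining bound on \<open>\<gamma>\<close> is for. Their constants are those that
  \<open>lyapunov_contraction\<close> tolerates: with \<open>s = 3 \<beta> / lam\<close>, a bias of relative size \<open>lam / 10\<close> costs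
  \<open>3 \<beta> / 10\<close>, and the variance costs \<open>37/16 \<cdot> 9 \<beta> \<cdot> 0.0148 \<le> 0.312 \<beta>\<close>.\<close>

locale accelerated_gossip = gossip_chain P S Q W \<pi> \<tau> Wt \<rho>
  for P :: "'o measure" and S :: "(real^'n::finite^'n) measure" and Q W \<pi> \<tau> Wt \<rho> +
  fixes \<beta> lam M :: real and B m :: nat
  assumes beta: "0 < \<beta>" "\<beta> \<le> 1 / 4" and lam: "0 < lam"
    and Wt_sym: "\<And>x y. x \<bullet> (Wt *v y) = (Wt *v x) \<bullet> y"
    and Wt_psd: "\<And>y. 0 \<le> y \<bullet> (Wt *v y)"
    and Wt_upper: "\<And>y. \<beta>\<^sup>2 * (y \<bullet> (Wt *v y)) \<le> lam / 16 * (y \<bullet> y)"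
    and Wt_upper_norm: "\<And>y. \<beta>\<^sup>2 * norm (Wt *v y) \<le> lam / 16 * norm y"
    and Wt_lower: "\<And>y. 1 \<bullet> y = 0 \<Longrightarrow> lam * (y \<bullet> y) \<le> y \<bullet> (Wt *v y)"
    and levels: "\<And>i. 2 ^ i \<le> M \<longleftrightarrow> i \<le> m" and m1: "m \<ge> 1" and B1: "B \<ge> 1"
    and bias_small: "8 / 3 * (real \<tau> * \<rho>) \<le> lam / 10 * (2 ^ m * real B)"
    and variance_small: "\<beta> * (14 * real m * (19 / 3 * real \<tau> * \<rho>\<^sup>2)) \<le> 148 / 10000 * lam\<^sup>2 * real B"
    and columns: "\<And>A. A \<in> space S \<Longrightarrow> 1 v* A = 0"
begin

definition U :: "real^'n \<Rightarrow> real^'n" where "U x = (1 / lam) *\<^sub>R (Wt *v x)"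

lemma linear_U: "linear U"
  unfolding U_def by (rule linearI) (simp_all add: matrix_vector_right_distrib scaleR_right_distrib matrix_vector_mult_scaleR)

lemma U_sym: "x \<bullet> U y = U x \<bullet> y"
  unfolding U_def using Wt_sym[of x y] by simp

lemma U_psd: "0 \<le> y \<bullet> U y"
  unfolding U_def using Wt_psd[of y] lam by simp

lemma U_upper: "\<beta>\<^sup>2 * (y \<bullet> U y) \<le> (y \<bullet> y) / 16"
  unfolding U_def using Wt_upper[of y] lam by (simp add: field_simps)

lemma U_upper_norm: "\<beta>\<^sup>2 * norm (U y) \<le> norm y / 16"
  unfolding U_def using Wt_upper_norm[of y] lam by (simp add: field_simps)

lemma U_lower: "1 \<bullet> y = 0 \<Longrightarrow> y \<bullet> y \<le> y \<bullet> U y"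
  unfolding U_def using Wt_lower[of y] lam by (simp add: field_simps)

lemma adapted_U: "adapted k z \<Longrightarrow> adapted k (\<lambda>\<omega>. U (z \<omega>))"
  unfolding U_def by (intro adapted_scaleR adapted_matrix)

lemma adapted_lyapunov: "adapted k x \<Longrightarrow> adapted k y \<Longrightarrow> adapted k (\<lambda>\<omega>. lyapunov U (x \<omega>) (y \<omega>))"
  unfolding lyapunov_def by (intro adapted_rules adapted_U)

lemma lyapunov_nonneg: "0 \<le> lyapunov U x y"
  unfolding lyapunov_def using U_psd[of y] by simp

definition noise :: "nat \<Rightarrow> ('o \<Rightarrow> real^'n) \<Rightarrow> nat \<Rightarrow> 'o \<Rightarrow> real^'n" where
  "noise T z i \<omega> = mlmc_estimate (\<lambda>k. W k \<omega>) M B T (z \<omega>) i - Wt *v z \<omega>"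

lemma batch_mean_deviation:
  "batch_mean (\<lambda>k. W k \<omega>) B T (z \<omega>) j = Wt *v z \<omega> + mean_deviation B T z j \<omega>"
proof -
  have "(\<Sum>i = 1..2 ^ j * B. W (T + i) \<omega> *v z \<omega>)
     = (\<Sum>i = 1..2 ^ j * B. (W (T + i) \<omega> - Wt) *v z \<omega>) + (\<Sum>i = 1..2 ^ j * B. Wt *v z \<omega>)"
    unfolding sum.distrib[symmetric] matrix_vector_mult_diff_rdistrib by simp
  also have "(\<Sum>i = 1..2 ^ j * B. Wt *v z \<omega>) = (2 ^ j * real B) *\<^sub>R (Wt *v z \<omega>)"
    by (simp only: sum_constant_scaleR) simp
  finally show ?thesis
    unfolding batch_mean_def mean_deviation_def using B1 by (simp add: scaleR_right_distrib)
qed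

text \<open>Level \<open>0\<close> has probability zero, but the equation holds there too, because the natural number
  \<open>0 - 1\<close> is \<open>0\<close>.\<close>

lemma noise_eq:
  "noise T z i \<omega> = mean_deviation B T z 0 \<omega>
    + (if 1 \<le> i \<and> i \<le> m then 2 ^ i *\<^sub>R (mean_deviation B T z i \<omega> - mean_deviation B T z (i - 1) \<omega>) else 0)"
  unfolding noise_def mlmc_estimate_def batch_mean_deviation levels by (cases i) auto

lemma adapted_noise:
  assumes "adapted T z"
  shows "adapted (T + 2 ^ i * B) (noise T z i)"
proof -
  have 0: "adapted (T + 2 ^ i * B) (mean_deviation B T z l)" if "l \<le> i" for l
    using that by (intro adapted_mono[OF adapted_mean_deviation[OF assms]]) simp
  show ?thesis unfolding noise_eq[abs_def]
    by (cases "1 \<le> i \<and> i \<le> m") (auto intro!: adapted_rules 0)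
qed

lemma expected_noise_linear:
  assumes u: "adapted T u" and z: "adapted T z"
  shows "(\<integral>\<omega>. u \<omega> \<bullet> noise T z i \<omega> \<partial>P) = (\<integral>\<omega>. u \<omega> \<bullet> mean_deviation B T z 0 \<omega> \<partial>P)
    + (if 1 \<le> i \<and> i \<le> m then 2 ^ i * ((\<integral>\<omega>. u \<omega> \<bullet> mean_deviation B T z i \<omega> \<partial>P) - (\<integral>\<omega>. u \<omega> \<bullet> mean_deviation B T z (i - 1) \<omega> \<partial>P)) else 0)"
proof -
  have i: "integrable P (\<lambda>\<omega>. u \<omega> \<bullet> mean_deviation B T z l \<omega>)" for l
    by (rule adapted_integrable[of "T + 2 ^ l * B"])
      (intro adapted_inner adapted_mean_deviation z adapted_mono[OF u], simp)
  define b where "b \<longleftrightarrow> 1 \<le> i \<and> i \<le> m"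
  show ?thesis unfolding noise_eq b_def[symmetric] using i
    by (cases b) (simp_all add: inner_add_right inner_diff_right)
qed

lemma expected_noise_square:
  assumes z: "adapted T z"
  shows "(\<integral>\<omega>. (norm (noise T z i \<omega>))\<^sup>2 \<partial>P) \<le> 2 * (\<integral>\<omega>. (norm (mean_deviation B T z 0 \<omega>))\<^sup>2 \<partial>P)
    + (if 1 \<le> i \<and> i \<le> m then 4 * 4 ^ i * ((\<integral>\<omega>. (norm (mean_deviation B T z i \<omega>))\<^sup>2 \<partial>P) + (\<integral>\<omega>. (norm (mean_deviation B T z (i - 1) \<omega>))\<^sup>2 \<partial>P)) else 0)"
proof -
  have i: "integrable P (\<lambda>\<omega>. (norm (mean_deviation B T z l \<omega>))\<^sup>2)" for l
    by (rule adapted_integrable[of "T + 2 ^ l * B"]) (rule adapted_power2, rule adapted_norm, rule adapted_mean_deviation[OF z])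
  have n: "integrable P (\<lambda>\<omega>. (norm (noise T z i \<omega>))\<^sup>2)"
    by (rule adapted_integrable[of "T + 2 ^ i * B"]) (rule adapted_power2, rule adapted_norm, rule adapted_noise[OF z])
  define b where "b \<longleftrightarrow> 1 \<le> i \<and> i \<le> m"
  show ?thesis
  proof (cases b)
    case True
    have "(\<integral>\<omega>. (norm (noise T z i \<omega>))\<^sup>2 \<partial>P) \<le> (\<integral>\<omega>. 2 * (norm (mean_deviation B T z 0 \<omega>))\<^sup>2
       + 4 * 4 ^ i * ((norm (mean_deviation B T z i \<omega>))\<^sup>2 + (norm (mean_deviation B T z (i - 1) \<omega>))\<^sup>2) \<partial>P)"
    proof (rule integral_mono[OF n])
      fix \<omega>
      let ?a = "mean_deviation B T z i \<omega>" and ?b = "mean_deviation B T z (i - 1) \<omega>" and ?c = "mean_deviation B T z 0 \<omega>"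
      have "(norm (?a + - ?b))\<^sup>2 \<le> 2 * (norm ?a)\<^sup>2 + 2 * (norm (- ?b))\<^sup>2" by (rule norm_add_square_le)
      then have d: "(norm (?a - ?b))\<^sup>2 \<le> 2 * (norm ?a)\<^sup>2 + 2 * (norm ?b)\<^sup>2" by simp
      have "(norm (noise T z i \<omega>))\<^sup>2 \<le> 2 * (norm ?c)\<^sup>2 + 2 * (norm (2 ^ i *\<^sub>R (?a - ?b)))\<^sup>2"
        unfolding noise_eq b_def[symmetric] if_P[OF True] by (rule norm_add_square_le)
      also have "(norm (2 ^ i *\<^sub>R (?a - ?b)))\<^sup>2 = 4 ^ i * (norm (?a - ?b))\<^sup>2"
      proof -
        have "((2::real) ^ i)\<^sup>2 = (2\<^sup>2) ^ i" by (simp only: power_mult[symmetric] mult.commute)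
        then show ?thesis by (simp add: power_mult_distrib)
      qed
      also have "2 * (norm ?c)\<^sup>2 + 2 * (4 ^ i * (norm (?a - ?b))\<^sup>2) \<le> 2 * (norm ?c)\<^sup>2 + 2 * (4 ^ i * (2 * (norm ?a)\<^sup>2 + 2 * (norm ?b)\<^sup>2))"
        using d by (intro add_left_mono mult_left_mono) auto
      finally show "(norm (noise T z i \<omega>))\<^sup>2 \<le> 2 * (norm ?c)\<^sup>2 + 4 * 4 ^ i * ((norm ?a)\<^sup>2 + (norm ?b)\<^sup>2)"
        by (simp add: algebra_simps)
    qed (use i in simp)
    then show ?thesis unfolding b_def[symmetric] using True i by simp
  next
    case False
    have "(\<integral>\<omega>. (norm (noise T z i \<omega>))\<^sup>2 \<partial>P) = (\<integral>\<omega>. (norm (mean_deviation B T z 0 \<omega>))\<^sup>2 \<partial>P)"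
      unfolding noise_eq b_def[symmetric] if_not_P[OF False] by simp
    also have "\<dots> \<le> 2 * (\<integral>\<omega>. (norm (mean_deviation B T z 0 \<omega>))\<^sup>2 \<partial>P)" by simp
    finally show ?thesis unfolding b_def[symmetric] using False by simp
  qed
qed

text \<open>For every level the perturbed Lyapunov function is bounded by its noiseless value, a term linear in
  the noise and a term quadratic in it. Averaged over the level, the linear terms telescope to the
  longest batch, whose bias is small. The quadratic term of level \<open>i\<close> has weight
  \<open>2\<^sup>-\<^sup>i \<cdot> 4\<^sup>i\<close> and size of order \<open>2\<^sup>-\<^sup>i\<close>, so the \<open>m\<close> levels make comparable contributions.\<close>

lemma expected_contraction:
  assumes z: "adapted T z" and q: "adapted T q" and mz: "\<And>\<omega>. \<omega> \<in> space P \<Longrightarrow> 1 \<bullet> z \<omega> = 0"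
  shows "(\<integral>i. (\<integral>\<omega>. lyapunov U
        (z \<omega> + ((4 - \<beta>) * (1 - \<beta>)) *\<^sub>R q \<omega> - (3 * \<beta>) *\<^sub>R U (z \<omega>) - (3 * \<beta> / lam) *\<^sub>R noise T z i \<omega>)
        (z \<omega> - (3 * \<beta>\<^sup>2) *\<^sub>R U (z \<omega>) - \<beta> *\<^sub>R ((3 * \<beta> / lam) *\<^sub>R noise T z i \<omega>)) \<partial>P)
        \<partial>measure_pmf (map_pmf Suc (geometric_pmf (1/2))))
    \<le> (1 - \<beta> / 2) * (\<integral>\<omega>. lyapunov U (z \<omega> + (4 - \<beta>) *\<^sub>R q \<omega>) (z \<omega> - (\<beta> * (1 - \<beta>)) *\<^sub>R q \<omega>) \<partial>P)"
    (is "(\<integral>i. ?a i \<partial>?G) \<le> _")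
proof -
  define s where "s = 3 * \<beta> / lam"
  have s0: "s > 0" using beta lam by (simp add: s_def)
  define D where "D \<omega> = lyapunov U (z \<omega> + ((4 - \<beta>) * (1 - \<beta>)) *\<^sub>R q \<omega> - (3 * \<beta>) *\<^sub>R U (z \<omega>)) (z \<omega> - (3 * \<beta>\<^sup>2) *\<^sub>R U (z \<omega>))" for \<omega>
  define u where "u \<omega> = noise_gradient U \<beta> (z \<omega>) (q \<omega>)" for \<omega>
  have Uz: "adapted T (\<lambda>\<omega>. U (z \<omega>))" by (rule adapted_U[OF z])
  have Da: "adapted T D" unfolding D_def by (intro adapted_lyapunov adapted_rules z q Uz)
  have ua: "adapted T u" unfolding u_def noise_gradient_def by (intro adapted_U adapted_rules z q Uz)
  let ?l = "\<lambda>j. \<integral>\<omega>. u \<omega> \<bullet> mean_deviation B T z j \<omega> \<partial>P"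
  let ?v = "\<lambda>j. \<integral>\<omega>. (norm (mean_deviation B T z j \<omega>))\<^sup>2 \<partial>P"
  let ?E = "\<integral>\<omega>. (norm (z \<omega>))\<^sup>2 \<partial>P"
  let ?ED = "\<integral>\<omega>. D \<omega> \<partial>P"
  have E0: "?E \<ge> 0" by simp
  define c where "c = ?ED + s * ?l 0 + 37 / 16 * s\<^sup>2 * (2 * ?v 0)"
  define f where "f i = s * (2 ^ i * (?l i - ?l (i - 1))) + 37 / 16 * s\<^sup>2 * (4 * 4 ^ i * (?v i + ?v (i - 1)))" for i
  \<comment> \<open>\<open>c\<close> and \<open>f\<close> collect the contributions of the base batch and of the correction at level \<open>i\<close>\<close>
  have a0: "0 \<le> ?a i" for i by (intro integral_nonneg_AE AE_I2 lyapunov_nonneg)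
  have ab: "?a i \<le> c + (if 1 \<le> i \<and> i \<le> m then f i else 0)" for i
  proof -
    let ?T = "T + 2 ^ i * B"
    define b where "b \<longleftrightarrow> 1 \<le> i \<and> i \<le> m"
    have na: "adapted ?T (noise T z i)" by (rule adapted_noise[OF z])
    have up: "adapted ?T f" if "adapted T f" for f :: "'o \<Rightarrow> 'b::euclidean_space" using that by (rule adapted_mono) simp
    have iD: "integrable P D" by (rule adapted_integrable[OF Da])
    have iu: "integrable P (\<lambda>\<omega>. u \<omega> \<bullet> noise T z i \<omega>)" by (rule adapted_integrable[of ?T]) (intro adapted_inner up[OF ua] na)
    have inn: "integrable P (\<lambda>\<omega>. (norm (noise T z i \<omega>))\<^sup>2)" by (rule adapted_integrable[of ?T]) (intro adapted_rules na)
    have "?a i \<le> (\<integral>\<omega>. D \<omega> + s * (u \<omega> \<bullet> noise T z i \<omega>) + 37 / 16 * s\<^sup>2 * (norm (noise T z i \<omega>))\<^sup>2 \<partial>P)"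
    proof (rule integral_mono)
      show "integrable P (\<lambda>\<omega>. D \<omega> + s * (u \<omega> \<bullet> noise T z i \<omega>) + 37 / 16 * s\<^sup>2 * (norm (noise T z i \<omega>))\<^sup>2)"
        using iD iu inn by simp
      show "integrable P (\<lambda>\<omega>. lyapunov U
        (z \<omega> + ((4 - \<beta>) * (1 - \<beta>)) *\<^sub>R q \<omega> - (3 * \<beta>) *\<^sub>R U (z \<omega>) - (3 * \<beta> / lam) *\<^sub>R noise T z i \<omega>)
        (z \<omega> - (3 * \<beta>\<^sup>2) *\<^sub>R U (z \<omega>) - \<beta> *\<^sub>R ((3 * \<beta> / lam) *\<^sub>R noise T z i \<omega>)))"
        by (rule adapted_integrable[of ?T]) (intro adapted_lyapunov adapted_rules up[OF z] up[OF q] up[OF Uz] na)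
      fix \<omega>
      let ?e = "s *\<^sub>R noise T z i \<omega>"
      have "(1 + \<beta>)\<^sup>2 \<le> (5 / 4)\<^sup>2" using beta by (intro power_mono) auto
      then have "(1 + \<beta>)\<^sup>2 \<le> 25 / 16" by (simp add: power2_eq_square)
      then have "(1 + \<beta>)\<^sup>2 * (?e \<bullet> ?e) \<le> 25 / 16 * (?e \<bullet> ?e)" by (rule mult_right_mono[OF _ inner_ge_zero])
      moreover have "12 * \<beta>\<^sup>2 * (?e \<bullet> U ?e) \<le> 12 / 16 * (?e \<bullet> ?e)"
        using mult_left_mono[OF U_upper[of ?e], of 12] by (simp only: mult.assoc) linarith
      ultimately have "(1 + \<beta>)\<^sup>2 * (?e \<bullet> ?e) + 12 * \<beta>\<^sup>2 * (?e \<bullet> U ?e) \<le> 37 / 16 * (?e \<bullet> ?e)" by linarith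
      moreover have "?e \<bullet> ?e = s\<^sup>2 * (norm (noise T z i \<omega>))\<^sup>2"
        unfolding power2_norm_eq_inner by (simp add: power2_eq_square)
      ultimately have "(1 + \<beta>)\<^sup>2 * (?e \<bullet> ?e) + 12 * \<beta>\<^sup>2 * (?e \<bullet> U ?e) \<le> 37 / 16 * s\<^sup>2 * (norm (noise T z i \<omega>))\<^sup>2"
        by (simp only: mult.assoc)
      then show "lyapunov U
        (z \<omega> + ((4 - \<beta>) * (1 - \<beta>)) *\<^sub>R q \<omega> - (3 * \<beta>) *\<^sub>R U (z \<omega>) - (3 * \<beta> / lam) *\<^sub>R noise T z i \<omega>)
        (z \<omega> - (3 * \<beta>\<^sup>2) *\<^sub>R U (z \<omega>) - \<beta> *\<^sub>R ((3 * \<beta> / lam) *\<^sub>R noise T z i \<omega>))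
        \<le> D \<omega> + s * (u \<omega> \<bullet> noise T z i \<omega>) + 37 / 16 * s\<^sup>2 * (norm (noise T z i \<omega>))\<^sup>2"
        unfolding s_def[symmetric] lyapunov_perturbation[OF linear_U U_sym] D_def u_def inner_scaleR_right by linarith
    qed
    also have "\<dots> = ?ED + s * (\<integral>\<omega>. u \<omega> \<bullet> noise T z i \<omega> \<partial>P) + 37 / 16 * s\<^sup>2 * (\<integral>\<omega>. (norm (noise T z i \<omega>))\<^sup>2 \<partial>P)"
      using iD iu inn by simp
    also have "\<dots> \<le> c + (if 1 \<le> i \<and> i \<le> m then f i else 0)"
    proof -
      have "37 / 16 * s\<^sup>2 * (\<integral>\<omega>. (norm (noise T z i \<omega>))\<^sup>2 \<partial>P) \<le> 37 / 16 * s\<^sup>2 * (2 * ?v 0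
        + (if 1 \<le> i \<and> i \<le> m then 4 * 4 ^ i * (?v i + ?v (i - 1)) else 0))"
        by (rule mult_left_mono[OF expected_noise_square[OF z]]) simp
      then show ?thesis unfolding expected_noise_linear[OF ua z] c_def f_def
        unfolding b_def[symmetric] by (cases b) (simp_all add: distrib_left)
    qed
    finally show ?thesis .
  qed
  have "(\<integral>i. ?a i \<partial>?G) \<le> (\<integral>i. c + (if 1 \<le> i \<and> i \<le> m then f i else 0) \<partial>?G)"
    using ab order_trans[OF a0 ab] by (intro integral_mono' geometric_level_expectation(1)) auto
  also have "\<dots> = c + (\<Sum>i = 1..m. f i / 2 ^ i)" by (rule geometric_level_expectation(2))
  also have "(\<Sum>i = 1..m. f i / 2 ^ i) = s * (\<Sum>i = 1..m. ?l i - ?l (i - 1)) + 37 / 16 * s\<^sup>2 * (\<Sum>i = 1..m. 4 * 2 ^ i * (?v i + ?v (i - 1)))"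
    unfolding sum_distrib_left sum.distrib[symmetric]
  proof (rule sum.cong[OF refl])
    fix i
    have "(4::real) ^ i = 2 ^ i * 2 ^ i" by (simp add: power_mult_distrib[symmetric])
    then show "f i / 2 ^ i = s * (?l i - ?l (i - 1)) + 37 / 16 * s\<^sup>2 * (4 * 2 ^ i * (?v i + ?v (i - 1)))"
      unfolding f_def by (simp add: field_simps)
  qed
  also have "(\<Sum>i = 1..m. ?l i - ?l (i - 1)) = ?l m - ?l 0"
  proof -
    have "(\<Sum>i = 1..n. h i - h (i - 1)) = h n - h 0" for n and h :: "nat \<Rightarrow> real" by (induction n) auto
    then show ?thesis .
  qed
  finally have main: "(\<integral>i. ?a i \<partial>?G) \<le> ?ED + s * ?l m + 37 / 16 * s\<^sup>2 * (2 * ?v 0 + (\<Sum>i = 1..m. 4 * 2 ^ i * (?v i + ?v (i - 1))))"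
    unfolding c_def by (simp add: algebra_simps)
  let ?N = "\<integral>\<omega>. norm (u \<omega>) * norm (z \<omega>) \<partial>P"
  have N0: "?N \<ge> 0" by simp
  have bias: "s * ?l m \<le> 3 / 10 * \<beta> * ?N"
  proof -
    have pos: "2 ^ m * real B > 0" using B1 by simp
    have "(2 ^ m * real B) * \<bar>?l m\<bar> \<le> 8 / 3 * (real \<tau> * \<rho>) * ?N" by (rule mean_deviation_bias[OF ua z])
    also have "\<dots> \<le> lam / 10 * (2 ^ m * real B) * ?N" by (rule mult_right_mono[OF bias_small N0])
    finally have "(2 ^ m * real B) * \<bar>?l m\<bar> \<le> (2 ^ m * real B) * (lam / 10 * ?N)" by (simp only: ac_simps)
    then have "\<bar>?l m\<bar> \<le> lam / 10 * ?N" using pos by (simp only: mult_le_cancel_left_pos)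
    then have "s * ?l m \<le> s * (lam / 10 * ?N)" using s0 by (intro mult_left_mono) auto
    also have "\<dots> = 3 / 10 * \<beta> * ?N" using lam by (simp add: s_def)
    finally show ?thesis .
  qed
  define K where "K = 19 / 3 * real \<tau> * \<rho>\<^sup>2 * ?E / real B"
  have K0: "K \<ge> 0" using E0 by (simp add: K_def)
  \<comment> \<open>\<open>K\<close> bounds the variance of the base batch\<close>
  have vK: "?v j \<le> K / 2 ^ j" for j
    using mean_deviation_variance[OF z B1, of j] unfolding K_def divide_divide_eq_left
    by (simp only: mult.commute[of "2 ^ j"])
  \<comment> \<open>the base batch contributes \<open>2 K\<close>, each level \<open>12 K\<close>\<close>
  have var: "2 * ?v 0 + (\<Sum>i = 1..m. 4 * 2 ^ i * (?v i + ?v (i - 1))) \<le> 14 * real m * K"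
  proof -
    have "(\<Sum>i = 1..m. 4 * 2 ^ i * (?v i + ?v (i - 1))) \<le> (\<Sum>i = 1..m. 12 * K)"
    proof (rule sum_mono)
      fix i assume "i \<in> {1..m}"
      then have "i \<noteq> 0" by simp
      then obtain n where n: "i = Suc n" using not0_implies_Suc by blast
      have "4 * 2 ^ i * (?v i + ?v (i - 1)) \<le> 4 * 2 ^ i * (K / 2 ^ i + K / 2 ^ (i - 1))"
        by (intro mult_left_mono add_mono vK) simp
      also have "\<dots> = 12 * K" by (simp add: n field_simps)
      finally show "4 * 2 ^ i * (?v i + ?v (i - 1)) \<le> 12 * K" .
    qed
    also have "\<dots> = 12 * real m * K" by simp
    finally have "2 * ?v 0 + (\<Sum>i = 1..m. 4 * 2 ^ i * (?v i + ?v (i - 1))) \<le> 2 * K + 12 * real m * K"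
      using vK[of 0] by simp
    also have "2 * K \<le> 2 * real m * K" using K0 m1 mult_right_mono[of 1 "real m" K] by simp
    finally show ?thesis by (simp only: distrib_right[symmetric]) (simp add: algebra_simps)
  qed
  have quad: "37 / 16 * s\<^sup>2 * (2 * ?v 0 + (\<Sum>i = 1..m. 4 * 2 ^ i * (?v i + ?v (i - 1)))) \<le> 312 / 1000 * \<beta> * ?E"
  proof -
    have "37 / 16 * s\<^sup>2 * (2 * ?v 0 + (\<Sum>i = 1..m. 4 * 2 ^ i * (?v i + ?v (i - 1)))) \<le> 37 / 16 * s\<^sup>2 * (14 * real m * K)"
      by (intro mult_left_mono var) simp
    also have "\<dots> = 333 / 16 * \<beta> / lam\<^sup>2 * (\<beta> * (14 * real m * (19 / 3 * real \<tau> * \<rho>\<^sup>2)) / real B) * ?E"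
      by (simp add: s_def K_def power_divide power_mult_distrib power2_eq_square)
    also have "\<dots> \<le> 333 / 16 * \<beta> / lam\<^sup>2 * (148 / 10000 * lam\<^sup>2) * ?E"
    proof (intro mult_right_mono mult_left_mono E0)
      show "\<beta> * (14 * real m * (19 / 3 * real \<tau> * \<rho>\<^sup>2)) / real B \<le> 148 / 10000 * lam\<^sup>2"
      proof -
        have "real B > 0" using B1 by simp
        then show ?thesis using variance_small by (simp only: pos_divide_le_eq)
      qed
    qed (use beta in auto)
    also have "\<dots> = 333 / 16 * 148 / 10000 * (\<beta> * ?E)" using lam by simp
    also have "\<dots> \<le> 312 / 1000 * (\<beta> * ?E)" using beta E0 by (intro mult_right_mono) auto
    finally show ?thesis by simp
  qed
  have "?ED + 3 / 10 * \<beta> * ?N + 312 / 1000 * \<beta> * ?E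
     = (\<integral>\<omega>. D \<omega> + 3 / 10 * \<beta> * (norm (u \<omega>) * norm (z \<omega>)) + 312 / 1000 * \<beta> * (norm (z \<omega>))\<^sup>2 \<partial>P)"
  proof -
    have "integrable P D" by (rule adapted_integrable[OF Da])
    moreover have "integrable P (\<lambda>\<omega>. norm (u \<omega>) * norm (z \<omega>))" by (rule adapted_integrable[of T]) (intro adapted_rules ua z)
    moreover have "integrable P (\<lambda>\<omega>. (norm (z \<omega>))\<^sup>2)" by (rule adapted_integrable[of T]) (intro adapted_rules z)
    ultimately show ?thesis by simp
  qed
  also have "\<dots> \<le> (\<integral>\<omega>. (1 - \<beta> / 2) * lyapunov U (z \<omega> + (4 - \<beta>) *\<^sub>R q \<omega>) (z \<omega> - (\<beta> * (1 - \<beta>)) *\<^sub>R q \<omega>) \<partial>P)"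
  proof (rule integral_mono)
    show "integrable P (\<lambda>\<omega>. D \<omega> + 3 / 10 * \<beta> * (norm (u \<omega>) * norm (z \<omega>)) + 312 / 1000 * \<beta> * (norm (z \<omega>))\<^sup>2)"
      by (rule adapted_integrable[of T]) (intro adapted_rules Da ua z)
    show "integrable P (\<lambda>\<omega>. (1 - \<beta> / 2) * lyapunov U (z \<omega> + (4 - \<beta>) *\<^sub>R q \<omega>) (z \<omega> - (\<beta> * (1 - \<beta>)) *\<^sub>R q \<omega>))"
      by (rule adapted_integrable[of T]) (intro adapted_lyapunov adapted_rules z q)
    fix \<omega> assume w: "\<omega> \<in> space P"
    show "D \<omega> + 3 / 10 * \<beta> * (norm (u \<omega>) * norm (z \<omega>)) + 312 / 1000 * \<beta> * (norm (z \<omega>))\<^sup>2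
      \<le> (1 - \<beta> / 2) * lyapunov U (z \<omega> + (4 - \<beta>) *\<^sub>R q \<omega>) (z \<omega> - (\<beta> * (1 - \<beta>)) *\<^sub>R q \<omega>)"
      unfolding D_def u_def
      by (rule lyapunov_contraction[OF linear_U U_sym U_psd U_upper U_upper_norm U_lower[OF mz[OF w]] beta])
  qed
  also have "\<dots> = (1 - \<beta> / 2) * (\<integral>\<omega>. lyapunov U (z \<omega> + (4 - \<beta>) *\<^sub>R q \<omega>) (z \<omega> - (\<beta> * (1 - \<beta>)) *\<^sub>R q \<omega>) \<partial>P)"
    by simp
  finally show ?thesis using main bias quad by linarith
qed

end

section \<open>States of the algorithm\<close>

lemma acc_consensus_time: "snd (snd (acc_consensus \<gamma> \<theta> \<eta> \<beta> p M B x0 w J k)) = (\<Sum>i<k. 2 ^ J i * B)"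
  by (induction k) (auto simp: Let_def case_prod_beta)

lemma acc_consensus_cong:
  "(\<And>i. i < k \<Longrightarrow> J i = J' i) \<Longrightarrow>
    acc_consensus \<gamma> \<theta> \<eta> \<beta> p M B x0 w J k = acc_consensus \<gamma> \<theta> \<eta> \<beta> p M B x0 w J' k"
  by (induction k) auto

lemma batch_mean_shift:
  assumes "\<And>k. w k *v c = 0"
  shows "batch_mean w B T (x + c) j = batch_mean w B T x j"
  unfolding batch_mean_def by (simp add: matrix_vector_right_distrib assms)

text \<open>The coefficients in each update have sum \<open>1\<close>, and the gradient estimate does not see a
  vector in the kernel of all matrices.\<close>

lemma acc_consensus_shift:
  assumes w: "\<And>k. w k *v c = 0"
  shows "acc_consensus \<gamma> \<theta> \<eta> \<beta> p M B (x0 + c) w J k =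
    (case acc_consensus \<gamma> \<theta> \<eta> \<beta> p M B x0 w J k of (x, x\<^sub>f, T) \<Rightarrow> (x + c, x\<^sub>f + c, T))"
proof (induction k)
  case (Suc k)
  obtain x xf T where st: "acc_consensus \<gamma> \<theta> \<eta> \<beta> p M B x0 w J k = (x, xf, T)" by (metis prod_cases3)
  define z where "z = \<theta> *\<^sub>R xf + (1 - \<theta>) *\<^sub>R x"
  have z: "\<theta> *\<^sub>R (xf + c) + (1 - \<theta>) *\<^sub>R (x + c) = z + c"
    unfolding z_def by (simp add: algebra_simps)
  have g: "mlmc_estimate w M B T (z + c) (J k) = mlmc_estimate w M B T z (J k)"
    unfolding mlmc_estimate_def by (simp add: batch_mean_shift[OF w])
  define y where "y = z - (p * \<gamma>) *\<^sub>R mlmc_estimate w M B T z (J k)"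
  have y: "z + c - (p * \<gamma>) *\<^sub>R mlmc_estimate w M B T z (J k) = y + c" unfolding y_def by simp
  have comb: "\<eta> *\<^sub>R (y + c) + (p - \<eta>) *\<^sub>R (xf + c) + ((1 - p) * (1 - \<beta>)) *\<^sub>R (x + c) + ((1 - p) * \<beta>) *\<^sub>R (z + c)
    = (\<eta> *\<^sub>R y + (p - \<eta>) *\<^sub>R xf + ((1 - p) * (1 - \<beta>)) *\<^sub>R x + ((1 - p) * \<beta>) *\<^sub>R z) + c"
    by (simp add: algebra_simps)
  show ?case using Suc by (simp add: st Let_def z g y comb z_def[symmetric] y_def[symmetric])
qed simp

lemma batch_mean_measurable:
  assumes V: "\<And>i. i \<le> T + 2 ^ j * B \<Longrightarrow> V i \<in> borel_measurable N" and x: "x \<in> borel_measurable N"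
  shows "(\<lambda>\<omega>. batch_mean (\<lambda>k. V k \<omega>) B T (x \<omega>) j) \<in> borel_measurable N"
  unfolding batch_mean_def
  by (intro borel_measurable_scaleR borel_measurable_const borel_measurable_sum borel_measurable_matrix_vector_mult V x) simp

lemma mlmc_estimate_measurable:
  assumes V: "\<And>i. i \<le> T + 2 ^ j * B \<Longrightarrow> V i \<in> borel_measurable N" and x: "x \<in> borel_measurable N"
  shows "(\<lambda>\<omega>. mlmc_estimate (\<lambda>k. V k \<omega>) M B T (x \<omega>) j) \<in> borel_measurable N"
proof -
  have b: "(\<lambda>\<omega>. batch_mean (\<lambda>k. V k \<omega>) B T (x \<omega>) l) \<in> borel_measurable N" if "l \<le> j" for l
  proof (rule batch_mean_measurable[OF V x])
    fix i assume i: "i \<le> T + 2 ^ l * B"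
    have "(2::nat) ^ l * B \<le> 2 ^ j * B" using that by (intro mult_right_mono power_increasing) auto
    then show "i \<le> T + 2 ^ j * B" using i by linarith
  qed
  show ?thesis unfolding mlmc_estimate_def
    by (cases "2 ^ j \<le> M") (simp_all add: b borel_measurable_add borel_measurable_scaleR borel_measurable_diff)
qed

text \<open>The horizon restricts the matrices to those drawn before the state is formed. It gives adaptedness
  when \<open>N\<close> is the past of the chain, and plain measurability for other \<open>N\<close>.\<close>

lemma acc_consensus_measurable:
  assumes V: "\<And>i. i \<le> (\<Sum>l<k. 2 ^ J l * B) \<Longrightarrow> V i \<in> borel_measurable N"
  shows "(\<lambda>\<omega>. fst (acc_consensus \<gamma> \<theta> \<eta> \<beta> p M B x0 (\<lambda>k. V k \<omega>) J k)) \<in> borel_measurable N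
    \<and> (\<lambda>\<omega>. fst (snd (acc_consensus \<gamma> \<theta> \<eta> \<beta> p M B x0 (\<lambda>k. V k \<omega>) J k))) \<in> borel_measurable N"
  using V
proof (induction k)
  case (Suc k)
  let ?s = "\<lambda>\<omega>. acc_consensus \<gamma> \<theta> \<eta> \<beta> p M B x0 (\<lambda>k. V k \<omega>) J k"
  let ?T = "\<Sum>l<k. 2 ^ J l * B"
  have "(\<lambda>\<omega>. fst (?s \<omega>)) \<in> borel_measurable N \<and> (\<lambda>\<omega>. fst (snd (?s \<omega>))) \<in> borel_measurable N"
    by (rule Suc.IH) (rule Suc.prems, simp)
  then have 1: "(\<lambda>\<omega>. fst (?s \<omega>)) \<in> borel_measurable N" "(\<lambda>\<omega>. fst (snd (?s \<omega>))) \<in> borel_measurable N"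
    by blast+
  let ?z = "\<lambda>\<omega>. \<theta> *\<^sub>R fst (snd (?s \<omega>)) + (1 - \<theta>) *\<^sub>R fst (?s \<omega>)"
  have z: "?z \<in> borel_measurable N"
    by (intro borel_measurable_add borel_measurable_scaleR borel_measurable_const 1)
  have g: "(\<lambda>\<omega>. mlmc_estimate (\<lambda>k. V k \<omega>) M B ?T (?z \<omega>) (J k)) \<in> borel_measurable N"
    by (rule mlmc_estimate_measurable[OF Suc.prems z]) simp
  let ?y = "\<lambda>\<omega>. ?z \<omega> - (p * \<gamma>) *\<^sub>R mlmc_estimate (\<lambda>k. V k \<omega>) M B ?T (?z \<omega>) (J k)"
  have y: "?y \<in> borel_measurable N"
    by (intro borel_measurable_diff borel_measurable_scaleR borel_measurable_const z g)
  have e: "acc_consensus \<gamma> \<theta> \<eta> \<beta> p M B x0 (\<lambda>k. V k \<omega>) J (Suc k) =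
     (\<eta> *\<^sub>R ?y \<omega> + (p - \<eta>) *\<^sub>R fst (snd (?s \<omega>)) + ((1 - p) * (1 - \<beta>)) *\<^sub>R fst (?s \<omega>) + ((1 - p) * \<beta>) *\<^sub>R ?z \<omega>,
      ?y \<omega>, ?T + 2 ^ J k * B)" for \<omega>
    by (simp only: acc_consensus.simps Let_def case_prod_beta acc_consensus_time)
  show ?case
    unfolding e fst_conv snd_conv by (intro conjI borel_measurable_add borel_measurable_scaleR borel_measurable_const y z 1)
qed simp

text \<open>The momentum \<open>\<theta>\<close> is chosen such that \<open>\<eta> z + (p - \<eta>) x\<^sub>f\<close> combines with the remaining terms to
  \<open>(1 - \<beta>) x + \<beta> z\<close>; this is the identity behind the third equation.\<close>

lemma acc_consensus_step:
  fixes x0 :: "real^'n"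
  assumes beta: "0 < \<beta>" "\<beta> \<le> 1 / 4" and lam: "0 < lam"
    and st: "acc_consensus (12 * \<beta>\<^sup>2 / lam) ((4 - \<beta>) / (4 - \<beta>\<^sup>2)) (1 / \<beta>) \<beta> (1 / 4) M B x0 w J k = (x, xf, T)"
    and z: "z = ((4 - \<beta>) / (4 - \<beta>\<^sup>2)) *\<^sub>R xf + (1 - (4 - \<beta>) / (4 - \<beta>\<^sup>2)) *\<^sub>R x"
    and q: "q = (1 / (4 - \<beta>\<^sup>2)) *\<^sub>R (x - xf)"
    and g: "g = mlmc_estimate w M B T z (J k)"
  shows "x = z + (4 - \<beta>) *\<^sub>R q" and "xf = z - (\<beta> * (1 - \<beta>)) *\<^sub>R q"
    and "acc_consensus (12 * \<beta>\<^sup>2 / lam) ((4 - \<beta>) / (4 - \<beta>\<^sup>2)) (1 / \<beta>) \<beta> (1 / 4) M B x0 w J (Suc k)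
      = (z + ((4 - \<beta>) * (1 - \<beta>)) *\<^sub>R q - (3 * \<beta> / lam) *\<^sub>R g, z - (\<beta> * (3 * \<beta> / lam)) *\<^sub>R g, T + 2 ^ J k * B)"
proof -
  have b2: "\<beta>\<^sup>2 \<le> \<beta> / 4" using beta mult_left_mono[of \<beta> "1/4" \<beta>] by (simp add: power2_eq_square)
  then have d: "4 - \<beta>\<^sup>2 > 0" using beta by linarith
  define \<theta> where "\<theta> = (4 - \<beta>) / (4 - \<beta>\<^sup>2)"
  have t1: "(4 - \<beta>) *\<^sub>R q = \<theta> *\<^sub>R (x - xf)" by (simp add: q \<theta>_def)
  have t: "1 - \<theta> = (\<beta> * (1 - \<beta>)) * (1 / (4 - \<beta>\<^sup>2))"
    using d by (simp add: \<theta>_def field_simps power2_eq_square)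
  have t2: "(\<beta> * (1 - \<beta>)) *\<^sub>R q = (1 - \<theta>) *\<^sub>R (x - xf)" by (simp add: q t)
  show x: "x = z + (4 - \<beta>) *\<^sub>R q"
    unfolding t1 unfolding z \<theta>_def[symmetric] by (simp add: algebra_simps)
  show xf: "xf = z - (\<beta> * (1 - \<beta>)) *\<^sub>R q"
    unfolding t2 unfolding z \<theta>_def[symmetric] by (simp add: algebra_simps)
  have y: "1 / 4 * (12 * \<beta>\<^sup>2 / lam) = \<beta> * (3 * \<beta> / lam)" by (simp add: power2_eq_square)
  have comb: "a *\<^sub>R (z - c *\<^sub>R g) + b *\<^sub>R (z - d *\<^sub>R q) + e *\<^sub>R (z + f *\<^sub>R q) + h *\<^sub>R z
     = (a + b + e + h) *\<^sub>R z + (e * f - b * d) *\<^sub>R q - (a * c) *\<^sub>R g" for a b c d e f h :: real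
    by (simp add: algebra_simps)
  have c1: "1 / \<beta> + (1 / 4 - 1 / \<beta>) + (1 - 1 / 4) * (1 - \<beta>) + (1 - 1 / 4) * \<beta> = 1" by (simp add: algebra_simps diff_divide_distrib)
  have c2: "(1 - 1 / 4) * (1 - \<beta>) * (4 - \<beta>) - (1 / 4 - 1 / \<beta>) * (\<beta> * (1 - \<beta>)) = (4 - \<beta>) * (1 - \<beta>)"
    using beta by (simp add: field_simps)
  have c3: "1 / \<beta> * (\<beta> * (3 * \<beta> / lam)) = 3 * \<beta> / lam" using beta by simp
  have "(1 / \<beta>) *\<^sub>R (z - (\<beta> * (3 * \<beta> / lam)) *\<^sub>R g) + (1 / 4 - 1 / \<beta>) *\<^sub>R xf + ((1 - 1 / 4) * (1 - \<beta>)) *\<^sub>R x + ((1 - 1 / 4) * \<beta>) *\<^sub>R z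
      = (1 / \<beta>) *\<^sub>R (z - (\<beta> * (3 * \<beta> / lam)) *\<^sub>R g) + (1 / 4 - 1 / \<beta>) *\<^sub>R (z - (\<beta> * (1 - \<beta>)) *\<^sub>R q)
        + ((1 - 1 / 4) * (1 - \<beta>)) *\<^sub>R (z + (4 - \<beta>) *\<^sub>R q) + ((1 - 1 / 4) * \<beta>) *\<^sub>R z"
    by (simp only: x[symmetric] xf[symmetric])
  also have "\<dots> = z + ((4 - \<beta>) * (1 - \<beta>)) *\<^sub>R q - (3 * \<beta> / lam) *\<^sub>R g"
    unfolding comb c1 c2 c3 by simp
  finally show "acc_consensus (12 * \<beta>\<^sup>2 / lam) ((4 - \<beta>) / (4 - \<beta>\<^sup>2)) (1 / \<beta>) \<beta> (1 / 4) M B x0 w J (Suc k)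
      = (z + ((4 - \<beta>) * (1 - \<beta>)) *\<^sub>R q - (3 * \<beta> / lam) *\<^sub>R g, z - (\<beta> * (3 * \<beta> / lam)) *\<^sub>R g, T + 2 ^ J k * B)"
    by (simp only: acc_consensus.simps st Let_def case_prod_conv z[symmetric] g[symmetric] y)
qed

lemma lyapunov_gap_equivalence:
  fixes U :: "'a::real_inner \<Rightarrow> 'a"
  assumes U: "y \<bullet> y \<le> y \<bullet> U y"
  shows "lyapunov U x y \<le> 2 * ((norm x)\<^sup>2 + 24 * (y \<bullet> U y))"
    and "(norm x)\<^sup>2 + 24 * (y \<bullet> U y) \<le> 3 * lyapunov U x y"
proof -
  have y0: "0 \<le> y \<bullet> y" by simp
  have n: "(norm y)\<^sup>2 = y \<bullet> y" by (rule power2_norm_eq_inner)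
  have "(norm (x + y))\<^sup>2 \<le> 2 * (norm x)\<^sup>2 + 2 * (norm y)\<^sup>2" by (rule norm_add_square_le)
  then show "lyapunov U x y \<le> 2 * ((norm x)\<^sup>2 + 24 * (y \<bullet> U y))"
  proof -
    have e: "2 * ((norm x)\<^sup>2 + 24 * (y \<bullet> U y)) = 2 * (norm x)\<^sup>2 + 48 * (y \<bullet> U y)" by simp
    assume "(norm (x + y))\<^sup>2 \<le> 2 * (norm x)\<^sup>2 + 2 * (norm y)\<^sup>2"
    then show ?thesis unfolding lyapunov_def n e using U y0 by linarith
  qed
  have "(norm ((x + y) + - y))\<^sup>2 \<le> 2 * (norm (x + y))\<^sup>2 + 2 * (norm (- y))\<^sup>2" by (rule norm_add_square_le)
  then have "(norm x)\<^sup>2 \<le> 2 * (norm (x + y))\<^sup>2 + 2 * (y \<bullet> y)" by (simp add: n)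
  then show "(norm x)\<^sup>2 + 24 * (y \<bullet> U y) \<le> 3 * lyapunov U x y"
  proof -
    have e: "3 * ((norm (x + y))\<^sup>2 + 12 * (y \<bullet> U y)) = 3 * (norm (x + y))\<^sup>2 + 36 * (y \<bullet> U y)" by simp
    assume "(norm x)\<^sup>2 \<le> 2 * (norm (x + y))\<^sup>2 + 2 * (y \<bullet> y)"
    then show ?thesis
      unfolding lyapunov_def e using U y0 zero_le_power2[of "norm (x + y)"] by linarith
  qed
qed

context accelerated_gossip
begin

definition trajectory :: "real^'n \<Rightarrow> (nat \<Rightarrow> real^'n^'n) \<Rightarrow> (nat \<Rightarrow> nat) \<Rightarrow> nat \<Rightarrow> (real^'n) \<times> (real^'n) \<times> nat" where
  "trajectory = acc_consensus (12 * \<beta>\<^sup>2 / lam) ((4 - \<beta>) / (4 - \<beta>\<^sup>2)) (1 / \<beta>) \<beta> (1 / 4) M B"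

definition potential :: "real^'n \<Rightarrow> (nat \<Rightarrow> real^'n^'n) \<Rightarrow> (nat \<Rightarrow> nat) \<Rightarrow> nat \<Rightarrow> real" where
  "potential x0 w j k = lyapunov U (fst (trajectory x0 w j k)) (fst (snd (trajectory x0 w j k)))"

lemma mean_zero_matrix:
  assumes "A \<in> space S"
  shows "1 \<bullet> (A *v x) = 0"
  using columns[OF assms] dot_lmul_matrix[of 1 A x] by simp

lemma mean_zero_mlmc:
  assumes "\<And>k. w k \<in> space S"
  shows "1 \<bullet> mlmc_estimate w M B T x i = 0"
proof -
  have "1 \<bullet> batch_mean w B T x i = 0" for i
    unfolding batch_mean_def by (simp add: inner_sum_right mean_zero_matrix assms)
  then show ?thesis unfolding mlmc_estimate_def by (simp add: inner_add_right inner_diff_right)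
qed

lemma trajectory_mean_zero:
  assumes w: "\<And>k. w k \<in> space S" and x0: "1 \<bullet> x0 = 0"
  shows "1 \<bullet> fst (trajectory x0 w j k) = 0 \<and> 1 \<bullet> fst (snd (trajectory x0 w j k)) = 0"
proof (induction k)
  case (Suc k)
  then show ?case
    unfolding trajectory_def
    by (simp add: Let_def case_prod_beta inner_add_right inner_diff_right mean_zero_mlmc[OF w])
qed (simp add: trajectory_def x0)

lemma norm_matrix_le:
  assumes "A \<in> space S"
  shows "norm (A *v x) \<le> (\<rho> + op_norm Wt) * norm x"
proof -
  have "norm (A *v x) = norm ((A - Wt) *v x + Wt *v x)" by (simp add: matrix_vector_mult_diff_rdistrib)
  also have "\<dots> \<le> \<rho> * norm x + op_norm Wt * norm x"
    by (intro norm_triangle_le add_mono norm_deviation_le assms norm_matrix_vector_le_op_norm)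
  finally show ?thesis by (simp add: algebra_simps)
qed

lemma norm_mlmc_le:
  assumes w: "\<And>k. w k \<in> space S"
  shows "norm (mlmc_estimate w M B T x i) \<le> (1 + 2 * 2 ^ m) * (\<rho> + op_norm Wt) * norm x"
proof -
  let ?c = "(\<rho> + op_norm Wt) * norm x"
  have c0: "?c \<ge> 0" using norm_matrix_le[OF w, of 0 x] norm_ge_zero order_trans by blast
  have b: "norm (batch_mean w B T x j) \<le> ?c" for j
  proof -
    have "norm (batch_mean w B T x j) \<le> (1 / (2 ^ j * real B)) * (\<Sum>i = 1..2 ^ j * B. ?c)"
      unfolding batch_mean_def norm_scaleR
      by (intro mult_mono sum_norm_le norm_matrix_le w) (auto intro!: sum_nonneg c0)
    also have "\<dots> = ?c" using B1 by simp
    finally show ?thesis .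
  qed
  show ?thesis
  proof (cases "2 ^ i \<le> M")
    case True
    then have "i \<le> m" by (simp add: levels)
    then have i: "(2::real) ^ i \<le> 2 ^ m" by (intro power_increasing) auto
    have "norm (mlmc_estimate w M B T x i) \<le> norm (batch_mean w B T x 0)
        + norm (2 ^ i *\<^sub>R (batch_mean w B T x i - batch_mean w B T x (i - 1)))"
      unfolding mlmc_estimate_def using True by (simp only: if_True norm_triangle_ineq)
    also have "\<dots> \<le> ?c + 2 ^ m * (?c + ?c)"
      unfolding norm_scaleR using i c0
      by (intro add_mono mult_mono b order_trans[OF norm_triangle_ineq4]) auto
    finally show ?thesis by (simp add: algebra_simps)
  next
    case False
    then have "norm (mlmc_estimate w M B T x i) \<le> 1 * ?c"
      unfolding mlmc_estimate_def using b[of 0] by (simp only: if_False)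
    also have "\<dots> \<le> (1 + 2 * 2 ^ m) * ?c" using c0 by (intro mult_right_mono) auto
    finally show ?thesis by (simp add: mult.assoc)
  qed
qed

text \<open>The bound depends on the iteration, but neither on the matrices nor on the levels; the latter holds
  since the multilevel correction is switched off above level \<open>m\<close>.\<close>

lemma trajectory_bounded:
  "\<exists>c. \<forall>w j. (\<forall>k. w k \<in> space S) \<longrightarrow> norm (fst (trajectory x0 w j k)) \<le> c \<and> norm (fst (snd (trajectory x0 w j k))) \<le> c"
proof (induction k)
    case 0
    show ?case by (rule exI[of _ "norm x0"]) (simp add: trajectory_def)
  next
    case (Suc k)
    then obtain c where c: "\<And>w j. (\<And>k. w k \<in> space S) \<Longrightarrow> norm (fst (trajectory x0 w j k)) \<le> c"
       "\<And>w j. (\<And>k. w k \<in> space S) \<Longrightarrow> norm (fst (snd (trajectory x0 w j k))) \<le> c" by blast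
    define \<theta> where "\<theta> = (4 - \<beta>) / (4 - \<beta>\<^sup>2)"
    define \<gamma> where "\<gamma> = 12 * \<beta>\<^sup>2 / lam"
    define cz where "cz = \<bar>\<theta>\<bar> * c + \<bar>1 - \<theta>\<bar> * c"
    define K where "K = (1 + 2 * 2 ^ m) * (\<rho> + op_norm Wt)"
    have K0: "K \<ge> 0" unfolding K_def using deviation_nonneg
      by (intro mult_nonneg_nonneg add_nonneg_nonneg) (auto simp: op_norm_def onorm_pos_le)
    define cy where "cy = cz + \<bar>1 / 4 * \<gamma>\<bar> * (K * cz)"
    define cx where "cx = \<bar>1 / \<beta>\<bar> * cy + \<bar>1 / 4 - 1 / \<beta>\<bar> * c + \<bar>(1 - 1 / 4) * (1 - \<beta>)\<bar> * c + \<bar>(1 - 1 / 4) * \<beta>\<bar> * cz"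
    have "norm (fst (trajectory x0 w j (Suc k))) \<le> max cx cy \<and> norm (fst (snd (trajectory x0 w j (Suc k)))) \<le> max cx cy"
      if w: "\<forall>k. w k \<in> space S" for w j
    proof -
      obtain x xf T where st: "trajectory x0 w j k = (x, xf, T)" by (metis prod_cases3)
      have x: "norm x \<le> c" "norm xf \<le> c" using c[of w j] w st by auto
      define z where "z = \<theta> *\<^sub>R xf + (1 - \<theta>) *\<^sub>R x"
      define y where "y = z - (1 / 4 * \<gamma>) *\<^sub>R mlmc_estimate w M B T z (j k)"
      have z: "norm z \<le> cz" unfolding z_def cz_def
        by (intro norm_triangle_le add_mono) (simp_all add: x mult_left_mono)
      have "norm (mlmc_estimate w M B T z (j k)) \<le> K * norm z" unfolding K_def by (rule norm_mlmc_le) (use w in simp)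
      also have "\<dots> \<le> K * cz" by (rule mult_left_mono[OF z K0])
      finally have g: "norm (mlmc_estimate w M B T z (j k)) \<le> K * cz" .
      have y: "norm y \<le> cy" unfolding y_def cy_def
        by (intro order_trans[OF norm_triangle_ineq4] add_mono z) (simp only: norm_scaleR, rule mult_left_mono[OF g abs_ge_zero])
      have e: "trajectory x0 w j (Suc k) = ((1 / \<beta>) *\<^sub>R y + (1 / 4 - 1 / \<beta>) *\<^sub>R xf + ((1 - 1 / 4) * (1 - \<beta>)) *\<^sub>R x + ((1 - 1 / 4) * \<beta>) *\<^sub>R z, y, T + 2 ^ j k * B)"
        using st unfolding trajectory_def
        by (simp only: acc_consensus.simps Let_def case_prod_conv y_def z_def \<theta>_def \<gamma>_def)
      have "norm ((1 / \<beta>) *\<^sub>R y + (1 / 4 - 1 / \<beta>) *\<^sub>R xf + ((1 - 1 / 4) * (1 - \<beta>)) *\<^sub>R x + ((1 - 1 / 4) * \<beta>) *\<^sub>R z) \<le> cx"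
        unfolding cx_def
        by (intro norm_triangle_le add_mono) (simp_all only: norm_scaleR mult_left_mono[OF _ abs_ge_zero] x y z)
      with y show ?thesis unfolding e by auto
    qed
    then show ?case by blast
qed

lemma potential_nonneg: "0 \<le> potential x0 w j k"
  unfolding potential_def by (rule lyapunov_nonneg)

lemma potential_bounded:
  "\<exists>c. \<forall>w j. (\<forall>k. w k \<in> space S) \<longrightarrow> \<bar>potential x0 w j k\<bar> \<le> c"
proof -
  obtain c where c: "\<And>w j. (\<And>k. w k \<in> space S) \<Longrightarrow> norm (fst (trajectory x0 w j k)) \<le> c"
    "\<And>w j. (\<And>k. w k \<in> space S) \<Longrightarrow> norm (fst (snd (trajectory x0 w j k))) \<le> c"
    using trajectory_bounded[of x0 k] by blast
  have "\<bar>potential x0 w j k\<bar> \<le> (c + c)\<^sup>2 + 12 * (c\<^sup>2 / 16 / \<beta>\<^sup>2)" if w: "\<And>k. w k \<in> space S" for w j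
  proof -
    let ?x = "fst (trajectory x0 w j k)" and ?y = "fst (snd (trajectory x0 w j k))"
    have "norm (?x + ?y) \<le> c + c" by (intro norm_triangle_le add_mono c w)
    then have 1: "(norm (?x + ?y))\<^sup>2 \<le> (c + c)\<^sup>2" by (intro power_mono) auto
    have "\<beta>\<^sup>2 * (?y \<bullet> U ?y) \<le> c\<^sup>2 / 16"
    proof -
      have "norm ?y \<le> c" by (rule c(2)[OF w])
      then have "(norm ?y)\<^sup>2 \<le> c\<^sup>2" by (rule power_mono) simp
      then show ?thesis using U_upper[of ?y] by (simp only: power2_norm_eq_inner)
    qed
    then have "?y \<bullet> U ?y \<le> c\<^sup>2 / 16 / \<beta>\<^sup>2" using beta by (simp add: field_simps)
    then show ?thesis using 1 potential_nonneg[of x0 w j k] unfolding potential_def lyapunov_def by simp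
  qed
  then show ?thesis by blast
qed

lemma potential_measurable:
  assumes "\<And>i. V i \<in> borel_measurable N"
  shows "(\<lambda>\<omega>. potential x0 (\<lambda>k. V k \<omega>) j k) \<in> borel_measurable N"
proof -
  have m: "(\<lambda>\<omega>. fst (trajectory x0 (\<lambda>k. V k \<omega>) j k)) \<in> borel_measurable N"
    "(\<lambda>\<omega>. fst (snd (trajectory x0 (\<lambda>k. V k \<omega>) j k))) \<in> borel_measurable N"
    unfolding trajectory_def using acc_consensus_measurable[where V = V and N = N, OF assms] by blast+
  have U: "(\<lambda>\<omega>. U (f \<omega>)) \<in> borel_measurable N" if "f \<in> borel_measurable N" for f
    unfolding U_def using that by (intro borel_measurable_scaleR borel_measurable_matrix_vector_mult borel_measurable_const)
  have n: "(\<lambda>\<omega>. norm (f \<omega>)) \<in> borel_measurable N" if "f \<in> borel_measurable N" for f :: "_ \<Rightarrow> real^'n"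
    using that by measurable
  show ?thesis unfolding potential_def lyapunov_def
    by (intro borel_measurable_add borel_measurable_times borel_measurable_const borel_measurable_inner borel_measurable_power n m U)
qed

definition mean_potential :: "real^'n \<Rightarrow> (nat \<Rightarrow> nat) \<Rightarrow> nat \<Rightarrow> real" where
  "mean_potential x0 j k = (\<integral>\<omega>. potential x0 (\<lambda>k. W k \<omega>) j k \<partial>P)"

lemma mean_potential_nonneg: "0 \<le> mean_potential x0 j k"
  unfolding mean_potential_def by (intro integral_nonneg_AE AE_I2 potential_nonneg)

lemma mean_potential_cong: "(\<And>i. i < k \<Longrightarrow> j i = j' i) \<Longrightarrow> mean_potential x0 j k = mean_potential x0 j' k"
proof -
  assume j: "\<And>i. i < k \<Longrightarrow> j i = j' i"
  have "trajectory x0 w j k = trajectory x0 w j' k" for w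
    unfolding trajectory_def by (rule acc_consensus_cong) (rule j)
  then show ?thesis unfolding mean_potential_def potential_def by (simp only:)
qed

lemma W_measurable_P: "W i \<in> borel_measurable P"
  using measurable_compose[OF chain_measurable identity_measurable] .

lemma mean_potential_bounded: "\<exists>c. \<forall>j. \<bar>mean_potential x0 j k\<bar> \<le> c"
proof -
  obtain c where c: "\<And>w j. (\<And>k. w k \<in> space S) \<Longrightarrow> \<bar>potential x0 w j k\<bar> \<le> c"
    using potential_bounded[of x0 k] by blast
  have "\<bar>mean_potential x0 j k\<bar> \<le> c" for j
    unfolding mean_potential_def
    by (rule abs_expectation_le[OF potential_measurable[OF W_measurable_P] c[OF W_space]])
  then show ?thesis by blast
qed

text \<open>Only the level of the current iteration is averaged. The earlier ones are fixed, so the iteration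
  starts from a state that is adapted to the chain at a deterministic time.\<close>

lemma mean_potential_contraction:
  assumes x0: "1 \<bullet> x0 = 0"
  shows "(\<integral>i. mean_potential x0 (j(k := i)) (Suc k) \<partial>measure_pmf (map_pmf Suc (geometric_pmf (1/2))))
    \<le> (1 - \<beta> / 2) * mean_potential x0 j k"
proof -
  define T where "T = (\<Sum>i<k. 2 ^ j i * B)"
  define x where "x \<omega> = fst (trajectory x0 (\<lambda>k. W k \<omega>) j k)" for \<omega>
  define xf where "xf \<omega> = fst (snd (trajectory x0 (\<lambda>k. W k \<omega>) j k))" for \<omega>
  have st: "trajectory x0 (\<lambda>k. W k \<omega>) j k = (x \<omega>, xf \<omega>, T)" for \<omega>
    unfolding x_def xf_def T_def trajectory_def by (simp add: prod_eq_iff acc_consensus_time)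
  obtain c where c: "\<And>w j. (\<And>k. w k \<in> space S) \<Longrightarrow> norm (fst (trajectory x0 w j k)) \<le> c"
    "\<And>w j. (\<And>k. w k \<in> space S) \<Longrightarrow> norm (fst (snd (trajectory x0 w j k))) \<le> c"
    using trajectory_bounded[of x0 k] by blast
  have "x \<in> borel_measurable (past P S W T)" "xf \<in> borel_measurable (past P S W T)"
    using acc_consensus_measurable[where V = W and N = "past P S W T", OF W_measurable_past] unfolding x_def xf_def trajectory_def T_def by blast+
  moreover have "\<forall>\<omega>\<in>space P. norm (x \<omega>) \<le> c" "\<forall>\<omega>\<in>space P. norm (xf \<omega>) \<le> c"
    unfolding x_def xf_def by (intro ballI, rule c, rule W_space, assumption)+
  ultimately have ax: "adapted T x" and axf: "adapted T xf" unfolding adapted_def by blast+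
  define z where "z \<omega> = ((4 - \<beta>) / (4 - \<beta>\<^sup>2)) *\<^sub>R xf \<omega> + (1 - (4 - \<beta>) / (4 - \<beta>\<^sup>2)) *\<^sub>R x \<omega>" for \<omega>
  define q where "q \<omega> = (1 / (4 - \<beta>\<^sup>2)) *\<^sub>R (x \<omega> - xf \<omega>)" for \<omega>
  have az: "adapted T z" unfolding z_def by (intro adapted_add adapted_scaleR ax axf)
  have aq: "adapted T q" unfolding q_def by (intro adapted_diff adapted_scaleR ax axf)
  have mz: "1 \<bullet> z \<omega> = 0" if "\<omega> \<in> space P" for \<omega>
    using trajectory_mean_zero[of "\<lambda>k. W k \<omega>" x0 j k, OF W_space[OF that] x0]
    unfolding st z_def by (simp add: inner_add_right)
  have st': "trajectory x0 (\<lambda>k. W k \<omega>) (j(k := i)) k = (x \<omega>, xf \<omega>, T)" for \<omega> i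
    unfolding st[symmetric] trajectory_def by (rule acc_consensus_cong) simp
  note step = acc_consensus_step[OF beta lam st'[unfolded trajectory_def] z_def q_def refl, folded trajectory_def]
  have g: "mlmc_estimate (\<lambda>k. W k \<omega>) M B T (z \<omega>) i = Wt *v z \<omega> + noise T z i \<omega>" for \<omega> i
    by (simp add: noise_def)
  have next1: "z \<omega> + ((4 - \<beta>) * (1 - \<beta>)) *\<^sub>R q \<omega> - (3 * \<beta> / lam) *\<^sub>R mlmc_estimate (\<lambda>k. W k \<omega>) M B T (z \<omega>) i
     = z \<omega> + ((4 - \<beta>) * (1 - \<beta>)) *\<^sub>R q \<omega> - (3 * \<beta>) *\<^sub>R U (z \<omega>) - (3 * \<beta> / lam) *\<^sub>R noise T z i \<omega>" for \<omega> i
    unfolding g U_def by (simp add: scaleR_right_distrib)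
  have next2: "z \<omega> - (\<beta> * (3 * \<beta> / lam)) *\<^sub>R mlmc_estimate (\<lambda>k. W k \<omega>) M B T (z \<omega>) i
     = z \<omega> - (3 * \<beta>\<^sup>2) *\<^sub>R U (z \<omega>) - \<beta> *\<^sub>R ((3 * \<beta> / lam) *\<^sub>R noise T z i \<omega>)" for \<omega> i
    unfolding g U_def by (simp add: scaleR_right_distrib power2_eq_square mult.left_commute)
  have "potential x0 (\<lambda>k. W k \<omega>) (j(k := i)) (Suc k) = lyapunov U
        (z \<omega> + ((4 - \<beta>) * (1 - \<beta>)) *\<^sub>R q \<omega> - (3 * \<beta>) *\<^sub>R U (z \<omega>) - (3 * \<beta> / lam) *\<^sub>R noise T z i \<omega>)
        (z \<omega> - (3 * \<beta>\<^sup>2) *\<^sub>R U (z \<omega>) - \<beta> *\<^sub>R ((3 * \<beta> / lam) *\<^sub>R noise T z i \<omega>))" for \<omega> i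
    unfolding potential_def step(3) fun_upd_same next1 next2 fst_conv snd_conv ..
  moreover have "potential x0 (\<lambda>k. W k \<omega>) j k = lyapunov U (z \<omega> + (4 - \<beta>) *\<^sub>R q \<omega>) (z \<omega> - (\<beta> * (1 - \<beta>)) *\<^sub>R q \<omega>)" for \<omega>
    unfolding potential_def st fst_conv snd_conv step(1)[symmetric] step(2)[symmetric] ..
  ultimately show ?thesis
    using expected_contraction[OF az aq mz] unfolding mean_potential_def by (simp only:)
qed

section \<open>Averaging over the batch levels\<close>

abbreviation level_law :: "nat measure" where
  "level_law \<equiv> measure_pmf (map_pmf Suc (geometric_pmf (1/2)))"

text \<open>Under the product measure the last level can be integrated first, with the others fixed.\<close>

lemma averaged_potential_decay:
  assumes x0: "1 \<bullet> x0 = 0"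
  shows "(\<integral>j. mean_potential x0 j k \<partial>(\<Pi>\<^sub>M i\<in>{..<k}. level_law)) \<le> (1 - \<beta> / 2) ^ k * lyapunov U x0 x0"
proof (induction k)
  case 0
  show ?case by (simp add: mean_potential_def potential_def trajectory_def PiM_empty prob_space)
next
  case (Suc k)
  interpret product_prob_space "\<lambda>_ :: nat. level_law" UNIV by unfold_locales
  have meas: "f \<in> borel_measurable (\<Pi>\<^sub>M i\<in>{..<k}. level_law)" for f :: "(nat \<Rightarrow> nat) \<Rightarrow> real" and k
  proof -
    have "sets (\<Pi>\<^sub>M i\<in>{..<k}. level_law) = sets (\<Pi>\<^sub>M i\<in>{..<k}. count_space UNIV)"
      by (rule sets_PiM_cong) simp_all
    also have "(\<Pi>\<^sub>M i\<in>{..<k}. count_space UNIV) = count_space (PiE {..<k} (\<lambda>_. UNIV :: nat set))"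
      by (rule count_space_PiM_finite) simp_all
    finally show ?thesis using measurable_cong_sets[of _ _ borel borel] by (metis borel_measurable_count_space)
  qed
  have int: "integrable (\<Pi>\<^sub>M i\<in>{..<k}. level_law) (\<lambda>j. mean_potential x0 j l)" for k l
  proof -
    interpret law: prob_space "\<Pi>\<^sub>M i\<in>{..<k}. level_law" by (rule prob_space_PiM) (rule measure_pmf.prob_space_axioms)
    obtain c where "\<And>j. \<bar>mean_potential x0 j l\<bar> \<le> c" using mean_potential_bounded by blast
    then show ?thesis by (intro law.integrable_bounded_real[OF meas])
  qed
  have "(\<integral>j. mean_potential x0 j (Suc k) \<partial>(\<Pi>\<^sub>M i\<in>{..<Suc k}. level_law))
     = (\<integral>j. (\<integral>i. mean_potential x0 (j(k := i)) (Suc k) \<partial>level_law) \<partial>(\<Pi>\<^sub>M i\<in>{..<k}. level_law))"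
    unfolding lessThan_Suc by (rule product_integral_insert) (use int[of "Suc k"] in \<open>simp_all add: lessThan_Suc\<close>)
  also have "\<dots> \<le> (\<integral>j. (1 - \<beta> / 2) * mean_potential x0 j k \<partial>(\<Pi>\<^sub>M i\<in>{..<k}. level_law))"
  proof (rule integral_mono')
    show "integrable (\<Pi>\<^sub>M i\<in>{..<k}. level_law) (\<lambda>j. (1 - \<beta> / 2) * mean_potential x0 j k)" using int by simp
    show "0 \<le> (1 - \<beta> / 2) * mean_potential x0 j k" for j using mean_potential_nonneg beta by simp
  qed (rule mean_potential_contraction[OF x0])
  also have "\<dots> = (1 - \<beta> / 2) * (\<integral>j. mean_potential x0 j k \<partial>(\<Pi>\<^sub>M i\<in>{..<k}. level_law))" by simp
  also have "\<dots> \<le> (1 - \<beta> / 2) * ((1 - \<beta> / 2) ^ k * lyapunov U x0 x0)"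
    using Suc beta by (intro mult_left_mono) auto
  finally show ?case by simp
qed

text \<open>Fubini's theorem for the product law of the matrices and the levels. The potential after \<open>N\<close>
  iterations depends on finitely many levels, and these take countably many values; both joint
  measurability and the passage to a finite product come from this.\<close>

lemma expected_potential_eq:
  assumes J: "geometric_batches P S W J"
  shows "integrable P (\<lambda>\<omega>. potential x0 (\<lambda>k. W k \<omega>) (\<lambda>k. J k \<omega>) N)"
    and "(\<integral>\<omega>. potential x0 (\<lambda>k. W k \<omega>) (\<lambda>k. J k \<omega>) N \<partial>P)
      = (\<integral>j. mean_potential x0 j N \<partial>(\<Pi>\<^sub>M i\<in>{..<N}. level_law))"
proof -
  let ?SW = "\<Pi>\<^sub>M k\<in>(UNIV :: nat set). S" and ?SJ = "\<Pi>\<^sub>M k\<in>(UNIV :: nat set). (count_space UNIV :: nat measure)"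
  let ?W = "\<lambda>\<omega> k. W k \<omega>" and ?J = "\<lambda>\<omega> k. J k \<omega>"
  let ?LW = "distr P ?SW ?W" and ?LJ = "distr P ?SJ ?J"
  define F where "F w j = potential x0 w j N" for w j
  have Jm: "J k \<in> measurable P (count_space UNIV)" and Jd: "distr P (count_space UNIV) (J k) = level_law" for k
    using J unfolding geometric_batches_def by blast+
  have Ji: "indep_vars (\<lambda>_. count_space UNIV) J UNIV"
    and joint: "distr P (?SW \<Otimes>\<^sub>M ?SJ) (\<lambda>\<omega>. (?W \<omega>, ?J \<omega>)) = ?LW \<Otimes>\<^sub>M ?LJ"
    using J unfolding geometric_batches_def by blast+
  have Wm: "?W \<in> measurable P ?SW"
    by (rule measurable_PiM_single') (auto intro: W_space)
  have JM: "?J \<in> measurable P ?SJ"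
    by (rule measurable_PiM_single') (auto intro: Jm)
  have Fr: "F w j = F w (restrict j {..<N})" for w j
    unfolding F_def potential_def trajectory_def by (simp add: acc_consensus_cong[of N j "restrict j {..<N}"])
  have Fw: "(\<lambda>w. F w j) \<in> borel_measurable ?SW" for j
    unfolding F_def
  proof (rule potential_measurable)
    fix i
    have "(\<lambda>w. w i) \<in> measurable ?SW S" by (rule measurable_component_singleton) simp
    from measurable_compose[OF this identity_measurable] show "(\<lambda>w. w i) \<in> borel_measurable ?SW" .
  qed
  have Fm: "(\<lambda>(w, j). F w j) \<in> borel_measurable (?SW \<Otimes>\<^sub>M ?SJ)"
  proof -
    let ?I = "PiE {..<N} (\<lambda>_. UNIV :: nat set)"
    have r: "(\<lambda>p. restrict (snd p) {..<N}) \<in> measurable (?SW \<Otimes>\<^sub>M ?SJ) (count_space ?I)"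
    proof -
      have "(\<lambda>j. restrict j {..<N}) \<in> measurable ?SJ (\<Pi>\<^sub>M k\<in>{..<N}. count_space UNIV)"
        by (rule measurable_restrict_subset) simp
      also have "(\<Pi>\<^sub>M k\<in>{..<N}. count_space UNIV) = count_space ?I"
        by (rule count_space_PiM_finite) simp_all
      finally show ?thesis by (rule measurable_compose[OF measurable_snd])
    qed
    have "countable ?I" by (intro countable_PiE) auto
    then have "(\<lambda>p. F (fst p) (restrict (snd p) {..<N})) \<in> borel_measurable (?SW \<Otimes>\<^sub>M ?SJ)"
      by (intro measurable_compose_countable'[OF _ r, where f = "\<lambda>j p. F (fst p) j"])
        (auto intro: measurable_compose[OF measurable_fst Fw])
    then show ?thesis by (simp add: case_prod_beta Fr[symmetric])
  qed
  obtain c where c: "\<And>w j. (\<And>k. w k \<in> space S) \<Longrightarrow> \<bar>F w j\<bar> \<le> c"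
    unfolding F_def using potential_bounded[of x0 N] by blast
  have mW: "(\<lambda>\<omega>. (?W \<omega>, ?J \<omega>)) \<in> measurable P (?SW \<Otimes>\<^sub>M ?SJ)" using Wm JM by measurable
  have "(\<lambda>\<omega>. F (?W \<omega>) (?J \<omega>)) \<in> borel_measurable P" using measurable_compose[OF mW Fm] by simp
  then show "integrable P (\<lambda>\<omega>. potential x0 (\<lambda>k. W k \<omega>) (\<lambda>k. J k \<omega>) N)"
    unfolding F_def[symmetric] by (rule integrable_bounded_real) (rule c, rule W_space)
  interpret LW: prob_space ?LW by (rule prob_space_distr[OF Wm])
  interpret LJ: prob_space ?LJ by (rule prob_space_distr[OF JM])
  interpret pair: pair_prob_space ?LW ?LJ by unfold_locales
  have spW: "w k \<in> space S" if "w \<in> space ?SW" for w k using that by (auto simp: space_PiM)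
  have iF: "integrable (?LW \<Otimes>\<^sub>M ?LJ) (\<lambda>(w, j). F w j)"
  proof (rule pair.integrable_bounded_real)
    show "(\<lambda>(w, j). F w j) \<in> borel_measurable (?LW \<Otimes>\<^sub>M ?LJ)" using Fm by simp
    show "\<bar>case p of (w, j) \<Rightarrow> F w j\<bar> \<le> c" if "p \<in> space (?LW \<Otimes>\<^sub>M ?LJ)" for p
      using that c spW by (auto simp: space_pair_measure)
  qed
  have "(\<integral>\<omega>. F (?W \<omega>) (?J \<omega>) \<partial>P) = (\<integral>p. (case p of (w, j) \<Rightarrow> F w j) \<partial>(?LW \<Otimes>\<^sub>M ?LJ))"
    unfolding joint[symmetric] using integral_distr[OF mW Fm] by simp
  also have "\<dots> = (\<integral>j. (\<integral>w. F w j \<partial>?LW) \<partial>?LJ)"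
    using pair.integral_snd[OF iF] by simp
  also have "\<dots> = (\<integral>j. mean_potential x0 j N \<partial>?LJ)"
    unfolding integral_distr[OF Wm Fw] unfolding mean_potential_def F_def ..
  also have "\<dots> = (\<integral>j. mean_potential x0 (restrict j {..<N}) N \<partial>?LJ)"
    by (intro Bochner_Integration.integral_cong refl mean_potential_cong) simp
  also have "\<dots> = (\<integral>j. mean_potential x0 j N \<partial>(\<Pi>\<^sub>M i\<in>{..<N}. level_law))"
  proof (cases "N = 0")
    case True
    have "mean_potential x0 j 0 = lyapunov U x0 x0" for j
      by (simp add: mean_potential_def potential_def trajectory_def prob_space)
    then show ?thesis using True LJ.prob_space by (simp add: PiM_empty)
  next
    case False
    let ?SN = "\<Pi>\<^sub>M i\<in>{..<N}. (count_space UNIV :: nat measure)"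
    have "indep_vars (\<lambda>_. count_space UNIV) J {..<N}" by (rule indep_vars_subset[OF Ji]) simp
    then have d: "distr P ?SN (\<lambda>\<omega>. \<lambda>i\<in>{..<N}. J i \<omega>) = (\<Pi>\<^sub>M i\<in>{..<N}. level_law)"
      using False by (subst (asm) indep_vars_iff_distr_eq_PiM) (auto simp: Jd Jm)
    have r: "(\<lambda>j. restrict j {..<N}) \<in> measurable ?SJ ?SN" by (rule measurable_restrict_subset) simp
    have m: "f \<in> borel_measurable ?SN" for f :: "(nat \<Rightarrow> nat) \<Rightarrow> real"
      by (subst count_space_PiM_finite) simp_all
    have "(\<integral>j. mean_potential x0 (restrict j {..<N}) N \<partial>?LJ) = (\<integral>\<omega>. mean_potential x0 (restrict (?J \<omega>) {..<N}) N \<partial>P)"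
      by (rule integral_distr[OF JM measurable_compose[OF r m]])
    also have "\<dots> = (\<integral>j. mean_potential x0 j N \<partial>distr P ?SN (\<lambda>\<omega>. \<lambda>i\<in>{..<N}. J i \<omega>))"
      by (rule integral_distr[OF measurable_compose[OF JM r] m, symmetric])
    finally show ?thesis unfolding d .
  qed
  finally show "(\<integral>\<omega>. potential x0 (\<lambda>k. W k \<omega>) (\<lambda>k. J k \<omega>) N \<partial>P)
      = (\<integral>j. mean_potential x0 j N \<partial>(\<Pi>\<^sub>M i\<in>{..<N}. level_law))"
    unfolding F_def .
qed

end

context accelerated_gossip
begin

lemma random_trajectory_measurable:
  assumes J: "\<And>k. J k \<in> measurable P (count_space UNIV)"
  shows "(\<lambda>\<omega>. fst (trajectory x0 (\<lambda>k. W k \<omega>) (\<lambda>k. J k \<omega>) N)) \<in> borel_measurable P"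
    and "(\<lambda>\<omega>. fst (snd (trajectory x0 (\<lambda>k. W k \<omega>) (\<lambda>k. J k \<omega>) N))) \<in> borel_measurable P"
proof -
  let ?I = "PiE {..<N} (\<lambda>_. UNIV :: nat set)"
  have g: "(\<lambda>\<omega>. \<lambda>k\<in>{..<N}. J k \<omega>) \<in> measurable P (count_space ?I)"
  proof -
    have "(\<lambda>\<omega>. \<lambda>k\<in>{..<N}. J k \<omega>) \<in> measurable P (\<Pi>\<^sub>M k\<in>{..<N}. count_space UNIV)"
      by (rule measurable_restrict) (rule J)
    also have "(\<Pi>\<^sub>M k\<in>{..<N}. count_space UNIV) = count_space ?I"
      by (rule count_space_PiM_finite) simp_all
    finally show ?thesis .
  qed
  have cI: "countable ?I" by (intro countable_PiE) auto
  have m: "(\<lambda>\<omega>. fst (trajectory x0 (\<lambda>k. W k \<omega>) j N)) \<in> borel_measurable P"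
    "(\<lambda>\<omega>. fst (snd (trajectory x0 (\<lambda>k. W k \<omega>) j N))) \<in> borel_measurable P" for j
    unfolding trajectory_def using acc_consensus_measurable[where V = W and N = P, OF W_measurable_P] by blast+
  have e: "trajectory x0 w (\<lambda>k. J k \<omega>) N = trajectory x0 w (\<lambda>k\<in>{..<N}. J k \<omega>) N" for w \<omega>
    unfolding trajectory_def by (rule acc_consensus_cong) simp
  show "(\<lambda>\<omega>. fst (trajectory x0 (\<lambda>k. W k \<omega>) (\<lambda>k. J k \<omega>) N)) \<in> borel_measurable P"
    unfolding e by (rule measurable_compose_countable'[OF m(1) g cI])
  show "(\<lambda>\<omega>. fst (snd (trajectory x0 (\<lambda>k. W k \<omega>) (\<lambda>k. J k \<omega>) N))) \<in> borel_measurable P"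
    unfolding e by (rule measurable_compose_countable'[OF m(2) g cI])
qed

lemma expected_gap_decay:
  fixes N :: nat
  assumes J: "geometric_batches P S W J" and x0: "1 \<bullet> x0 = 0"
  defines "gap \<equiv> \<lambda>x y. (norm x)\<^sup>2 + 24 * (y \<bullet> U y)"
  defines "G \<equiv> \<lambda>\<omega>. gap (fst (trajectory x0 (\<lambda>k. W k \<omega>) (\<lambda>k. J k \<omega>) N)) (fst (snd (trajectory x0 (\<lambda>k. W k \<omega>) (\<lambda>k. J k \<omega>) N)))"
  shows "integrable P G" and "(\<integral>\<omega>. G \<omega> \<partial>P) \<le> 6 * (exp (- real N * (\<beta> / 2)) * gap x0 x0)"
proof -
  let ?pot = "\<lambda>\<omega>. potential x0 (\<lambda>k. W k \<omega>) (\<lambda>k. J k \<omega>) N"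
  have Jm: "J k \<in> measurable P (count_space UNIV)" for k
    using J unfolding geometric_batches_def by (rule conjunct1[THEN spec])
  note m = random_trajectory_measurable[where J = J, OF Jm]
  have n: "(\<lambda>\<omega>. norm (f \<omega>)) \<in> borel_measurable P" if "f \<in> borel_measurable P" for f :: "'o \<Rightarrow> real^'n"
    using that by measurable
  have Gm: "G \<in> borel_measurable P"
    unfolding G_def gap_def U_def
    by (intro borel_measurable_add borel_measurable_times borel_measurable_const borel_measurable_power n m
        borel_measurable_inner borel_measurable_scaleR borel_measurable_matrix_vector_mult)
  have G0: "0 \<le> G \<omega>" for \<omega> unfolding G_def gap_def using U_psd by simp
  have Gp: "G \<omega> \<le> 3 * ?pot \<omega>" if "\<omega> \<in> space P" for \<omega>
    unfolding G_def gap_def potential_def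
    by (rule lyapunov_gap_equivalence(2)[OF U_lower]) (rule trajectory_mean_zero[where w = "\<lambda>k. W k \<omega>", OF W_space[OF that] x0, THEN conjunct2])
  have pi: "integrable P (\<lambda>\<omega>. 3 * ?pot \<omega>)" using expected_potential_eq(1)[OF J] by simp
  show Gi: "integrable P G"
    by (rule Bochner_Integration.integrable_bound[OF pi Gm]) (use G0 Gp potential_nonneg in \<open>auto intro!: AE_I2\<close>)
  have "(\<integral>\<omega>. G \<omega> \<partial>P) \<le> (\<integral>\<omega>. 3 * ?pot \<omega> \<partial>P)" by (rule integral_mono[OF Gi pi Gp])
  also have "\<dots> = 3 * (\<integral>j. mean_potential x0 j N \<partial>(\<Pi>\<^sub>M i\<in>{..<N}. level_law))"
    using expected_potential_eq(2)[OF J] by simp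
  also have "\<dots> \<le> 3 * ((1 - \<beta> / 2) ^ N * lyapunov U x0 x0)"
    by (intro mult_left_mono averaged_potential_decay[OF x0]) simp
  also have "\<dots> \<le> 3 * (exp (- real N * (\<beta> / 2)) * (2 * gap x0 x0))"
  proof (intro mult_left_mono mult_mono)
    have "1 + - (\<beta> / 2) \<le> exp (- (\<beta> / 2))" by (rule exp_ge_add_one_self)
    then have "(1 - \<beta> / 2) ^ N \<le> exp (- (\<beta> / 2)) ^ N" using beta by (intro power_mono) auto
    also have "\<dots> = exp (- real N * (\<beta> / 2))" by (simp add: exp_of_nat_mult[symmetric])
    finally show "(1 - \<beta> / 2) ^ N \<le> exp (- real N * (\<beta> / 2))" .
    show "lyapunov U x0 x0 \<le> 2 * gap x0 x0" unfolding gap_def by (rule lyapunov_gap_equivalence(1)[where U = U, OF U_lower[OF x0]])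
  qed (auto intro: lyapunov_nonneg)
  finally show "(\<integral>\<omega>. G \<omega> \<partial>P) \<le> 6 * (exp (- real N * (\<beta> / 2)) * gap x0 x0)" by simp
qed

end

section \<open>Consequences of the choice of parameters\<close>

text \<open>The two bounds on \<open>\<gamma>\<close>, expressed in terms of \<open>\<beta>\<close>. The constant \<open>6000\<close> rounds down
  \<open>1800 \<surd>12\<close>.\<close>

lemma stepsize_consequences:
  fixes lam L \<gamma> \<beta> \<rho> :: real and \<tau> b :: nat
  assumes lam: "0 < lam" and L: "lam \<le> L" and g: "0 < \<gamma>" "\<gamma> < 3 / (4 * L)"
    and g2: "\<rho> = 0 \<or> \<gamma> < lam ^ 3 / (1800 * \<rho>\<^sup>2 * (real \<tau> / real b + (real \<tau>)\<^sup>2 / (real b)\<^sup>2))\<^sup>2"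
    and tau: "\<tau> \<ge> 1" and b: "b \<ge> 1"
    and \<beta>: "\<beta> = sqrt (4 * (1/4)\<^sup>2 * lam * \<gamma> / 3)"
  shows "0 < \<beta>" "\<beta> \<le> 1 / 4" "\<gamma> = 12 * \<beta>\<^sup>2 / lam" "\<gamma> * L \<le> 3 / 4"
    "6000 * (\<rho>\<^sup>2 * (real \<tau> / real b + (real \<tau>)\<^sup>2 / (real b)\<^sup>2)) * \<beta> \<le> lam\<^sup>2"
proof -
  have Lp: "L > 0" using lam L by simp
  have b2: "\<beta>\<^sup>2 = lam * \<gamma> / 12" unfolding \<beta> using lam g by (simp add: power2_eq_square)
  show bp: "0 < \<beta>" unfolding \<beta> using lam g by simp
  show gb: "\<gamma> = 12 * \<beta>\<^sup>2 / lam" unfolding b2 using lam by simp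
  show gL: "\<gamma> * L \<le> 3 / 4" using g Lp by (simp add: field_simps)
  have "lam * \<gamma> \<le> \<gamma> * L" using L g by simp
  then have "\<beta>\<^sup>2 \<le> (1 / 4)\<^sup>2" using gL b2 by (simp add: power2_eq_square)
  then show "\<beta> \<le> 1 / 4" by (rule power2_le_imp_le) simp
  define \<delta> where "\<delta> = \<rho>\<^sup>2 * (real \<tau> / real b + (real \<tau>)\<^sup>2 / (real b)\<^sup>2)"
  have "6000 * \<delta> * \<beta> \<le> lam\<^sup>2"
  proof (cases "\<rho> = 0")
    case False
    then have d: "\<delta> > 0" unfolding \<delta>_def using tau b by (intro mult_pos_pos add_pos_pos divide_pos_pos) auto
    have "\<gamma> < lam ^ 3 / (1800 * \<delta>)\<^sup>2" using g2 False by (simp add: \<delta>_def mult.assoc)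
    then have "\<gamma> * (1800 * \<delta>)\<^sup>2 < lam ^ 3" using d by (simp add: pos_less_divide_eq)
    then have "lam * (\<gamma> * (1800 * \<delta>)\<^sup>2) \<le> lam * lam ^ 3" using lam by (intro mult_left_mono) auto
    also have "lam * (\<gamma> * (1800 * \<delta>)\<^sup>2) = 12 * \<beta>\<^sup>2 * (1800 * \<delta>)\<^sup>2" unfolding b2 by simp
    also have "\<dots> = 38880000 * (\<beta>\<^sup>2 * \<delta>\<^sup>2)" by (simp add: power_mult_distrib)
    also have "lam * lam ^ 3 = (lam\<^sup>2)\<^sup>2" by (simp add: power2_eq_square power3_eq_cube)
    finally have "38880000 * (\<beta>\<^sup>2 * \<delta>\<^sup>2) \<le> (lam\<^sup>2)\<^sup>2" .
    moreover have "0 \<le> \<beta>\<^sup>2 * \<delta>\<^sup>2" by simp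
    ultimately have "36000000 * (\<beta>\<^sup>2 * \<delta>\<^sup>2) \<le> (lam\<^sup>2)\<^sup>2" by linarith
    then have "(6000 * \<delta> * \<beta>)\<^sup>2 \<le> (lam\<^sup>2)\<^sup>2" by (simp add: power_mult_distrib mult.commute)
    then show ?thesis by (rule power2_le_imp_le) simp
  qed (simp add: \<delta>_def)
  then show "6000 * (\<rho>\<^sup>2 * (real \<tau> / real b + (real \<tau>)\<^sup>2 / (real b)\<^sup>2)) * \<beta> \<le> lam\<^sup>2" by (simp only: \<delta>_def)
qed

text \<open>The lengths \<open>2\<^sup>m B\<close> and \<open>B\<close> are long enough: \<open>2\<^sup>m > M / 2\<close> with \<open>M\<^sup>2 \<ge> 1 / (2 \<beta>)\<close> controls the
  bias, and \<open>B \<ge> b log\<^sub>2 M \<ge> b m\<close> pays for the \<open>m\<close> levels in the variance.\<close>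

lemma batch_consequences:
  fixes lam \<beta> \<rho> M :: real and \<tau> b B :: nat
  assumes lam: "0 < lam" and \<rho>: "0 \<le> \<rho>" and tau: "\<tau> \<ge> 1" and b: "b \<ge> 1" and \<beta>: "0 < \<beta>"
    and small: "6000 * (\<rho>\<^sup>2 * (real \<tau> / real b + (real \<tau>)\<^sup>2 / (real b)\<^sup>2)) * \<beta> \<le> lam\<^sup>2"
    and M: "M = max 2 (sqrt (1/4 * (1 + 2 / \<beta>)))" and B: "int B = \<lceil>real b * log 2 M\<rceil>"
  shows "\<exists>m :: nat. (\<forall>i. 2 ^ i \<le> M \<longleftrightarrow> i \<le> m) \<and> m \<ge> 1 \<and> B \<ge> 1 \<and>
    8 / 3 * (real \<tau> * \<rho>) \<le> lam / 10 * (2 ^ m * real B) \<and>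
    \<beta> * (14 * real m * (19 / 3 * real \<tau> * \<rho>\<^sup>2)) \<le> 148 / 10000 * lam\<^sup>2 * real B"
proof -
  define m where "m = nat \<lfloor>log 2 M\<rfloor>"
  have M2: "M \<ge> 2" unfolding M by simp
  then have l1: "log 2 M \<ge> 1" by (simp add: le_log_iff)
  have lev: "2 ^ i \<le> M \<longleftrightarrow> i \<le> m" for i
  proof -
    have "2 ^ i \<le> M \<longleftrightarrow> real i \<le> log 2 M" using M2 by (simp add: le_log_iff powr_realpow)
    also have "\<dots> \<longleftrightarrow> i \<le> m" unfolding m_def using l1 by (simp add: le_nat_iff le_floor_iff)
    finally show ?thesis .
  qed
  have m1: "m \<ge> 1" using lev[of 1] M2 by simp
  have ml: "real m \<le> log 2 M" unfolding m_def using l1 by simp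
  have Bl: "real B \<ge> real b * log 2 M"
  proof -
    have "real B = of_int \<lceil>real b * log 2 M\<rceil>" using B by (metis of_int_of_nat_eq)
    then show ?thesis by (simp only: le_of_int_ceiling)
  qed
  have Bb: "real B \<ge> real b" using Bl mult_left_mono[OF l1, of "real b"] by simp
  have Bm: "real B \<ge> real b * real m" using Bl mult_left_mono[OF ml, of "real b"] by simp
  have B1: "B \<ge> 1" using Bb b by simp
  have b0: "real b > 0" using b by simp
  have two: "M / 2 \<le> 2 ^ m" using lev[of "Suc m"] by simp
  have MM: "1 / (2 * \<beta>) \<le> M\<^sup>2"
  proof -
    have "1/4 * (1 + 2 / \<beta>) = (sqrt (1/4 * (1 + 2 / \<beta>)))\<^sup>2" using \<beta> by simp
    also have "\<dots> \<le> M\<^sup>2" unfolding M using \<beta> by (intro power_mono) auto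
    finally show ?thesis using \<beta> by (simp add: field_simps)
  qed
  define \<kappa> where "\<kappa> = (real \<tau>)\<^sup>2 / (real b)\<^sup>2"
  have k0: "\<kappa> \<ge> 0" and t0: "real \<tau> / real b \<ge> 0" by (auto simp: \<kappa>_def)
  have "6000 * (\<rho>\<^sup>2 * \<kappa>) * \<beta> \<le> 6000 * (\<rho>\<^sup>2 * (real \<tau> / real b + \<kappa>)) * \<beta>"
    using t0 \<beta> by (intro mult_right_mono mult_left_mono) auto
  then have s1: "6000 * (\<rho>\<^sup>2 * \<kappa>) * \<beta> \<le> lam\<^sup>2" using small by (simp add: \<kappa>_def)
  have "6000 * (\<rho>\<^sup>2 * (real \<tau> / real b)) * \<beta> \<le> 6000 * (\<rho>\<^sup>2 * (real \<tau> / real b + \<kappa>)) * \<beta>"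
    using k0 \<beta> by (intro mult_right_mono mult_left_mono) auto
  then have s2: "6000 * (\<rho>\<^sup>2 * (real \<tau> / real b)) * \<beta> \<le> lam\<^sup>2" using small by (simp add: \<kappa>_def)
  have bias: "8 / 3 * (real \<tau> * \<rho>) \<le> lam / 10 * (2 ^ m * real B)"
  proof (rule power2_le_imp_le)
    have "(8 / 3 * (real \<tau> * \<rho>))\<^sup>2 = 64 / 9 * (real b)\<^sup>2 * (\<rho>\<^sup>2 * \<kappa>)"
      using b0 by (simp add: \<kappa>_def power_mult_distrib power_divide)
    also have "\<dots> \<le> 64 / 9 * (real b)\<^sup>2 * (lam\<^sup>2 / (6000 * \<beta>))"
    proof (rule mult_left_mono)
      show "\<rho>\<^sup>2 * \<kappa> \<le> lam\<^sup>2 / (6000 * \<beta>)" using s1 \<beta> by (simp add: pos_le_divide_eq algebra_simps)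
    qed simp
    also have "\<dots> \<le> (lam / 10)\<^sup>2 * ((real b)\<^sup>2 * (1 / (2 * \<beta>) / 4))"
    proof -
      have "64 / 9 * (1 / 6000) * ((real b)\<^sup>2 * lam\<^sup>2 / \<beta>) \<le> 1 / 800 * ((real b)\<^sup>2 * lam\<^sup>2 / \<beta>)"
        using \<beta> by (intro mult_right_mono) auto
      then show ?thesis by (simp add: power_divide algebra_simps)
    qed
    also have "\<dots> \<le> (lam / 10)\<^sup>2 * ((real b)\<^sup>2 * (2 ^ m)\<^sup>2)"
    proof (intro mult_left_mono)
      have "(M / 2)\<^sup>2 \<le> (2 ^ m)\<^sup>2" using two M2 by (intro power_mono) auto
      then show "1 / (2 * \<beta>) / 4 \<le> (2 ^ m)\<^sup>2" using MM by (simp add: power_divide)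
    qed auto
    also have "\<dots> \<le> (lam / 10)\<^sup>2 * ((real B)\<^sup>2 * (2 ^ m)\<^sup>2)"
      using Bb by (intro mult_left_mono mult_right_mono power_mono) auto
    finally show "(8 / 3 * (real \<tau> * \<rho>))\<^sup>2 \<le> (lam / 10 * (2 ^ m * real B))\<^sup>2"
      by (simp only: power_mult_distrib mult.commute)
  qed (use lam in simp)
  \<comment> \<open>\<open>14 \<cdot> 19/3 / 6000 = 266 / 18000\<close> is just below the allowance \<open>148 / 10000\<close>\<close>
  have var: "\<beta> * (14 * real m * (19 / 3 * real \<tau> * \<rho>\<^sup>2)) \<le> 148 / 10000 * lam\<^sup>2 * real B"
  proof -
    have "\<beta> * (14 * real m * (19 / 3 * real \<tau> * \<rho>\<^sup>2)) = 266 / 18000 * (real b * real m) * (6000 * (\<rho>\<^sup>2 * (real \<tau> / real b)) * \<beta>)"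
      using b0 by simp
    also have "\<dots> \<le> 266 / 18000 * (real b * real m) * lam\<^sup>2"
      using s2 by (intro mult_left_mono) auto
    also have "\<dots> \<le> 148 / 10000 * real B * lam\<^sup>2"
      using Bm by (intro mult_right_mono mult_mono) auto
    finally show ?thesis by (simp add: algebra_simps)
  qed
  show ?thesis by (intro exI[of _ m] conjI allI lev m1 B1 bias var)
qed

section \<open>Convergence of accelerated consensus\<close>

theorem theorem1:
  shows "\<exists>C>0.
    \<forall>(P :: 'o measure) (S :: (real^'n::finite^'n) measure) Q \<pi> W J G E Wt R \<tau> \<rho>
      (b :: nat) \<gamma> p \<beta> \<theta> \<eta> M (B :: nat) x\<^sub>0 N.
      prob_space P \<and>
      (\<forall>H\<in>G. simple_graph H) \<and>
      (\<forall>A\<in>space S. \<exists>H\<in>G. gossip_matrix H A) \<and>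
      \<comment> \<open>column sums vanish (automatic for symmetric \<open>A\<close>), so the constraint on \<open>x\<close> is preserved\<close>
      (\<forall>A\<in>space S. 1 v* A = 0) \<and>
      markov_chain P S Q W \<and>
      invariant_distribution S Q \<pi> \<and>
      (\<forall>\<pi>'. invariant_distribution S Q \<pi>' \<longrightarrow> \<pi>' = \<pi>) \<and>
      uniformly_geometrically_ergodic S Q \<tau> \<and>
      integrable \<pi> (\<lambda>A. A) \<and> (\<integral>A. A \<partial>\<pi>) = Wt \<and>
      simple_graph E \<and> connected_graph E \<and> gossip_matrix E Wt \<and>
      (\<forall>A\<in>space S. op_norm (A - Wt) \<le> \<rho>) \<and>
      matrix_sqrt R Wt \<and>
      geometric_batches P S W J \<and>
      \<comment> \<open>the second bound on \<open>\<gamma>\<close> is void if \<open>\<rho> = 0\<close>\<close>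
      b \<ge> 1 \<and>
      0 < \<gamma> \<and> \<gamma> < 3 / (4 * lambda_max Wt) \<and>
      (\<rho> = 0 \<or>
        \<gamma> < lambda_min_pos Wt ^ 3 / (1800 * \<rho>\<^sup>2 * (real \<tau> / real b + (real \<tau>)\<^sup>2 / (real b)\<^sup>2))\<^sup>2) \<and>
      p = 1/4 \<and>
      \<beta> = sqrt (4 * p\<^sup>2 * lambda_min_pos Wt * \<gamma> / 3) \<and>
      \<eta> = 3 * \<beta> / (p * lambda_min_pos Wt * \<gamma>) \<and>
      \<theta> = (p / \<eta> - 1) / (\<beta> * p / \<eta> - 1) \<and>
      M = max 2 (sqrt (1/4 * (1 + 2 / \<beta>))) \<and>
      int B = \<lceil>real b * log 2 M\<rceil>
      \<longrightarrow>
      (let gap = consensus_gap R (lambda_min_pos Wt) (average_vec x\<^sub>0);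
           final = (\<lambda>\<omega>. let (x, x\<^sub>f, T) = acc_consensus \<gamma> \<theta> \<eta> \<beta> p M B x\<^sub>0
                              (\<lambda>k. W k \<omega>) (\<lambda>k. J k \<omega>) N
                        in gap x x\<^sub>f)
       in integrable P final \<and>
          (\<integral>\<omega>. final \<omega> \<partial>P)
            \<le> C * (exp (- real N * sqrt (p\<^sup>2 * lambda_min_pos Wt * \<gamma> / 3)) * gap x\<^sub>0 x\<^sub>0))"
proof (rule exI[of _ 6], intro conjI allI impI, simp, elim conjE)
  fix P :: "'o measure" and S :: "(real^'n::finite^'n) measure"
    and Q \<pi> W J G E Wt R \<tau> \<rho> and b :: nat and \<gamma> p \<beta> \<theta> \<eta> M and B :: nat
    and x\<^sub>0 :: "real^'n" and N :: nat
  assume P: "prob_space P"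
    and gossip: "\<forall>A\<in>space S. \<exists>H\<in>G. gossip_matrix H A"
    and col: "\<forall>A\<in>space S. 1 v* A = 0"
    and chain: "markov_chain P S Q W" and inv: "invariant_distribution S Q \<pi>"
    and erg: "uniformly_geometrically_ergodic S Q \<tau>"
    and int: "integrable \<pi> (\<lambda>A. A)" and mean: "(\<integral>A. A \<partial>\<pi>) = Wt"
    and gW: "gossip_matrix E Wt" and dev: "\<forall>A\<in>space S. op_norm (A - Wt) \<le> \<rho>"
    and R: "matrix_sqrt R Wt" and J: "geometric_batches P S W J" and b: "b \<ge> 1"
    and g: "0 < \<gamma>" "\<gamma> < 3 / (4 * lambda_max Wt)"
    and g2: "\<rho> = 0 \<or> \<gamma> < lambda_min_pos Wt ^ 3 / (1800 * \<rho>\<^sup>2 * (real \<tau> / real b + (real \<tau>)\<^sup>2 / (real b)\<^sup>2))\<^sup>2"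
    and p: "p = 1/4" and \<beta>: "\<beta> = sqrt (4 * p\<^sup>2 * lambda_min_pos Wt * \<gamma> / 3)"
    and \<eta>: "\<eta> = 3 * \<beta> / (p * lambda_min_pos Wt * \<gamma>)"
    and \<theta>: "\<theta> = (p / \<eta> - 1) / (\<beta> * p / \<eta> - 1)"
    and M: "M = max 2 (sqrt (1/4 * (1 + 2 / \<beta>)))" and B: "int B = \<lceil>real b * log 2 M\<rceil>"
  define lam where "lam = lambda_min_pos Wt"
  have ker: "{x. Wt *v x = 0} = {x. \<forall>i j. x $ i = x $ j}" using gW unfolding gossip_matrix_def by (rule conjunct2)
  \<comment> \<open>on a single node \<open>lambda_max Wt = 0\<close>, and the interval for \<open>\<gamma>\<close> is empty\<close>
  have Lpos: "lambda_max Wt > 0"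
  proof (rule ccontr)
    assume "\<not> lambda_max Wt > 0"
    then have "3 / (4 * lambda_max Wt) \<le> 0" by (intro divide_nonneg_nonpos) auto
    then show False using g by linarith
  qed
  note spec = R ker Lpos
  have lam: "0 < lam" unfolding lam_def by (rule lambda_min_pos_positive[OF spec])
  have lamL: "lam \<le> lambda_max Wt" unfolding lam_def by (rule lambda_min_pos_le_max[OF spec])
  have tau: "\<tau> \<ge> 1" using erg unfolding uniformly_geometrically_ergodic_def by (rule conjunct1)
  note step = stepsize_consequences[OF lam lamL g g2[folded lam_def] tau b \<beta>[folded lam_def, unfolded p]]
  interpret prob_space P by (rule P)
  interpret gc: gossip_chain P S Q W \<pi> \<tau> Wt \<rho>
    by unfold_locales (use chain inv erg int mean dev in blast)+
  obtain m where lev: "\<And>i. 2 ^ i \<le> M \<longleftrightarrow> i \<le> m" and m1: "m \<ge> 1" and B1: "B \<ge> 1"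
    and bias: "8 / 3 * (real \<tau> * \<rho>) \<le> lam / 10 * (2 ^ m * real B)"
    and var: "\<beta> * (14 * real m * (19 / 3 * real \<tau> * \<rho>\<^sup>2)) \<le> 148 / 10000 * lam\<^sup>2 * real B"
    using batch_consequences[OF lam gc.deviation_nonneg tau b step(1) step(5) M B] by (elim exE conjE) auto
  note sym = symmetric_inner[OF matrix_sqrt_transpose[OF R]]
  have b2: "\<beta>\<^sup>2 = lam * \<gamma> / 12" using step(3) lam by simp
  have scale: "\<beta>\<^sup>2 * t \<le> lam / 16 * s" if t: "t \<le> lambda_max Wt * s" and s: "0 \<le> s" for t s
  proof -
    have "\<gamma> * t \<le> \<gamma> * (lambda_max Wt * s)" using t g by (intro mult_left_mono) auto
    also have "\<dots> \<le> 3 / 4 * s" using mult_right_mono[OF step(4) s] by (simp add: mult.assoc)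
    finally have "lam / 12 * (\<gamma> * t) \<le> lam / 12 * (3 / 4 * s)" using lam by (intro mult_left_mono) auto
    then show ?thesis by (simp add: b2)
  qed
  have ones: "A *v c = 0" if A: "A \<in> space S" and c: "\<forall>i j. c $ i = c $ j" for A c
  proof -
    obtain H where "gossip_matrix H A" using gossip A by (elim ballE exE bexE) auto
    then have "{x. A *v x = 0} = {x. \<forall>i j. x $ i = x $ j}" unfolding gossip_matrix_def by (rule conjunct2)
    moreover have "c \<in> {x. \<forall>i j. x $ i = x $ j}" using c by simp
    ultimately have "c \<in> {x. A *v x = 0}" by (simp only:)
    then show ?thesis by simp
  qed
  interpret acc: accelerated_gossip P S Q W \<pi> \<tau> Wt \<rho> \<beta> lam M B m
  proof unfold_locales
    show "0 \<le> y \<bullet> (Wt *v y)" for y using matrix_sqrt_inner[OF R, of y y] by simp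
    show "\<beta>\<^sup>2 * (y \<bullet> (Wt *v y)) \<le> lam / 16 * (y \<bullet> y)" for y
      by (rule scale[OF rayleigh_upper[OF spec]]) simp
    show "\<beta>\<^sup>2 * norm (Wt *v y) \<le> lam / 16 * norm y" for y
      by (rule scale[OF norm_matrix_le_lambda_max[OF spec]]) simp
    show "lam * (y \<bullet> y) \<le> y \<bullet> (Wt *v y)" if "1 \<bullet> y = 0" for y
      unfolding lam_def by (rule rayleigh_lower[OF spec that])
  qed (fact step(1) step(2) lam sym lev m1 B1 bias var | use col in blast)+
  \<comment> \<open>translate the consensus value to the origin\<close>
  define xs where "xs = average_vec x\<^sub>0"
  define y0 where "y0 = x\<^sub>0 - xs"
  have x0: "x\<^sub>0 = y0 + xs" by (simp add: y0_def)
  have mz: "1 \<bullet> y0 = 0" unfolding y0_def xs_def by (rule mean_zero_minus_average)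
  have xsc: "\<forall>i j. xs $ i = xs $ j" by (simp add: xs_def average_vec_def)
  have \<eta>': "\<eta> = 1 / \<beta>"
  proof -
    have "lam * \<gamma> = 12 * \<beta>\<^sup>2" using b2 by simp
    then have "\<eta> = 3 * \<beta> / (1 / 4 * (12 * \<beta>\<^sup>2))" unfolding \<eta> p lam_def[symmetric] by (simp add: mult.assoc)
    then show ?thesis using step(1) by (simp add: power2_eq_square)
  qed
  have \<theta>': "\<theta> = (4 - \<beta>) / (4 - \<beta>\<^sup>2)"
  proof -
    have n: "p / \<eta> - 1 = - (1/4) * (4 - \<beta>)" unfolding \<eta>' p by (simp add: diff_divide_distrib)
    have d: "\<beta> * p / \<eta> - 1 = - (1/4) * (4 - \<beta>\<^sup>2)" unfolding \<eta>' p by (simp add: power2_eq_square diff_divide_distrib)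
    show ?thesis unfolding \<theta> n d by (rule mult_divide_mult_cancel_left) simp
  qed
  have traj: "acc_consensus \<gamma> \<theta> \<eta> \<beta> p M B y0 w j k = acc.trajectory y0 w j k" for w j k
    unfolding acc.trajectory_def p \<theta>' \<eta>' step(3)[symmetric] ..
  have "xs \<in> {x. Wt *v x = 0}" unfolding ker using xsc by simp
  then have Wxs: "Wt *v xs = 0" by simp
  have Rxs: "R *v xs = 0"
  proof -
    have "(R *v xs) \<bullet> (R *v xs) = 0" using matrix_sqrt_inner[OF R, of xs xs] Wxs by simp
    then show ?thesis by simp
  qed
  have gap: "consensus_gap R (lambda_min_pos Wt) xs (x + xs) (y + xs) = (norm x)\<^sup>2 + 24 * (y \<bullet> acc.U y)" for x y
  proof -
    have "(norm (R *v y))\<^sup>2 = y \<bullet> (Wt *v y)" by (simp add: power2_norm_eq_inner matrix_sqrt_inner[OF R])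
    then show ?thesis unfolding consensus_gap_def acc.U_def lam_def[symmetric]
      by (simp add: matrix_vector_right_distrib Rxs)
  qed
  have fin: "(let (x, x\<^sub>f, T) = acc_consensus \<gamma> \<theta> \<eta> \<beta> p M B x\<^sub>0 (\<lambda>k. W k \<omega>) (\<lambda>k. J k \<omega>) N
        in consensus_gap R (lambda_min_pos Wt) xs x x\<^sub>f)
     = (norm (fst (acc.trajectory y0 (\<lambda>k. W k \<omega>) (\<lambda>k. J k \<omega>) N)))\<^sup>2
       + 24 * (fst (snd (acc.trajectory y0 (\<lambda>k. W k \<omega>) (\<lambda>k. J k \<omega>) N)) \<bullet> acc.U (fst (snd (acc.trajectory y0 (\<lambda>k. W k \<omega>) (\<lambda>k. J k \<omega>) N))))"
    if w: "\<omega> \<in> space P" for \<omega>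
  proof -
    have "W k \<omega> *v xs = 0" for k by (rule ones[OF gc.W_space[OF w] xsc])
    from acc_consensus_shift[where w = "\<lambda>k. W k \<omega>", OF this]
    have "acc_consensus \<gamma> \<theta> \<eta> \<beta> p M B x\<^sub>0 (\<lambda>k. W k \<omega>) (\<lambda>k. J k \<omega>) N
       = (case acc.trajectory y0 (\<lambda>k. W k \<omega>) (\<lambda>k. J k \<omega>) N of (x, x\<^sub>f, T) \<Rightarrow> (x + xs, x\<^sub>f + xs, T))"
      unfolding x0 traj[symmetric] .
    then show ?thesis by (simp add: case_prod_beta gap)
  qed
  have rate: "sqrt (p\<^sup>2 * lambda_min_pos Wt * \<gamma> / 3) = \<beta> / 2"
  proof -
    have "\<beta> = sqrt (4 * (p\<^sup>2 * lambda_min_pos Wt * \<gamma> / 3))" unfolding \<beta> by (simp add: mult.assoc)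
    also have "\<dots> = 2 * sqrt (p\<^sup>2 * lambda_min_pos Wt * \<gamma> / 3)" by (simp only: real_sqrt_mult) simp
    finally show ?thesis by simp
  qed
  have g0: "consensus_gap R (lambda_min_pos Wt) xs x\<^sub>0 x\<^sub>0 = (norm y0)\<^sup>2 + 24 * (y0 \<bullet> acc.U y0)"
    unfolding x0 by (rule gap)
  note decay = acc.expected_gap_decay[OF J mz, of N]
  show "let gap = consensus_gap R (lambda_min_pos Wt) (average_vec x\<^sub>0);
           final = (\<lambda>\<omega>. let (x, x\<^sub>f, T) = acc_consensus \<gamma> \<theta> \<eta> \<beta> p M B x\<^sub>0
                              (\<lambda>k. W k \<omega>) (\<lambda>k. J k \<omega>) N
                        in gap x x\<^sub>f)
       in integrable P final \<and>
          (\<integral>\<omega>. final \<omega> \<partial>P)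
            \<le> 6 * (exp (- real N * sqrt (p\<^sup>2 * lambda_min_pos Wt * \<gamma> / 3)) * gap x\<^sub>0 x\<^sub>0)"
    unfolding xs_def[symmetric] Let_def[of "consensus_gap R (lambda_min_pos Wt) xs"]
    unfolding Let_def[of "\<lambda>\<omega>. (let (x, x\<^sub>f, T) = acc_consensus \<gamma> \<theta> \<eta> \<beta> p M B x\<^sub>0 (\<lambda>k. W k \<omega>) (\<lambda>k. J k \<omega>) N
        in consensus_gap R (lambda_min_pos Wt) xs x x\<^sub>f)"] rate g0
    using decay
    by (simp only: fin cong: Bochner_Integration.integrable_cong Bochner_Integration.integral_cong)
qed

end
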